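(* The distribution of a Wishart-random POVM of parameters $(d,k;s_1,s_2,\ldots,s_k)$ has the following density at a point $m=(m_1,\ldots,m_k)$, with respect to the Lebesgue measure on $k$-tuples of $d\times d$ Hermitian matrices: $$\frac{\mathrm d\mathbb P}{\mathrm d\mathrm{Leb}}(m_1,\ldots,m_k)=C_{d,k,s_1,\ldots,s_k}\,\mathbf 1_{\sum_j m_j=I_d}\,\prod_{i=1}^k\mathbf 1_{m_i\ge0}\,\det(m_i)^{s_i-d},$$ where $C_{d,k,s_1,\ldots,s_k}$ is a normalization constant.
   Context: A Wishart random matrix of parameters $(d,s)$ is $W=G^*G$, where $G\in\mathcal M_{s\times d}(\mathbb C)$ has i.i.d. complex standard Gaussian entries; Wishart matrices of parameters $(d,s)$ are also defined for all real $s\ge d$, through the density $C_{d,s}\mathbf 1_{w\ge0}\exp(-\operatorname{Tr}w)(\det w)^{s-d}$ with respect to the Lebesgue measure on $d\times d$ Hermitian matrices. A Wishart-random POVM of parameters $(d,k;s_1,\ldots,s_k)$ is the $k$-tuple $(M_1,\ldots,M_k)$ with $M_i=S^{-1/2}W_iS^{-1/2}$, where $W_1,\ldots,W_k$ are independent Wishart matrices of respective parameters $(d,s_i)$ and $S=\sum_{i=1}^kW_i$. $I_d$ is the $d\times d$ identity matrix. The factor $\mathbf 1_{\sum_j m_j=I_d}$ stands for the matrix Dirac delta function $\delta(I_d-\sum_j m_j)$, i.e. the density is supported on the affine subspace $\sum_jm_j=I_d$.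
   Formalization: All parameters are assumed to satisfy s_i ≥ d; for an integer s_i < d the matrix M_i is almost surely singular (or S is not invertible), so the stated density does not exist, e.g. d=2, k=2, s=(1,1). *)

theory Defs
  imports "HOL-Probability.Probability"
begin

text \<open>
  Matrices of size d are elements of \<open>complex^'d^'d\<close>, with d = \<open>CARD('d)\<close>;
  k-tuples of matrices are elements of \<open>(complex^'d^'d)^'k\<close>, with k = \<open>CARD('k)\<close>.
\<close>

definition adjoint_matrix :: "complex^'d^'d \<Rightarrow> complex^'d^'d" where
  "adjoint_matrix A = (\<chi> a b. cnj (A $ b $ a))"

definition hermitian :: "complex^'d^'d \<Rightarrow> bool" where
  "hermitian A \<longleftrightarrow> adjoint_matrix A = A"

definition psd :: "complex^'d^'d \<Rightarrow> bool" where
  "psd A \<longleftrightarrow> hermitian A \<and>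
     (\<forall>v::complex^'d. 0 \<le> Re (\<Sum>a\<in>UNIV. \<Sum>b\<in>UNIV. cnj (v $ a) * A $ a $ b * v $ b))"

definition psd_sqrt :: "complex^'d^'d \<Rightarrow> complex^'d^'d" where
  "psd_sqrt A = (THE R. psd R \<and> R ** R = A)"


subsection \<open>Lebesgue measure on Hermitian matrices\<close>

text \<open>
  Every Hermitian matrix is uniquely of the form (X + X^T)/2 + i (X - X^T)/2 with X a real
  d x d matrix, and this parametrisation is isometric for the Frobenius norms (see the lemmas
  below). Hence the image of \<open>lborel\<close> is the Lebesgue measure of the d^2-dimensional real
  Euclidean space of Hermitian matrices. In terms of the coordinates given by the diagonal and
  the real and imaginary parts above the diagonal, it is 2^(d(d-1)/2) times the product of
  one-dimensional Lebesgue measures.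
\<close>

definition herm_of :: "real^'d^'d \<Rightarrow> complex^'d^'d" where
  "herm_of X = (\<chi> a b. Complex ((X $ a $ b + X $ b $ a) / 2) ((X $ a $ b - X $ b $ a) / 2))"

definition lebesgue_herm :: "(complex^'d^'d) measure" where
  "lebesgue_herm = distr lborel borel herm_of"

lemma linear_herm_of: "linear herm_of"
  by (rule linearI) (simp_all add: herm_of_def vec_eq_iff complex_eq_iff field_simps)

lemma range_herm_of: "range herm_of = {A :: complex^'d^'d. hermitian A}"
proof (intro set_eqI iffI)
  fix A :: "complex^'d^'d"
  assume "A \<in> range herm_of"
  then show "A \<in> {A. hermitian A}"
    by (auto simp: herm_of_def hermitian_def adjoint_matrix_def vec_eq_iff complex_eq_iff field_simps)
next
  fix A :: "complex^'d^'d"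
  assume "A \<in> {A. hermitian A}"
  then have h: "cnj (A $ b $ a) = A $ a $ b" for a b
    by (simp add: hermitian_def adjoint_matrix_def vec_eq_iff)
  have re: "Re (A $ b $ a) = Re (A $ a $ b)" and im: "Im (A $ b $ a) = - Im (A $ a $ b)" for a b
    using arg_cong[OF h[of b a], of Re] arg_cong[OF h[of b a], of Im] by auto
  define X :: "real^'d^'d" where "X = (\<chi> a b. Re (A $ a $ b) + Im (A $ a $ b))"
  have "(X $ a $ b + X $ b $ a) / 2 = Re (A $ a $ b)" "(X $ a $ b - X $ b $ a) / 2 = Im (A $ a $ b)"
    for a b using re[of a b] im[of a b] by (simp_all add: X_def)
  then have "herm_of X = A"
    by (simp add: herm_of_def vec_eq_iff complex_eq_iff)
  then show "A \<in> range herm_of"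
    by blast
qed

lemma norm_herm_of: "norm (herm_of X) = norm X"
proof -
  have s: "(norm (herm_of X))\<^sup>2 = (\<Sum>a\<in>UNIV. \<Sum>b\<in>UNIV. ((X $ a $ b)\<^sup>2 + (X $ b $ a)\<^sup>2) / 2)"
    unfolding power2_norm_eq_inner inner_vec_def
    by (intro sum.cong refl)
       (simp add: herm_of_def inner_complex_def power2_eq_square field_simps)
  have t: "(norm X)\<^sup>2 = (\<Sum>a\<in>UNIV. \<Sum>b\<in>UNIV. (X $ a $ b)\<^sup>2)"
    unfolding power2_norm_eq_inner inner_vec_def by (simp add: power2_eq_square)
  have "(\<Sum>a\<in>UNIV. \<Sum>b\<in>UNIV. (X $ b $ a)\<^sup>2) = (\<Sum>a\<in>UNIV. \<Sum>b\<in>UNIV. (X $ a $ b)\<^sup>2)"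
    by (rule sum.swap)
  then have "(norm (herm_of X))\<^sup>2 = (norm X)\<^sup>2"
    unfolding s t by (simp add: sum_divide_distrib[symmetric] sum.distrib)
  then show ?thesis
    by simp
qed


subsection \<open>Wishart matrices\<close>

text \<open>The complex standard Gaussian is normalised by E |z|^2 = 1.\<close>

definition std_complex_gaussian :: "complex measure" where
  "std_complex_gaussian = density lborel (\<lambda>z. ennreal (exp (- (cmod z)\<^sup>2) / pi))"

text \<open>
  The law of G* G for an n x d matrix G with independent standard Gaussian entries
  \<open>G (l, a)\<close>, \<open>l < n\<close>.
\<close>

definition wishart_gram :: "nat \<Rightarrow> (complex^'d^'d) measure" where
  "wishart_gram n =
     distr (\<Pi>\<^sub>M p\<in>{..<n} \<times> (UNIV::'d set). std_complex_gaussian) borel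
       (\<lambda>G. \<chi> a b. \<Sum>l<n. cnj (G (l, a)) * G (l, b))"

text \<open>
  Determinants and traces of Hermitian matrices are real. The library convention
  \<open>0 powr 0 = 0\<close> only affects the null set of singular matrices.
\<close>

definition wishart_weight :: "real \<Rightarrow> complex^'d^'d \<Rightarrow> real" where
  "wishart_weight s w =
     indicator {w. psd w} w * exp (- Re (trace w)) * Re (det w) powr (s - real CARD('d))"

definition wishart_density :: "real \<Rightarrow> (complex^'d^'d) measure" where
  "wishart_density s =
     density lebesgue_herm
       (\<lambda>w. ennreal (wishart_weight s w / (\<integral>u. wishart_weight s (u :: complex^'d^'d) \<partial>lebesgue_herm)))"

definition wishart_matrix :: "'w measure \<Rightarrow> real \<Rightarrow> ('w \<Rightarrow> complex^'d^'d) \<Rightarrow> bool" where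
  "wishart_matrix M s W \<longleftrightarrow> W \<in> borel_measurable M \<and>
     ((\<exists>n::nat. s = real n \<and> distr M borel W = wishart_gram n) \<or>
      (real CARD('d) \<le> s \<and> distr M borel W = wishart_density s))"


subsection \<open>Wishart-random POVMs\<close>

definition normalize_povm :: "(complex^'d^'d)^'k \<Rightarrow> (complex^'d^'d)^'k" where
  "normalize_povm w =
     (let T = matrix_inv (psd_sqrt (\<Sum>i\<in>UNIV. w $ i)) in \<chi> i. T ** w $ i ** T)"

definition wishart_povm :: "'w measure \<Rightarrow> ('k \<Rightarrow> real) \<Rightarrow> ('w \<Rightarrow> (complex^'d^'d)^'k) \<Rightarrow> bool" where
  "wishart_povm M s P \<longleftrightarrow> prob_space M \<and>
     (\<exists>W :: 'k \<Rightarrow> 'w \<Rightarrow> complex^'d^'d.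
        prob_space.indep_vars M (\<lambda>_. borel) W UNIV \<and>
        (\<forall>i. wishart_matrix M (s i) (W i)) \<and>
        P = (\<lambda>\<omega>. normalize_povm (\<chi> i. W i \<omega>)))"

text \<open>
  The measure \<open>\<delta>(I - m_1 - ... - m_k) dm_1 ... dm_k\<close> on k-tuples of Hermitian matrices: the
  delta function is integrated out against the variable \<open>m_j\<close>, i.e. the integral of f is the
  integral of \<open>f(m)\<close> over the remaining Hermitian variables, with \<open>m_j\<close> replaced by
  \<open>I - (sum of the others)\<close>. The measure does not depend on which variable j is eliminated.
\<close>

definition delta_sum_one :: "'k::finite \<Rightarrow> ((complex^'d^'d)^'k) measure" where
  "delta_sum_one j =
     distr (\<Pi>\<^sub>M i\<in>UNIV - {j}. lebesgue_herm) borel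
       (\<lambda>m. \<chi> i. if i = j then mat 1 - (\<Sum>l\<in>UNIV - {j}. m l) else m i)"

end

theory Submission imports Defs begin

text \<open>
  Each \<open>W\<^sub>i\<close> has a density proportional to \<open>exp (- Tr w)\<close> times the power \<open>s\<^sub>i - d\<close> of \<open>det w\<close> on
  the cone of positive matrices. Replace one of the variables by the sum \<open>S\<close>, a shear preserving Lebesgue
  measure, and for fixed \<open>S\<close> substitute \<open>W\<^sub>i = \<surd>S M\<^sub>i \<surd>S\<close>, which has Jacobian \<open>(det S)\<^sup>d\<close> in each of
  the \<open>k - 1\<close> remaining variables. The joint density then splits into a function of \<open>S\<close> times
  the product of the powers \<open>s\<^sub>i - d\<close> of \<open>det M\<^sub>i\<close>, and integrating out \<open>S\<close> leaves a constant that does not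
  depend on the eliminated variable.

  The density of a Gram matrix \<open>G\<^sup>* G\<close> comes from symmetry. Its law without the Gaussian weight and the
  power \<open>n - d\<close> of \<open>det w\<close> times Lebesgue measure on the positive definite cone are both multiplied by
  \<open>\<bar>det T\<bar>\<close> to the same power under \<open>w \<mapsto> T\<^sup>* w T\<close>, and such a measure is unique up to a factor. The
  Jacobians are characters of the general linear group, hence determined by their values on diagonal
  matrices.
\<close>

subsection \<open>Characters of the general linear group\<close>

text \<open>The common power of |det T| is 2n. Each of the n rows in C^d contributes |det T|^2. On
  the cone a positive diagonal T scales the real coordinate X_ab by r_a r_b, so congruence has
  Jacobian |det T|^(2d), and (det w)^(n-d) supplies the remaining 2(n-d).

  Three linear actions need Jacobians, on real spaces of dimension 2d, 2d^2 and d^2. Seen as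
  characters of one complex group, they require no real determinant.

  No normalising constant is evaluated either. That the Wishart integrals and the integral over S
  are positive and finite is deduced from the total mass one of the given random objects. A Wishart
  matrix with integral s >= d may be given as a Gram matrix or by its density, and the two laws must
  be identified before the constant can depend on s alone.

  The square root and the inverse are given by description and choice, so their measurability has to
  cover the arguments without a root or an inverse.\<close>

definition gauss_matrix :: "'n \<Rightarrow> ('n \<Rightarrow> 'a::field) \<Rightarrow> 'a^'n^'n" where
  "gauss_matrix k v = (\<chi> i j. if i = j then 1 else if j = k then v i else 0)"

lemma gauss_matrix_mult_left:
  fixes A :: "'a::field^'n^'n"
  shows "(gauss_matrix k v ** A) $ i $ j = A $ i $ j + (if i = k then 0 else v i * A $ k $ j)"
proof -
  have "(gauss_matrix k v ** A) $ i $ j =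
      (\<Sum>l\<in>UNIV. (if l = i then A $ l $ j else 0) + (if l = k then (if i = k then 0 else v i * A $ k $ j) else 0))"
    unfolding gauss_matrix_def matrix_matrix_mult_def vec_lambda_beta by (rule sum.cong) auto
  then show ?thesis
    by (simp add: sum.distrib)
qed

lemma gauss_matrix_mult_right:
  fixes A :: "'a::field^'n^'n"
  shows "(A ** gauss_matrix k v) $ i $ j =
    A $ i $ j + (if j = k then (\<Sum>l\<in>UNIV - {k}. A $ i $ l * v l) else 0)"
proof -
  have "(A ** gauss_matrix k v) $ i $ j =
      (\<Sum>l\<in>UNIV. (if l = j then A $ i $ l else 0) + (if j = k \<and> l \<noteq> k then A $ i $ l * v l else 0))"
    unfolding gauss_matrix_def matrix_matrix_mult_def vec_lambda_beta by (rule sum.cong) auto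
  also have "\<dots> = A $ i $ j + (\<Sum>l\<in>UNIV. if j = k \<and> l \<noteq> k then A $ i $ l * v l else 0)"
    by (simp add: sum.distrib)
  also have "(\<Sum>l\<in>UNIV. if j = k \<and> l \<noteq> k then A $ i $ l * v l else 0) =
      (if j = k then (\<Sum>l\<in>UNIV - {k}. A $ i $ l * v l) else 0)"
    by (auto intro!: sum.mono_neutral_cong_right split: if_splits)
  finally show ?thesis .
qed

lemma gauss_matrix_mult_gauss_matrix:
  "gauss_matrix k v ** gauss_matrix k w = gauss_matrix k (\<lambda>i. v i + w i)"
  by (auto simp: vec_eq_iff gauss_matrix_mult_left) (auto simp: gauss_matrix_def)

lemma gauss_matrix_zero: "gauss_matrix k (\<lambda>i. 0) = mat 1"
  by (auto simp: vec_eq_iff gauss_matrix_def mat_def)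

lemma gauss_matrix_inverse: "gauss_matrix k v ** gauss_matrix k (\<lambda>i. - v i) = mat 1"
  by (simp add: gauss_matrix_mult_gauss_matrix gauss_matrix_zero)

lemma det_gauss_matrix_nonzero: "det (gauss_matrix k v) \<noteq> 0"
  using arg_cong[OF gauss_matrix_inverse[of k v], of det] by (auto simp: det_mul)

text \<open>Column elimination with one kind of elementary matrix. The inner claim allows
  off-diagonal entries only in the columns of \<open>K\<close> and removes one column at a time: a
  left Gauss factor clears column \<open>k\<close> once the pivot is nonzero and leaves the finished
  columns alone. A right factor creates a missing pivot, so permutation matrices do not occur among
  the generators.\<close>

lemma invertible_matrix_induct [consumes 1, case_names mult diagonal gauss]:
  fixes P :: "'a::field_char_0^'n^'n \<Rightarrow> bool"
  assumes "det A \<noteq> 0"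
    and mult: "\<And>A B. P A \<Longrightarrow> P B \<Longrightarrow> det A \<noteq> 0 \<Longrightarrow> det B \<noteq> 0 \<Longrightarrow> P (A ** B)"
    and diagonal: "\<And>D. (\<And>i j. i \<noteq> j \<Longrightarrow> D $ i $ j = 0) \<Longrightarrow> det D \<noteq> 0 \<Longrightarrow> P D"
    and gauss: "\<And>k v. P (gauss_matrix k v)"
  shows "P A"
proof -
  have "P A" if "\<And>i j. j \<notin> K \<Longrightarrow> i \<noteq> j \<Longrightarrow> A $ i $ j = 0" "det A \<noteq> 0" for K A
    using finite[of K] that
  proof (induction arbitrary: A rule: finite_induct)
    case empty
    then show ?case
      using diagonal by auto
  next
    case (insert k K)
    have pivot: "P B" if B: "\<And>i j. j \<notin> insert k K \<Longrightarrow> i \<noteq> j \<Longrightarrow> B $ i $ j = 0" "det B \<noteq> 0" "B $ k $ k \<noteq> 0" for B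
    proof -
      define v where "v i = B $ i $ k / B $ k $ k" for i
      let ?C = "gauss_matrix k (\<lambda>i. - v i) ** B"
      have d: "det ?C \<noteq> 0"
        using B(2) by (simp add: det_mul det_gauss_matrix_nonzero)
      have "?C $ i $ j = 0" if "j \<notin> K" "i \<noteq> j" for i j
        using that B(1)[of j] B(3) by (cases "j = k") (auto simp: gauss_matrix_mult_left v_def)
      then have "P ?C"
        by (intro insert.IH d)
      from mult[OF gauss this det_gauss_matrix_nonzero d] have "P (gauss_matrix k v ** ?C)" .
      then show ?thesis
        using gauss_matrix_inverse[of k v] by (simp add: matrix_mul_assoc)
    qed
    show ?case
    proof (cases "A $ k $ k = 0")
      case True
      \<comment> \<open>Row \<open>k\<close> of the nonsingular \<open>A\<close> has a nonzero entry
        in some column \<open>l\<close>; adding column \<open>l\<close> to column \<open>k\<close>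
        puts that entry on the diagonal. The right factor is undone by its inverse, again a Gauss
        matrix.\<close>
      have "row k A \<noteq> 0"
        using insert.prems(2) det_zero_row(1)[of k A] by blast
      then obtain l where l: "A $ k $ l \<noteq> 0"
        by (auto simp: row_def vec_eq_iff)
      with True have lk: "l \<noteq> k"
        by auto
      let ?e = "\<lambda>i. if i = l then 1 else 0"
      let ?B = "A ** gauss_matrix k ?e"
      have B: "?B $ i $ j = A $ i $ j + (if j = k then A $ i $ l else 0)" for i j
        using lk by (simp add: gauss_matrix_mult_right if_distrib cong: if_cong)
      have d: "det ?B \<noteq> 0"
        using insert.prems(2) by (simp add: det_mul det_gauss_matrix_nonzero)
      have "P ?B"
        using insert.prems(1) l True d by (intro pivot) (auto simp: B)
      from mult[OF this gauss d det_gauss_matrix_nonzero] have "P (?B ** gauss_matrix k (\<lambda>i. - ?e i))" .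
      then show ?thesis
        by (simp only: matrix_mul_assoc[symmetric] gauss_matrix_inverse matrix_mul_rid)
    qed (use insert.prems pivot in blast)
  qed
  from this[of UNIV A] assms(1) show ?thesis
    by simp
qed

text \<open>
  A Gauss matrix is conjugate to its square by a diagonal matrix, so every character of the
  general linear group is trivial on it.
\<close>

lemma character_gauss_matrix:
  fixes J :: "complex^'n^'n \<Rightarrow> 'b::idom"
  assumes mult: "\<And>A B. det A \<noteq> 0 \<Longrightarrow> det B \<noteq> 0 \<Longrightarrow> J (A ** B) = J A * J B"
    and one: "J (mat 1) = 1"
  shows "J (gauss_matrix k v) = 1"
proof -
  let ?F = "gauss_matrix k v"
  \<comment> \<open>With 1 at \<open>k\<close> and 2 elsewhere, conjugation by \<open>?D\<close>
    doubles the vector \<open>v\<close>, which is what squaring \<open>?F\<close> does. Hence J(F) =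
    J(F)^2 with J(F) nonzero.\<close>
  let ?D = "(\<chi> i j. if i = j then if i = k then 1 else 2 else 0) :: complex^'n^'n"
  have D: "det ?D \<noteq> 0"
    by (subst det_diagonal) auto
  have F: "det ?F \<noteq> 0"
    by (rule det_gauss_matrix_nonzero)
  have nz: "J A \<noteq> 0" if "det A \<noteq> 0" for A
  proof -
    have "invertible A"
      using that by (simp add: invertible_det_nz)
    then obtain B where B: "A ** B = mat 1"
      by (auto simp: invertible_def)
    moreover from arg_cong[OF B, of det] have "det B \<noteq> 0"
      by (auto simp: det_mul)
    ultimately show ?thesis
      using mult[OF that, of B] one by auto
  qed
  have "?D ** ?F = (?F ** ?F) ** ?D"
  proof -
    have *: "(?D ** A) $ i $ j = (if i = k then 1 else 2) * A $ i $ j" for A :: "complex^'n^'n" and i j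
      by (simp add: matrix_matrix_mult_def if_distrib[where f="\<lambda>x. x * _"] cong: if_cong)
    have **: "(A ** ?D) $ i $ j = (if j = k then 1 else 2) * A $ i $ j" for A :: "complex^'n^'n" and i j
      by (simp add: matrix_matrix_mult_def if_distrib[where f="\<lambda>x. _ * x"] cong: if_cong)
    show ?thesis
      unfolding vec_eq_iff * ** gauss_matrix_mult_gauss_matrix
      by (auto simp: gauss_matrix_def)
  qed
  then have "J (?D ** ?F) = J (?F ** ?F ** ?D)"
    by (rule arg_cong)
  then have "J ?D * J ?F = J ?F * J ?F * J ?D"
    using D F by (simp add: mult det_mul del: det_diagonal)
  then show ?thesis
    using nz[OF D] nz[OF F] by (simp add: algebra_simps)
qed

text \<open>Gauss matrices contribute 1 to both characters, so only the diagonal factors of a matrix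
  remain to be compared.\<close>

lemma character_unique:
  fixes J J' :: "complex^'n^'n \<Rightarrow> 'b::idom"
  assumes "\<And>A B. det A \<noteq> 0 \<Longrightarrow> det B \<noteq> 0 \<Longrightarrow> J (A ** B) = J A * J B" "J (mat 1) = 1"
    and "\<And>A B. det A \<noteq> 0 \<Longrightarrow> det B \<noteq> 0 \<Longrightarrow> J' (A ** B) = J' A * J' B" "J' (mat 1) = 1"
    and "\<And>D. (\<And>i j. i \<noteq> j \<Longrightarrow> D $ i $ j = 0) \<Longrightarrow> det D \<noteq> 0 \<Longrightarrow> J D = J' D"
    and "det A \<noteq> 0"
  shows "J A = J' A"
  using assms(6)
proof (induction rule: invertible_matrix_induct)
  case (mult A B)
  then show ?case
    using assms(1,3) by simp
next
  case (diagonal D)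
  then show ?case
    using assms(5) by blast
next
  case (gauss k v)
  then show ?case
    using character_gauss_matrix[of J, OF assms(1,2)] character_gauss_matrix[of J', OF assms(3,4)] by simp
qed

subsection \<open>Lebesgue measure under linear maps\<close>

lemma nn_integral_lborel_translate:
  fixes f :: "'a::euclidean_space \<Rightarrow> ennreal"
  assumes [measurable]: "f \<in> borel_measurable borel"
  shows "(\<integral>\<^sup>+x. f (x + a) \<partial>lborel) = (\<integral>\<^sup>+x. f x \<partial>lborel)"
proof -
  have "(\<integral>\<^sup>+x. f x \<partial>lborel) = (\<integral>\<^sup>+x. f x \<partial>distr lborel borel ((+) a))"
    by (simp add: lborel_distr_plus)
  also have "\<dots> = (\<integral>\<^sup>+x. f (a + x) \<partial>lborel)"
    by (rule nn_integral_distr) auto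
  finally show ?thesis
    by (simp add: add.commute)
qed

lemma nn_integral_lborel_reflect:
  fixes f :: "'a::euclidean_space \<Rightarrow> ennreal"
  assumes [measurable]: "f \<in> borel_measurable borel"
  shows "(\<integral>\<^sup>+x. f (a - x) \<partial>lborel) = (\<integral>\<^sup>+x. f x \<partial>lborel)"
proof -
  have "lborel = distr lborel borel (\<lambda>x::'a. a - x)"
    using lborel_affine[of "-1" a] by (simp add: density_1)
  then have "(\<integral>\<^sup>+x. f x \<partial>lborel) = (\<integral>\<^sup>+x. f x \<partial>distr lborel borel (\<lambda>x. a - x))"
    by simp
  also have "\<dots> = (\<integral>\<^sup>+x. f (a - x) \<partial>lborel)"
    by (rule nn_integral_distr) auto
  finally show ?thesis
    by simp
qed

text \<open>
  Apply Fubini to the integral of \<open>1\<^sub>A x * 1\<^sub>B (x + y)\<close>, translating in either variable.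
\<close>

lemma translation_invariant_proportional:
  fixes \<mu> :: "'a::euclidean_space measure"
  assumes "sigma_finite_measure \<mu>" and sets[measurable_cong, simp]: "sets \<mu> = sets borel"
    and inv: "\<And>a. distr \<mu> borel ((+) a) = \<mu>"
    and [measurable]: "A \<in> sets borel" "B \<in> sets borel"
  shows "emeasure \<mu> A * emeasure lborel B = emeasure lborel A * emeasure \<mu> B"
proof -
  interpret sigma_finite_measure \<mu> by fact
  interpret P: pair_sigma_finite \<mu> lborel ..
  have inv': "(\<integral>\<^sup>+x. f (a + x) \<partial>\<mu>) = (\<integral>\<^sup>+x. f x \<partial>\<mu>)" if [measurable]: "f \<in> borel_measurable borel" for f and a :: 'a
    using nn_integral_distr[of "(+) a" \<mu> borel f] by (simp add: inv)
  have "emeasure \<mu> A * emeasure lborel B = (\<integral>\<^sup>+x. indicator A x * emeasure lborel B \<partial>\<mu>)"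
    by (simp add: nn_integral_multc)
  also have "\<dots> = (\<integral>\<^sup>+x. indicator A x * (\<integral>\<^sup>+y. indicator B (y + x) \<partial>lborel) \<partial>\<mu>)"
    by (subst nn_integral_lborel_translate) auto
  also have "\<dots> = (\<integral>\<^sup>+x. (\<integral>\<^sup>+y. indicator A x * indicator B (y + x) \<partial>lborel) \<partial>\<mu>)"
    by (intro nn_integral_cong nn_integral_cmult[symmetric]) auto
  also have "\<dots> = (\<integral>\<^sup>+y. (\<integral>\<^sup>+x. indicator A x * indicator B (y + x) \<partial>\<mu>) \<partial>lborel)"
    by (rule P.Fubini'[symmetric]) measurable
  also have "\<dots> = (\<integral>\<^sup>+y. (\<integral>\<^sup>+x. indicator A (x - y) * indicator B x \<partial>\<mu>) \<partial>lborel)"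
    using inv'[of "\<lambda>x. indicator A (x - y) * indicator B x" y for y] by (simp add: add.commute)
  also have "\<dots> = (\<integral>\<^sup>+x. (\<integral>\<^sup>+y. indicator A (x - y) * indicator B x \<partial>lborel) \<partial>\<mu>)"
    by (rule P.Fubini') measurable
  also have "\<dots> = (\<integral>\<^sup>+x. (\<integral>\<^sup>+y. indicator A (x - y) \<partial>lborel) * indicator B x \<partial>\<mu>)"
    by (intro nn_integral_cong nn_integral_multc) auto
  also have "\<dots> = emeasure lborel A * emeasure \<mu> B"
    by (subst nn_integral_lborel_reflect) (auto simp: nn_integral_cmult)
  finally show ?thesis .
qed

text \<open>An image of a sigma-finite measure can fail to be sigma-finite; bounded preimages of
  balls give a countable cover by balls of finite image measure.\<close>

lemma sigma_finite_distr_lborel: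
  fixes f :: "'a::euclidean_space \<Rightarrow> 'b::euclidean_space"
  assumes [measurable]: "f \<in> borel_measurable borel" and bdd: "\<And>r. bounded (f -` cball 0 r)"
  shows "sigma_finite_measure (distr lborel borel f)"
proof
  let ?A = "range (\<lambda>n. cball (0::'b) (real n))"
  have "emeasure (distr lborel borel f) (cball 0 r) \<noteq> \<infinity>" for r
    using emeasure_bounded_finite[OF bdd[of r]] by (simp add: emeasure_distr less_top)
  moreover have "\<Union> ?A = UNIV"
    by (auto simp: real_arch_simple)
  ultimately show "\<exists>A. countable A \<and> A \<subseteq> sets (distr lborel borel f) \<and>
      \<Union> A = space (distr lborel borel f) \<and> (\<forall>a\<in>A. emeasure (distr lborel borel f) a \<noteq> \<infinity>)"
    by (intro exI[of _ ?A]) auto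
qed

text \<open>The reciprocal of the absolute real determinant of a bijective \<open>L\<close>: the
  preimage of the unit box is measured, so that the factor stands in front when
  \<open>f (L x)\<close> is integrated.\<close>

definition volume_factor :: "('a::euclidean_space \<Rightarrow> 'a) \<Rightarrow> real" where
  "volume_factor L = measure lborel (L -` cbox 0 One)"

lemma emeasure_lborel_unit_box: "emeasure lborel (cbox 0 (One::'a::euclidean_space)) = 1"
  by (subst emeasure_lborel_cbox) (auto simp: inner_diff_left)

text \<open>The image of Lebesgue measure under \<open>L\<close> is translation invariant, because
  translating by \<open>a\<close> after \<open>L\<close> is \<open>L\<close> after translating by
  the preimage of \<open>a\<close>. So it is a multiple of Lebesgue measure, and the unit box gives
  the multiple.\<close>

lemma
  fixes L :: "'a::euclidean_space \<Rightarrow> 'a"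
  assumes lin: "linear L" and bij: "bij L"
  shows nn_integral_volume_factor: "f \<in> borel_measurable borel \<Longrightarrow>
      (\<integral>\<^sup>+x. f (L x) \<partial>lborel) = ennreal (volume_factor L) * (\<integral>\<^sup>+x. f x \<partial>lborel)"
    and volume_factor_pos: "volume_factor L > 0"
proof -
  obtain g where g: "linear g" "\<And>x. g (L x) = x" "\<And>x. L (g x) = x"
    using linear_injective_isomorphism[OF lin] bij by (auto simp: bij_def)
  have [measurable]: "L \<in> borel_measurable borel"
    using lin by (intro borel_measurable_continuous_onI linear_continuous_on linear_conv_bounded_linear[THEN iffD1])
  have bdd: "bounded (L -` cball 0 r)" for r
  proof -
    have "L -` cball 0 r \<subseteq> g ` cball 0 r"
      using g by (metis image_eqI subsetI vimage_eq)
    moreover have "bounded (g ` cball 0 r)"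
      using g(1) by (intro bounded_linear_image) (auto simp: linear_conv_bounded_linear)
    ultimately show ?thesis
      by (rule bounded_subset[rotated])
  qed
  let ?\<mu> = "distr lborel borel L"
  have sf: "sigma_finite_measure ?\<mu>"
    by (intro sigma_finite_distr_lborel bdd) measurable
  have inv: "distr ?\<mu> borel ((+) a) = ?\<mu>" for a
  proof -
    have "distr ?\<mu> borel ((+) a) = distr lborel borel ((+) a \<circ> L)"
      by (rule distr_distr) auto
    also have "(+) a \<circ> L = L \<circ> (+) (g a)"
      by (auto simp: g linear_add[OF lin])
    also have "distr lborel borel \<dots> = distr (distr lborel borel ((+) (g a))) borel L"
      by (rule distr_distr[symmetric]) auto
    finally show ?thesis
      by (simp add: lborel_distr_plus)
  qed
  obtain r where "cbox 0 (One::'a) \<subseteq> cball 0 r"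
    using bounded_cbox[of 0 "One::'a"] by (auto simp: bounded_iff subset_iff dist_norm)
  then have "bounded (L -` cbox 0 One)"
    by (intro bounded_subset[OF bdd[of r]]) auto
  from emeasure_bounded_finite[OF this]
  have fin: "emeasure lborel (L -` cbox 0 One) = ennreal (volume_factor L)"
    unfolding volume_factor_def by (intro emeasure_eq_ennreal_measure) auto
  have scale: "emeasure ?\<mu> A = ennreal (volume_factor L) * emeasure lborel A" if "A \<in> sets borel" for A
    using translation_invariant_proportional[OF sf _ inv that, of "cbox 0 One"]
    by (simp add: emeasure_lborel_unit_box mult.commute emeasure_distr fin)
  have eq: "?\<mu> = scale_measure (ennreal (volume_factor L)) lborel"
    by (rule measure_eqI) (auto simp: scale)
  show "(\<integral>\<^sup>+x. f (L x) \<partial>lborel) = ennreal (volume_factor L) * (\<integral>\<^sup>+x. f x \<partial>lborel)"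
    if "f \<in> borel_measurable borel" for f
    using that nn_integral_distr[of L lborel borel f] unfolding eq by (simp add: nn_integral_scale_measure)
  \<comment> \<open>With factor zero the image of the whole space would be null.\<close>
  show "volume_factor L > 0"
    using scale[of UNIV] by (auto simp: emeasure_distr volume_factor_def intro: neq_le_trans)
qed

lemma volume_factor_eqI:
  fixes L :: "'a::euclidean_space \<Rightarrow> 'a"
  assumes "linear L" "bij L" "\<And>f::'a \<Rightarrow> ennreal. f \<in> borel_measurable borel \<Longrightarrow>
      (\<integral>\<^sup>+x. f (L x) \<partial>lborel) = ennreal c * (\<integral>\<^sup>+x. f x \<partial>lborel)" "c \<ge> 0"
  shows "volume_factor L = c"
  using assms(3)[of "indicator (cbox 0 One)"] nn_integral_volume_factor[OF assms(1,2), of "indicator (cbox 0 One)"]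
    assms(4) by (simp add: emeasure_lborel_unit_box volume_factor_def)

lemma volume_factor_comp:
  fixes L M :: "'a::euclidean_space \<Rightarrow> 'a"
  assumes "linear L" "bij L" "linear M" "bij M"
  shows "volume_factor (\<lambda>x. L (M x)) = volume_factor L * volume_factor M"
proof (rule volume_factor_eqI)
  have [measurable]: "L \<in> borel_measurable borel"
    using assms by (intro borel_measurable_continuous_onI linear_continuous_on linear_conv_bounded_linear[THEN iffD1])
  show "linear (\<lambda>x. L (M x))" "bij (\<lambda>x. L (M x))"
    using assms linear_compose[of M L] bij_comp[of M L] by (auto simp: o_def)
  show "(\<integral>\<^sup>+x. f (L (M x)) \<partial>lborel) = ennreal (volume_factor L * volume_factor M) * (\<integral>\<^sup>+x. f x \<partial>lborel)"
    if [measurable]: "f \<in> borel_measurable borel" for f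
    using nn_integral_volume_factor[OF assms(3,4), of "\<lambda>x. f (L x)"] nn_integral_volume_factor[OF assms(1,2), of f]
    by (simp add: ennreal_mult volume_factor_def mult.commute mult.left_commute)
qed (simp add: volume_factor_def)

text \<open>The unit ball is its own preimage and has positive finite volume, which can be
  cancelled.\<close>

lemma volume_factor_isometry:
  fixes L :: "'a::euclidean_space \<Rightarrow> 'a"
  assumes "linear L" "\<And>x. norm (L x) = norm x"
  shows "volume_factor L = 1"
proof -
  have "inj L"
    using assms by (metis linear_injective_0 norm_eq_zero)
  then have "bij L"
    using assms(1) linear_injective_imp_surjective by (auto simp: bij_def)
  from nn_integral_volume_factor[OF assms(1) this, of "indicator (ball 0 1)"]
  have "(\<integral>\<^sup>+x. indicator (ball 0 1) (L x) \<partial>lborel) = ennreal (volume_factor L) * emeasure lborel (ball (0::'a) 1)"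
    by (simp add: borel_measurable_indicator)
  moreover have "indicator (ball 0 1) (L x) = (indicator (ball 0 1) x :: ennreal)" for x
    by (simp add: indicator_def assms(2))
  moreover have "emeasure lborel (ball (0::'a) 1) = ennreal (measure lborel (ball (0::'a) 1))"
    using emeasure_bounded_finite[of "ball (0::'a) 1"] by (intro emeasure_eq_ennreal_measure) (auto simp: less_top)
  ultimately have "ennreal (measure lborel (ball (0::'a) 1)) =
      ennreal (volume_factor L * measure lborel (ball (0::'a) 1))"
    by (simp add: ennreal_mult volume_factor_def)
  then show ?thesis
    using content_ball_pos[of 1 "0::'a"] by (simp add: volume_factor_def)
qed

lemma volume_factor_diagonal:
  fixes L :: "'a::euclidean_space \<Rightarrow> 'a"
  assumes lin: "linear L" and L: "\<And>b. b \<in> Basis \<Longrightarrow> L b = c b *\<^sub>R b" and c: "\<And>b. b \<in> Basis \<Longrightarrow> c b \<noteq> 0"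
  shows "volume_factor L * (\<Prod>b\<in>Basis. \<bar>c b\<bar>) = 1"
proof -
  have Lx: "L x = 0 + (\<Sum>j\<in>Basis. (c j * (x \<bullet> j)) *\<^sub>R j)" for x
    by (subst euclidean_representation[symmetric])
       (simp add: linear_sum[OF lin] linear_scale[OF lin] L mult.commute del: euclidean_representation)
  have "inj L"
  proof (subst linear_injective_0[OF lin], intro allI impI)
    fix x assume "L x = 0"
    then have "c b * (x \<bullet> b) = 0" if "b \<in> Basis" for b
      using that inner_sum_left_Basis[of b "\<lambda>j. c j * (x \<bullet> j)"] by (simp add: Lx)
    then show "x = 0"
      using c by (auto intro: euclidean_eqI)
  qed
  then have bij: "bij L"
    using lin linear_injective_imp_surjective by (auto simp: bij_def)
  have [measurable]: "L \<in> borel_measurable borel"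
    using lin by (intro borel_measurable_continuous_onI linear_continuous_on linear_conv_bounded_linear[THEN iffD1])
  have "lborel = density (distr lborel borel L) (\<lambda>_. (\<Prod>j\<in>Basis. \<bar>c j\<bar>))"
    using lborel_affine_euclidean[of c 0] c unfolding Lx[symmetric] by simp
  then have "emeasure lborel (cbox 0 (One::'a)) = emeasure (density (distr lborel borel L) (\<lambda>_. (\<Prod>j\<in>Basis. \<bar>c j\<bar>))) (cbox 0 One)"
    by simp
  also have "\<dots> = ennreal (\<Prod>j\<in>Basis. \<bar>c j\<bar>) * (\<integral>\<^sup>+x. indicator (cbox 0 One) (L x) \<partial>lborel)"
    using nn_integral_distr[of L lborel borel "indicator (cbox 0 One)"]
    by (simp add: emeasure_density nn_integral_cmult_indicator)
  also have "\<dots> = ennreal (\<Prod>j\<in>Basis. \<bar>c j\<bar>) * ennreal (volume_factor L)"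
    by (subst nn_integral_volume_factor[OF lin bij]) (auto simp: emeasure_lborel_unit_box)
  finally show ?thesis
    by (simp add: emeasure_lborel_unit_box prod_nonneg volume_factor_def mult.commute flip: ennreal_mult ennreal_1)
qed

section \<open>Diagonal matrices and Jacobians of linear actions\<close>

definition diag_matrix :: "('n \<Rightarrow> 'a::zero) \<Rightarrow> 'a^'n^'n" where
  "diag_matrix u = (\<chi> i j. if i = j then u i else 0)"

lemma det_diag_matrix: "det (diag_matrix u :: 'a::comm_ring_1^'n^'n) = (\<Prod>i\<in>UNIV. u i)"
  by (subst det_diagonal) (auto simp: diag_matrix_def)

lemma diag_matrix_mult: "diag_matrix u ** diag_matrix v = diag_matrix (\<lambda>i. u i * v i :: 'a::semiring_1)"
  by (auto simp: diag_matrix_def matrix_matrix_mult_def vec_eq_iff if_distrib[where f="\<lambda>x. x * _"] cong: if_cong)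

text \<open>For a linear action \<open>\<rho>\<close>, \<open>volume_factor (\<rho> T)\<close> is a
  character in \<open>T\<close>, so only diagonal \<open>T\<close> matter. These split into a
  unitary diagonal factor, which acts isometrically, and a positive one, which acts on the standard
  basis by the scalars \<open>c r b\<close>; the exponent \<open>p\<close> is read off from their
  product.\<close>

lemma nn_integral_matrix_action:
  fixes \<rho> :: "complex^'n^'n \<Rightarrow> 'a::euclidean_space \<Rightarrow> 'a"
  assumes lin: "\<And>T. linear (\<rho> T)"
    and one: "\<And>x. \<rho> (mat 1) x = x"
    and mult: "\<And>S T x. \<rho> (S ** T) x = \<rho> S (\<rho> T x)"
    and unitary: "\<And>u x. (\<And>i. cmod (u i) = 1) \<Longrightarrow> norm (\<rho> (diag_matrix u) x) = norm x"
    and scale: "\<And>r b. (\<And>i. 0 < r i) \<Longrightarrow> b \<in> Basis \<Longrightarrow> \<rho> (diag_matrix (\<lambda>i. of_real (r i))) b = c r b *\<^sub>R b"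
    and c: "\<And>r b. (\<And>i. 0 < r i) \<Longrightarrow> b \<in> Basis \<Longrightarrow> 0 < c r b"
      "\<And>r. (\<And>i. 0 < r i) \<Longrightarrow> (\<Prod>b\<in>Basis. c r b) = (\<Prod>i\<in>UNIV. r i) ^ p"
    and T: "det T \<noteq> 0" and f: "f \<in> borel_measurable borel"
  shows "ennreal (cmod (det T) ^ p) * (\<integral>\<^sup>+x. f (\<rho> T x) \<partial>lborel) = (\<integral>\<^sup>+x. f x \<partial>lborel)"
proof -
  have bij: "bij (\<rho> T)" if "det T \<noteq> 0" for T
  proof -
    have "invertible T"
      using that by (simp add: invertible_det_nz)
    then obtain S where "S ** T = mat 1" "T ** S = mat 1"
      by (auto simp: invertible_def)
    then show ?thesis
      by (intro bij_betw_byWitness[of _ "\<rho> S"]) (auto simp flip: mult simp: one)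
  qed
  define J where "J T = volume_factor (\<rho> T)" for T
  have J_mult: "J (A ** B) = J A * J B" if "det A \<noteq> 0" "det B \<noteq> 0" for A B
  proof -
    have "\<rho> (A ** B) = (\<lambda>x. \<rho> A (\<rho> B x))"
      by (simp add: fun_eq_iff mult)
    then show ?thesis
      using volume_factor_comp[OF lin bij lin bij] that by (simp add: J_def)
  qed
  have J_one: "J (mat 1) = 1"
    unfolding J_def by (rule volume_factor_isometry) (auto simp: lin one)
  have "J T = inverse (cmod (det T) ^ p)"
  proof (rule character_unique[where J = J and J' = "\<lambda>T. inverse (cmod (det T) ^ p)"])
    fix D :: "complex^'n^'n"
    assume D: "\<And>i j. i \<noteq> j \<Longrightarrow> D $ i $ j = 0" "det D \<noteq> 0"
    define r where "r i = cmod (D $ i $ i)" for i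
    define u where "u i = D $ i $ i / r i" for i
    have Dd: "D = diag_matrix (\<lambda>i. D $ i $ i)"
      using D(1) by (auto simp: vec_eq_iff diag_matrix_def)
    have det: "det D = (\<Prod>i\<in>UNIV. D $ i $ i)"
      by (subst Dd, subst det_diag_matrix) simp
    have nz: "D $ i $ i \<noteq> 0" for i
      using D(2) by (simp add: det)
    have r: "r i > 0" for i
      using nz by (simp add: r_def)
    let ?U = "diag_matrix u" and ?R = "diag_matrix (\<lambda>i. of_real (r i)) :: complex^'n^'n"
    have "D = ?U ** ?R"
      unfolding diag_matrix_mult using r by (subst Dd) (auto simp: u_def less_le)
    moreover have u: "cmod (u i) = 1" for i
      using nz by (simp add: u_def r_def norm_divide)
    have "det ?U \<noteq> 0" "det ?R \<noteq> 0"
      using r nz by (auto simp: det_diag_matrix u_def less_le)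
    ultimately have "J D = J ?U * J ?R"
      by (simp add: J_mult)
    also have "J ?U = 1"
      unfolding J_def by (rule volume_factor_isometry) (auto simp: lin unitary u)
    also have "J ?R * (\<Prod>b\<in>Basis. \<bar>c r b\<bar>) = 1"
      unfolding J_def by (rule volume_factor_diagonal) (use lin scale c(1) r in \<open>auto simp: less_le\<close>)
    then have "J ?R = inverse (\<Prod>b\<in>Basis. \<bar>c r b\<bar>)"
      by (metis inverse_unique mult.commute)
    also have "(\<Prod>b\<in>Basis. \<bar>c r b\<bar>) = (\<Prod>b\<in>Basis. c r b)"
      using c(1)[of r] r by (intro prod.cong) (auto simp: less_imp_le)
    also have "\<dots> = cmod (det D) ^ p"
      using r by (simp add: c(2) det r_def prod_norm)
    finally show "J D = inverse (cmod (det D) ^ p)"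
      by simp
  qed (use J_mult J_one T in \<open>auto simp: det_mul norm_mult power_mult_distrib\<close>)
  then show ?thesis
    using T nn_integral_volume_factor[OF lin bij[OF T] f]
    by (simp add: J_def mult.assoc[symmetric] flip: ennreal_mult)
qed

subsection \<open>Adjoints and positive matrices\<close>

lemma scaleR_matrix_mult_vector:
  fixes A :: "complex^'n^'m"
  shows "(c *\<^sub>R A) *v v = c *\<^sub>R (A *v v)" "A *v (c *\<^sub>R v) = c *\<^sub>R (A *v v)"
  by (simp_all add: vec_eq_iff matrix_vector_mult_def scaleR_sum_right)

lemma matrix_vector_mult_axis: "(A *v axis a 1) $ i = (A $ i $ a :: complex)"
  by (simp add: matrix_vector_mult_def axis_def if_distrib cong: if_cong)

lemma bounded_bilinear_matrix_vector_mult: "bounded_bilinear ((*v) :: complex^'n^'m \<Rightarrow> _)"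
  unfolding bilinear_conv_bounded_bilinear[symmetric] bilinear_def
  by (auto intro!: linearI simp: matrix_vector_right_distrib scaleR_matrix_mult_vector
      matrix_vector_mult_add_rdistrib)

lemma bounded_bilinear_matrix_mult: "bounded_bilinear ((**) :: complex^'n^'m \<Rightarrow> complex^'k^'n \<Rightarrow> _)"
  unfolding bilinear_conv_bounded_bilinear[symmetric] bilinear_def
  by (auto intro!: linearI simp: vec_eq_iff matrix_matrix_mult_def sum.distrib algebra_simps scaleR_sum_right)

lemma adjoint_matrix_nth [simp]: "adjoint_matrix A $ a $ b = cnj (A $ b $ a)"
  by (simp add: adjoint_matrix_def)

lemma adjoint_matrix_mult: "adjoint_matrix (A ** B) = adjoint_matrix B ** adjoint_matrix A"
  by (simp add: vec_eq_iff matrix_matrix_mult_def mult.commute)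

lemma adjoint_matrix_adjoint [simp]: "adjoint_matrix (adjoint_matrix A) = A"
  by (simp add: vec_eq_iff)

lemma adjoint_matrix_mat_1 [simp]: "adjoint_matrix (mat 1) = mat 1"
  by (simp add: vec_eq_iff mat_def)

lemma adjoint_matrix_add: "adjoint_matrix (A + B) = adjoint_matrix A + adjoint_matrix B"
  by (simp add: vec_eq_iff)

lemma adjoint_matrix_diff: "adjoint_matrix (A - B) = adjoint_matrix A - adjoint_matrix B"
  by (simp add: vec_eq_iff)

lemma det_adjoint_matrix: "det (adjoint_matrix A) = cnj (det A)"
proof -
  have "det (adjoint_matrix A) = det (\<chi> a b. cnj (A $ a $ b))"
    by (subst det_transpose[symmetric]) (simp add: transpose_def adjoint_matrix_def)
  then show ?thesis
    by (simp add: det_def)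
qed

text \<open>On \<open>complex^'d\<close>, \<open>\<bullet>\<close> is the real part of the Hermitian
  product. The conjugate transpose is adjoint for it as well, so positivity can be argued in a real
  inner product space.\<close>

lemma inner_matrix_vector_mult:
  fixes A :: "complex^'d^'d"
  shows "x \<bullet> (A *v y) = (adjoint_matrix A *v x) \<bullet> y"
proof -
  have "x \<bullet> (A *v y) = Re (\<Sum>a\<in>UNIV. \<Sum>b\<in>UNIV. cnj (x $ a) * (A $ a $ b * y $ b))"
    by (simp add: inner_vec_def inner_complex_def matrix_vector_mult_def sum_distrib_left
        sum_subtractf sum.distrib algebra_simps)
  also have "\<dots> = Re (\<Sum>b\<in>UNIV. \<Sum>a\<in>UNIV. cnj (cnj (A $ a $ b) * x $ a) * y $ b)"
    by (subst sum.swap) (simp add: algebra_simps)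
  also have "\<dots> = (adjoint_matrix A *v x) \<bullet> y"
    by (simp add: inner_vec_def inner_complex_def matrix_vector_mult_def sum_distrib_left sum_distrib_right
        sum_subtractf sum.distrib algebra_simps)
  finally show ?thesis .
qed

lemma psd_iff: "psd A \<longleftrightarrow> adjoint_matrix A = A \<and> (\<forall>v. 0 \<le> v \<bullet> (A *v v))"
proof -
  have "Re (\<Sum>a\<in>UNIV. \<Sum>b\<in>UNIV. cnj (v $ a) * A $ a $ b * v $ b) = v \<bullet> (A *v v)" for v
    by (simp add: inner_vec_def inner_complex_def matrix_vector_mult_def sum_distrib_left
        sum_subtractf sum.distrib algebra_simps)
  then show ?thesis
    by (simp add: psd_def hermitian_def)
qed

lemma psd_adjoint: "psd A \<Longrightarrow> adjoint_matrix A = A"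
  by (simp add: psd_iff)

lemma psd_congruence:
  assumes "psd A"
  shows "psd (adjoint_matrix T ** A ** T)"
proof -
  have "v \<bullet> ((adjoint_matrix T ** A ** T) *v v) = (T *v v) \<bullet> (A *v (T *v v))" for v
    by (simp add: inner_matrix_vector_mult flip: matrix_vector_mul_assoc)
  then show ?thesis
    using assms by (simp add: psd_iff adjoint_matrix_mult matrix_mul_assoc)
qed

lemma psd_mat_1: "psd (mat 1)"
  by (simp add: psd_iff)

lemma psd_gram: "psd (adjoint_matrix T ** T)"
  using psd_congruence[OF psd_mat_1, of T] by simp

lemma psd_square: "psd R \<Longrightarrow> psd (R ** R)"
  using psd_gram[of R] by (simp add: psd_adjoint)

lemma psd_add: "psd A \<Longrightarrow> psd B \<Longrightarrow> psd (A + B)"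
  by (simp add: psd_iff adjoint_matrix_add matrix_vector_mult_add_rdistrib inner_add_right)

lemma psd_sum: "(\<And>i. i \<in> I \<Longrightarrow> psd (A i)) \<Longrightarrow> psd (\<Sum>i\<in>I. A i)"
proof (induction I rule: infinite_finite_induct)
  case (insert i I)
  then show ?case
    by (simp add: psd_add)
qed (simp_all add: psd_iff vec_eq_iff)

text \<open>With w = A u, the form at u + t w is 2 t |w|^2 + t^2 (w, A w), nonnegative for every
  real t; a nonzero linear coefficient would make it negative for small negative t.\<close>

lemma psd_form_zero:
  assumes "psd A" "u \<bullet> (A *v u) = 0"
  shows "A *v u = 0"
proof -
  define w where "w = A *v u"
  have sym: "w \<bullet> (A *v u) = u \<bullet> (A *v w)"
    using inner_matrix_vector_mult[of u A w] assms(1) by (simp add: psd_adjoint inner_commute)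
  have ge: "0 \<le> 2 * t * (w \<bullet> w) + t\<^sup>2 * (w \<bullet> (A *v w))" for t :: real
  proof -
    have "0 \<le> (u + t *\<^sub>R w) \<bullet> (A *v (u + t *\<^sub>R w))"
      using assms(1) by (simp add: psd_iff)
    also have "\<dots> = 2 * t * (w \<bullet> w) + t\<^sup>2 * (w \<bullet> (A *v w))"
      using assms(2) sym
      by (simp add: matrix_vector_right_distrib scaleR_matrix_mult_vector inner_add_left inner_add_right
          power2_eq_square algebra_simps flip: w_def)
    finally show ?thesis .
  qed
  have "w \<bullet> w \<le> 0"
  proof (rule ccontr)
    assume "\<not> w \<bullet> w \<le> 0"
    then have pos: "w \<bullet> w > 0"
      by linarith
    \<comment> \<open>\<open>K\<close> bounds the quadratic coefficient and is positive by the added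
      1; at t = -|w|^2 / K the polynomial is at most -|w|^4 / K.\<close>
    define K where "K = w \<bullet> (A *v w) + 1"
    have K: "K > 0" "w \<bullet> (A *v w) \<le> K"
      using assms(1) by (auto simp: psd_iff K_def intro: add_nonneg_pos)
    have "0 \<le> 2 * (- (w \<bullet> w) / K) * (w \<bullet> w) + (- (w \<bullet> w) / K)\<^sup>2 * (w \<bullet> (A *v w))"
      by (rule ge)
    also have "\<dots> \<le> 2 * (- (w \<bullet> w) / K) * (w \<bullet> w) + (- (w \<bullet> w) / K)\<^sup>2 * K"
      using K by (intro add_left_mono mult_left_mono) auto
    also have "\<dots> = - ((w \<bullet> w)\<^sup>2 / K)"
      using K by (simp add: field_simps power2_eq_square)
    finally show False
      using pos K by (simp add: divide_le_0_iff)
  qed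
  then have "w \<bullet> w = 0"
    using inner_ge_zero[of w] by linarith
  then show ?thesis
    by (simp add: w_def)
qed

text \<open>Stated with the determinant, so that stability under congruence follows from
  multiplicativity and the \<open>powr\<close> factors of the densities vanish on the rest of
  \<open>psd\<close>. The strict form is recovered in \<open>pos_def_iff\<close>.\<close>

definition pos_def :: "complex^'d^'d \<Rightarrow> bool" where
  "pos_def A \<longleftrightarrow> psd A \<and> det A \<noteq> 0"

lemma matrix_left_mult_zero:
  fixes A :: "'a::field^'n^'n"
  assumes "det A \<noteq> 0" "A *v x = 0"
  shows "x = 0"
proof -
  have "invertible A"
    using assms by (simp add: invertible_det_nz)
  then obtain B where "B ** A = mat 1"
    by (auto simp: invertible_def)
  then have "x = B *v (A *v x)"
    by (simp add: matrix_vector_mul_assoc)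
  then show ?thesis
    by (simp add: assms)
qed

lemma det_zero_kernel:
  fixes A :: "'a::field^'n^'n"
  assumes "det A = 0"
  shows "\<exists>x. x \<noteq> 0 \<and> A *v x = 0"
  using assms matrix_left_invertible_ker[of A] invertible_left_inverse[of A] invertible_det_nz[of A] by blast

lemma pos_def_form_pos: "pos_def A \<Longrightarrow> v \<noteq> 0 \<Longrightarrow> 0 < v \<bullet> (A *v v)"
  using psd_form_zero[of A v] matrix_left_mult_zero[of A v]
  by (auto simp: pos_def_def psd_iff less_le)

lemma pos_def_iff: "pos_def A \<longleftrightarrow> adjoint_matrix A = A \<and> (\<forall>v. v \<noteq> 0 \<longrightarrow> 0 < v \<bullet> (A *v v))"
proof
  assume r: "adjoint_matrix A = A \<and> (\<forall>v. v \<noteq> 0 \<longrightarrow> 0 < v \<bullet> (A *v v))"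
  then have "psd A"
    by (auto simp: psd_iff less_imp_le) (metis inner_zero_left less_eq_real_def)
  moreover have "det A \<noteq> 0"
    using det_zero_kernel[of A] r by (metis inner_zero_right less_irrefl)
  ultimately show "pos_def A"
    by (simp add: pos_def_def)
qed (auto simp: pos_def_form_pos, simp add: pos_def_def psd_adjoint)

lemma pos_def_add_psd: "pos_def A \<Longrightarrow> psd B \<Longrightarrow> pos_def (A + B)"
  by (auto simp: pos_def_iff psd_iff adjoint_matrix_add matrix_vector_mult_add_rdistrib inner_add_right
      intro: add_pos_nonneg)

lemma pos_def_congruence: "pos_def A \<Longrightarrow> det T \<noteq> 0 \<Longrightarrow> pos_def (adjoint_matrix T ** A ** T)"
  by (simp add: pos_def_def psd_congruence det_mul det_adjoint_matrix)

lemma pos_def_mat_1: "pos_def (mat 1)"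
  by (simp add: pos_def_def psd_mat_1)

lemma pos_def_scaleR: "pos_def A \<Longrightarrow> 0 < c \<Longrightarrow> pos_def (c *\<^sub>R A)"
  by (auto simp: pos_def_iff scaleR_matrix_mult_vector) (simp add: vec_eq_iff)

section \<open>Limits of positive matrices\<close>

lemmas tendsto_matrix_mult [tendsto_intros] = bounded_bilinear.tendsto[OF bounded_bilinear_matrix_mult]
lemmas tendsto_matrix_vector_mult [tendsto_intros] = bounded_bilinear.tendsto[OF bounded_bilinear_matrix_vector_mult]
lemmas continuous_on_matrix_mult [continuous_intros] = bounded_bilinear.continuous_on[OF bounded_bilinear_matrix_mult]

lemma linear_adjoint_matrix: "linear adjoint_matrix"
  by (rule linearI) (simp_all add: vec_eq_iff)

lemma tendsto_adjoint_matrix [tendsto_intros]: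
  "(f \<longlongrightarrow> A) F \<Longrightarrow> ((\<lambda>x. adjoint_matrix (f x)) \<longlongrightarrow> adjoint_matrix A) F"
  by (rule bounded_linear.tendsto[OF linear_conv_bounded_linear[THEN iffD1, OF linear_adjoint_matrix]])

lemma psd_tendsto:
  fixes R :: "nat \<Rightarrow> complex^'d^'d"
  assumes "\<And>n. psd (R n)" "R \<longlonglongrightarrow> L"
  shows "psd L"
proof -
  have "(\<lambda>n. adjoint_matrix (R n)) \<longlonglongrightarrow> adjoint_matrix L"
    by (intro tendsto_intros assms)
  then have "adjoint_matrix L = L"
    using assms LIMSEQ_unique by (simp add: psd_adjoint)
  moreover have "0 \<le> v \<bullet> (L *v v)" for v
  proof (rule LIMSEQ_le_const)
    show "(\<lambda>n. v \<bullet> (R n *v v)) \<longlonglongrightarrow> v \<bullet> (L *v v)"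
      by (intro tendsto_intros assms)
    show "\<exists>N. \<forall>n\<ge>N. 0 \<le> v \<bullet> (R n *v v)"
      using assms by (auto simp: psd_iff)
  qed
  ultimately show ?thesis
    by (simp add: psd_iff)
qed

lemma closed_psd: "closed {A :: complex^'d^'d. psd A}"
  unfolding closed_sequential_limits using psd_tendsto by blast

text \<open>For positive matrices this bounds a root in terms of its square; for general
  \<open>T\<close> it makes the cutoff \<open>norm T \<le> 1\<close> a condition on the Gram matrix
  of \<open>T\<close> alone.\<close>

lemma norm_power2_eq_trace: "(norm A)\<^sup>2 = Re (trace (adjoint_matrix A ** A))"
  unfolding power2_norm_eq_inner inner_vec_def
  by (subst sum.swap)
     (simp add: trace_def matrix_matrix_mult_def inner_complex_def)

lemma inner_axis_matrix: "axis a 1 \<bullet> (A *v axis a 1) = Re (A $ a $ a)"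
  by (simp add: inner_axis' matrix_vector_mult_axis inner_complex_def)

subsection \<open>Square roots\<close>

text \<open>With D = R - Q and S = R + Q, equal squares give SD + DS = 0, so by cyclicity the
  positive matrix DSD has trace zero and all its diagonal entries vanish. For u = D e_a this says
  (u, S u) = 0, hence R u = Q u = 0 and D u = 0; then |u|^2 = (e_a, D u) = 0.\<close>

lemma psd_square_inj:
  assumes R: "psd R" and Q: "psd Q" and eq: "R ** R = Q ** Q"
  shows "R = Q"
proof -
  define D where "D = R - Q"
  define S where "S = R + Q"
  have adj: "adjoint_matrix D = D"
    using R Q by (simp add: D_def adjoint_matrix_diff psd_adjoint)
  have S: "psd S"
    using R Q by (simp add: S_def psd_add)
  have SD: "S ** D + D ** S = 0"
    using eq by (simp add: S_def D_def bounded_bilinear.add_left[OF bounded_bilinear_matrix_mult]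
        bounded_bilinear.add_right[OF bounded_bilinear_matrix_mult]
        bounded_bilinear.diff_left[OF bounded_bilinear_matrix_mult]
        bounded_bilinear.diff_right[OF bounded_bilinear_matrix_mult])
  have "trace (D ** S ** D) + trace (D ** S ** D) = trace (D ** (S ** D)) + trace (D ** (D ** S))"
    by (simp add: matrix_mul_assoc trace_mul_sym[of "D ** S" D])
  also have "\<dots> = trace (D ** (S ** D + D ** S))"
    by (simp add: matrix_add_ldistrib trace_add)
  also have "\<dots> = 0"
    by (simp add: SD trace_def)
  finally have "trace (D ** S ** D) = 0"
    by simp
  then have sum0: "(\<Sum>a\<in>UNIV. axis a 1 \<bullet> ((D ** S ** D) *v axis a 1)) = 0"
    by (simp add: inner_axis_matrix trace_def flip: Re_sum)
  have "psd (D ** S ** D)"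
    using psd_congruence[OF S, of D] by (simp add: adj)
  then have z: "axis a 1 \<bullet> ((D ** S ** D) *v axis a 1) = 0" for a
    using sum0 by (subst (asm) sum_nonneg_eq_0_iff) (auto simp: psd_iff)
  have "D *v axis a 1 = 0" for a
  proof -
    define u where "u = D *v axis a 1"
    have "u \<bullet> (S *v u) = 0"
      using z[of a] by (simp add: u_def inner_matrix_vector_mult adj flip: matrix_vector_mul_assoc)
    then have "u \<bullet> (R *v u) + u \<bullet> (Q *v u) = 0"
      by (simp add: S_def matrix_vector_mult_add_rdistrib inner_add_right)
    then have "u \<bullet> (R *v u) = 0" "u \<bullet> (Q *v u) = 0"
      using R Q by (simp_all add: psd_iff add_nonneg_eq_0_iff)
    then have "R *v u = 0" "Q *v u = 0"
      using R Q psd_form_zero by blast+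
    then have "D *v u = 0"
      by (simp add: D_def matrix_vector_mult_diff_rdistrib)
    then have "u \<bullet> u = 0"
      unfolding u_def by (simp add: inner_matrix_vector_mult adj)
    then show ?thesis
      by (simp add: u_def)
  qed
  then have "D = 0"
    by (auto simp: vec_eq_iff matrix_vector_mult_axis)
  then show ?thesis
    by (simp add: D_def)
qed

text \<open>The traces of the squares bound the Frobenius norms of the roots, so a subsequence of
  roots converges. This compactness stands in for continuity of the root: it yields closedness of
  the image of squaring, roots of singular matrices, and measurability of
  \<open>psd_sqrt\<close>.\<close>

lemma psd_square_limit:
  fixes R :: "nat \<Rightarrow> complex^'d^'d"
  assumes psd: "\<And>n. psd (R n)" and lim: "(\<lambda>n. R n ** R n) \<longlonglongrightarrow> A"
  shows "\<exists>L r. strict_mono r \<and> (R \<circ> r) \<longlonglongrightarrow> L \<and> psd L \<and> L ** L = A"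
proof -
  have "(\<lambda>n. Re (trace (R n ** R n))) \<longlonglongrightarrow> Re (trace A)"
    unfolding trace_def by (intro tendsto_intros lim)
  then have "bounded (range (\<lambda>n. Re (trace (R n ** R n))))"
    by (rule convergent_imp_bounded)
  then obtain K where "\<And>n. \<bar>Re (trace (R n ** R n))\<bar> \<le> K"
    by (auto simp: bounded_iff)
  then have "(norm (R n))\<^sup>2 \<le> K" for n
    using psd by (simp add: norm_power2_eq_trace psd_adjoint abs_le_iff)
  then have "norm (R n) \<le> sqrt K" for n
    by (simp add: real_le_rsqrt)
  then have "bounded (range R)"
    by (auto simp: bounded_iff)
  then obtain L r where r: "strict_mono r" "(R \<circ> r) \<longlonglongrightarrow> L"
    using bounded_imp_convergent_subsequence by blast
  have "psd L"
    using psd_tendsto[of "R \<circ> r" L] psd r(2) by simp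
  moreover have "(\<lambda>n. (R \<circ> r) n ** (R \<circ> r) n) \<longlonglongrightarrow> L ** L"
    by (intro tendsto_intros r)
  then have "L ** L = A"
    using LIMSEQ_subseq_LIMSEQ[OF lim r(1)] LIMSEQ_unique by (auto simp: o_def)
  ultimately show ?thesis
    using r by blast
qed

section \<open>Real coordinates on Hermitian matrices and the shape of the cone\<close>

definition herm_coords :: "complex^'d^'d \<Rightarrow> real^'d^'d" where
  "herm_coords A = (\<chi> a b. Re (A $ a $ b) + Im (A $ a $ b))"

lemma herm_coords_herm_of [simp]: "herm_coords (herm_of X) = X"
  by (simp add: herm_coords_def herm_of_def vec_eq_iff field_simps)

lemma adjoint_herm_of [simp]: "adjoint_matrix (herm_of X) = herm_of X"
  by (auto simp: herm_of_def vec_eq_iff complex_eq_iff field_simps)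

lemma herm_of_herm_coords: "adjoint_matrix A = A \<Longrightarrow> herm_of (herm_coords A) = A"
  using range_herm_of by (metis (mono_tags, lifting) hermitian_def herm_coords_herm_of mem_Collect_eq rangeE)

lemma linear_herm_coords: "linear herm_coords"
  by (rule linearI) (simp_all add: herm_coords_def vec_eq_iff algebra_simps)

lemma continuous_on_herm_of: "continuous_on S herm_of"
  using linear_herm_of by (intro linear_continuous_on) (simp add: linear_conv_bounded_linear)

lemma continuous_on_herm_coords: "continuous_on S herm_coords"
  using linear_herm_coords by (intro linear_continuous_on) (simp add: linear_conv_bounded_linear)

text \<open>The form attains a positive minimum on the compact unit sphere; homogeneity extends the
  bound.\<close>

lemma pos_def_bounded_below:
  fixes A :: "complex^'d^'d"
  assumes "pos_def A"
  shows "\<exists>m>0. \<forall>v. m * (norm v)\<^sup>2 \<le> v \<bullet> (A *v v)"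
proof -
  have cont: "continuous_on (sphere 0 1) (\<lambda>v. v \<bullet> (A *v v))"
    by (intro continuous_intros bounded_bilinear.continuous_on[OF bounded_bilinear_matrix_vector_mult])
  have "axis undefined 1 \<in> sphere (0::complex^'d) 1"
    by simp
  then have "sphere (0::complex^'d) 1 \<noteq> {}"
    by blast
  from continuous_attains_inf[OF compact_sphere this cont]
  obtain w where w: "norm w = 1" "\<And>v. norm v = 1 \<Longrightarrow> w \<bullet> (A *v w) \<le> v \<bullet> (A *v v)"
    by auto
  define m where "m = w \<bullet> (A *v w)"
  have "m > 0"
    unfolding m_def using w(1) by (intro pos_def_form_pos assms) auto
  moreover have "m * (norm v)\<^sup>2 \<le> v \<bullet> (A *v v)" for v
  proof (cases "v = 0")
    case False
    define u where "u = v /\<^sub>R norm v"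
    have v: "v = norm v *\<^sub>R u" and "norm u = 1"
      using False by (simp_all add: u_def)
    then have "m \<le> u \<bullet> (A *v u)"
      using w(2) by (simp add: m_def)
    then have "m * (norm v)\<^sup>2 \<le> (u \<bullet> (A *v u)) * (norm v)\<^sup>2"
      by (rule mult_right_mono) simp
    also have "\<dots> = (norm v *\<^sub>R u) \<bullet> (A *v (norm v *\<^sub>R u))"
      by (simp add: scaleR_matrix_mult_vector power2_eq_square)
    finally show ?thesis
      by (simp flip: v)
  qed simp
  ultimately show ?thesis
    by blast
qed

text \<open>Openness is stated in real coordinates, since the Hermitian matrices have empty interior
  among the complex ones. A perturbation changes the form by at most \<open>K\<close> times its
  norm, so radius \<open>m / K\<close> keeps it positive.\<close>

lemma open_pos_def: "open {X. pos_def (herm_of X :: complex^'d^'d)}"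
proof (subst open_subopen, rule ballI)
  fix X :: "real^'d^'d"
  assume "X \<in> {X. pos_def (herm_of X)}"
  then have "pos_def (herm_of X)"
    by simp
  from pos_def_bounded_below[OF this] obtain m
    where m: "m > 0" "\<And>v. m * (norm v)\<^sup>2 \<le> v \<bullet> (herm_of X *v v)"
    by blast
  obtain K where K: "K > 0" "\<And>(A::complex^'d^'d) v. norm (A *v v) \<le> norm A * norm v * K"
    using bounded_bilinear.pos_bounded[OF bounded_bilinear_matrix_vector_mult] by blast
  show "\<exists>T. open T \<and> X \<in> T \<and> T \<subseteq> {X. pos_def (herm_of X)}"
  proof (intro exI conjI subsetI CollectI)
    fix Y
    assume Y: "Y \<in> ball X (m / K)"
    have "0 < v \<bullet> (herm_of Y *v v)" if "v \<noteq> 0" for v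
    proof -
      have "\<bar>v \<bullet> (herm_of (X - Y) *v v)\<bar> \<le> norm v * (norm (X - Y) * norm v * K)"
      proof (rule order_trans[OF Cauchy_Schwarz_ineq2])
        show "norm v * norm (herm_of (X - Y) *v v) \<le> norm v * (norm (X - Y) * norm v * K)"
          using K(2)[of "herm_of (X - Y)" v] by (intro mult_left_mono) (simp_all add: norm_herm_of)
      qed
      also have "\<dots> = (norm (X - Y) * K) * (norm v)\<^sup>2"
        by (simp add: power2_eq_square)
      also have "\<dots> < m * (norm v)\<^sup>2"
        using Y K(1) that by (intro mult_strict_right_mono) (auto simp: dist_norm field_simps)
      also have "\<dots> \<le> v \<bullet> (herm_of X *v v)"
        by (rule m(2))
      finally have "\<bar>v \<bullet> (herm_of X *v v) - v \<bullet> (herm_of Y *v v)\<bar> < v \<bullet> (herm_of X *v v)"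
        by (simp add: linear_diff[OF linear_herm_of] matrix_vector_mult_diff_rdistrib inner_diff_right)
      then show ?thesis
        by linarith
    qed
    then show "pos_def (herm_of Y)"
      by (simp add: pos_def_iff)
  qed (use m K in auto)
qed

lemma convex_pos_def: "convex {X. pos_def (herm_of X :: complex^'d^'d)}"
proof (rule convexI, clarsimp)
  fix X Y :: "real^'d^'d" and u v :: real
  assume XY: "pos_def (herm_of X)" "pos_def (herm_of Y)" and uv: "0 \<le> u" "0 \<le> v" "u + v = 1"
  have "herm_of (u *\<^sub>R X + v *\<^sub>R Y) = u *\<^sub>R herm_of X + v *\<^sub>R herm_of Y"
    by (simp add: linear_add[OF linear_herm_of] linear_scale[OF linear_herm_of])
  moreover have "pos_def (u *\<^sub>R herm_of X + v *\<^sub>R herm_of Y)"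
  proof (cases "u = 0 \<or> v = 0")
    case False
    then have "pos_def (u *\<^sub>R herm_of X)" "pos_def (v *\<^sub>R herm_of Y)"
      using XY uv by (auto intro: pos_def_scaleR)
    then show ?thesis
      using pos_def_add_psd pos_def_def by blast
  qed (use XY uv in auto)
  ultimately show "pos_def (herm_of (u *\<^sub>R X + v *\<^sub>R Y))"
    by simp
qed

text \<open>
  Squaring is an injective continuous map of the open cone of positive definite matrices into
  itself. Its image is open by invariance of domain and relatively closed by compactness, so it
  is the whole (connected) cone.
\<close>

lemma pos_def_sqrt_exists:
  fixes A :: "complex^'d^'d"
  assumes "pos_def A"
  shows "\<exists>R. psd R \<and> R ** R = A"
proof -
  define S where "S = {X. pos_def (herm_of X :: complex^'d^'d)}"
  define f where "f X = herm_coords (herm_of X ** herm_of X :: complex^'d^'d)" for X :: "real^'d^'d"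
  have hf: "herm_of (f X) = herm_of X ** herm_of X" for X
    unfolding f_def by (rule herm_of_herm_coords) (simp add: adjoint_matrix_mult)
  have cont: "continuous_on S f"
    unfolding f_def
    by (intro continuous_on_compose2[OF continuous_on_herm_coords[of UNIV]] continuous_intros continuous_on_herm_of) auto
  have inj: "inj_on f S"
  proof (rule inj_onI)
    fix X Y assume XY: "X \<in> S" "Y \<in> S" "f X = f Y"
    have "herm_of X = herm_of Y"
    proof (rule psd_square_inj)
      show "herm_of X ** herm_of X = herm_of Y ** herm_of Y"
        unfolding hf[symmetric] XY(3) ..
    qed (use XY in \<open>auto simp: S_def pos_def_def\<close>)
    then show "X = Y"
      by (metis herm_coords_herm_of)
  qed
  have sub: "f ` S \<subseteq> S"
    by (auto simp: S_def hf pos_def_def psd_square det_mul)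
  have op: "openin (top_of_set S) (f ` S)"
    using invariance_of_domain[OF cont _ inj] open_pos_def sub by (auto simp: S_def intro: open_subset)
  have "f ` S = S \<inter> closure (f ` S)"
  proof (intro equalityI subsetI IntI)
    fix Y assume "Y \<in> S \<inter> closure (f ` S)"
    then obtain y where Y: "Y \<in> S" and y: "\<And>n. y n \<in> f ` S" "y \<longlonglongrightarrow> Y"
      by (auto simp: closure_sequential)
    then obtain x where x: "\<And>n. x n \<in> S" "\<And>n. y n = f (x n)"
      unfolding image_iff by metis
    have "(\<lambda>n. herm_of (y n)) \<longlonglongrightarrow> herm_of Y"
      using continuous_on_herm_of[of UNIV] y(2) by (auto simp: continuous_on_eq_continuous_at isCont_def intro: tendsto_compose continuous_on_tendsto_compose[OF continuous_on_herm_of[of UNIV]])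
    then obtain L where L: "psd L" "L ** L = herm_of Y"
      using psd_square_limit[of "\<lambda>n. herm_of (x n)" "herm_of Y"] x by (auto simp: hf S_def pos_def_def)
    \<comment> \<open>The limit root \<open>L\<close> is so far only positive semidefinite; its
      square \<open>herm_of Y\<close> is nonsingular, so \<open>L\<close> lies in the open
      cone.\<close>
    have "det L * det L \<noteq> 0"
      using Y by (simp add: S_def pos_def_def flip: L(2) det_mul)
    then have "herm_coords L \<in> S"
      using L by (simp add: S_def herm_of_herm_coords psd_adjoint pos_def_def)
    moreover have "Y = f (herm_coords L)"
      using L by (simp add: f_def herm_of_herm_coords psd_adjoint)
    ultimately show "Y \<in> f ` S"
      by blast
  qed (use sub closure_subset[of "f ` S"] in blast)+
  then have cl: "closedin (top_of_set S) (f ` S)"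
    by (metis closedin_closed_Int closed_closure)
  have "herm_coords (mat 1) \<in> S"
    by (simp add: S_def herm_of_herm_coords pos_def_mat_1)
  then have "f ` S \<noteq> {}"
    by blast
  moreover have "connected S"
    unfolding S_def by (rule convex_connected[OF convex_pos_def])
  ultimately have "f ` S = S"
    using op cl unfolding connected_clopen by metis
  moreover have "herm_coords A \<in> S"
    using assms by (simp add: S_def herm_of_herm_coords pos_def_def psd_adjoint)
  ultimately obtain X where "X \<in> S" "herm_coords A = f X"
    by blast
  then show ?thesis
    using assms hf[of X] herm_of_herm_coords[of A] by (auto simp: S_def pos_def_def psd_adjoint)
qed

text \<open>The perturbations of \<open>A\<close> by small multiples of the identity are positive
  definite and have roots, and these accumulate at a root of \<open>A\<close>.\<close>

lemma psd_sqrt_exists: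
  fixes A :: "complex^'d^'d"
  assumes "psd A"
  shows "\<exists>R. psd R \<and> R ** R = A"
proof -
  define B where "B n = A + inverse (real (Suc n)) *\<^sub>R mat 1" for n
  have "pos_def (B n)" for n
    unfolding B_def
    by (subst add.commute, intro pos_def_add_psd pos_def_scaleR pos_def_mat_1 assms) simp
  then have "\<forall>n. \<exists>R. psd R \<and> R ** R = B n"
    using pos_def_sqrt_exists by blast
  from choice[OF this] obtain R where R: "\<And>n. psd (R n)" "\<And>n. R n ** R n = B n"
    by blast
  have "B \<longlonglongrightarrow> A + 0 *\<^sub>R mat 1"
    unfolding B_def by (intro tendsto_intros LIMSEQ_inverse_real_of_nat)
  then show ?thesis
    using psd_square_limit[of R A] R by auto
qed

lemma psd_sqrt:
  assumes "psd A"
  shows psd_psd_sqrt: "psd (psd_sqrt A)" and psd_sqrt_square: "psd_sqrt A ** psd_sqrt A = A"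
proof -
  have "\<exists>!R. psd R \<and> R ** R = A"
    using psd_sqrt_exists[OF assms] psd_square_inj by blast
  then have "psd (psd_sqrt A) \<and> psd_sqrt A ** psd_sqrt A = A"
    unfolding psd_sqrt_def by (rule theI')
  then show "psd (psd_sqrt A)" "psd_sqrt A ** psd_sqrt A = A"
    by auto
qed

lemma pos_def_psd_sqrt: "pos_def A \<Longrightarrow> pos_def (psd_sqrt A)"
  using psd_psd_sqrt[of A] arg_cong[OF psd_sqrt_square[of A], of det] by (auto simp: pos_def_def det_mul)

text \<open>Squares of positive matrices are positive, so the description has no witness and
  collapses to one fixed value. This makes \<open>psd_sqrt\<close> constant off the positive
  matrices, which settles its measurability there.\<close>

lemma psd_sqrt_not_psd:
  assumes "\<not> psd A"
  shows "psd_sqrt A = (THE R. False)"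
  unfolding psd_sqrt_def using assms psd_square by (metis (no_types, opaque_lifting))

text \<open>The squares of positive matrices outside an open \<open>U\<close> form a closed set
  \<open>C\<close>, by compactness of roots whose squares converge. As roots are unique, the
  preimage of \<open>U\<close> among the positive matrices is the complement of \<open>C\<close>
  there.\<close>

lemma borel_measurable_psd_sqrt [measurable]:
  "psd_sqrt \<in> borel_measurable (borel :: (complex^'d^'d) measure)"
proof (rule borel_measurableI)
  fix U :: "(complex^'d^'d) set"
  assume "open U"
  define C where "C = (\<lambda>R. R ** R) ` ({R. psd R} - U)"
  have "closed C"
    unfolding closed_sequential_limits
  proof (intro allI impI, elim conjE)
    fix x l assume "\<forall>n. x n \<in> C" and l: "x \<longlonglongrightarrow> l"
    then obtain R where R: "\<And>n. psd (R n)" "\<And>n. R n \<notin> U" "\<And>n. x n = R n ** R n"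
      unfolding C_def image_iff by (metis DiffD1 DiffD2 mem_Collect_eq)
    from l have "(\<lambda>n. R n ** R n) \<longlonglongrightarrow> l"
      by (subst (asm) R(3)[abs_def])
    from psd_square_limit[OF R(1) this] obtain L r where L: "(R \<circ> r) \<longlonglongrightarrow> L" "psd L" "L ** L = l"
      by blast
    have "L \<in> - U"
      using R(2) \<open>open U\<close> by (intro closed_sequentially[OF _ _ L(1)]) auto
    with L show "l \<in> C"
      by (auto simp: C_def)
  qed
  have psd_sets: "{A :: complex^'d^'d. psd A} \<in> sets borel"
    by (intro borel_closed closed_psd)
  have psd: "A \<in> C \<longleftrightarrow> psd_sqrt A \<notin> U" if "psd A" for A
  proof
    assume "A \<in> C"
    then obtain R where "psd R" "R \<notin> U" "A = R ** R"
      by (auto simp: C_def)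
    then show "psd_sqrt A \<notin> U"
      using psd_square_inj[OF psd_psd_sqrt[OF that], of R] psd_sqrt_square[OF that] by auto
  next
    assume "psd_sqrt A \<notin> U"
    then show "A \<in> C"
      unfolding C_def using psd_psd_sqrt[OF that] psd_sqrt_square[OF that]
      by (intro image_eqI[of _ _ "psd_sqrt A"]) auto
  qed
  have "psd_sqrt -` U \<inter> space borel =
      ({A. psd A} - C) \<union> (if (THE R. False) \<in> U then - {A :: complex^'d^'d. psd A} else {})"
  proof (rule set_eqI)
    show "A \<in> psd_sqrt -` U \<inter> space borel \<longleftrightarrow>
        A \<in> ({A. psd A} - C) \<union> (if (THE R. False) \<in> U then - {A. psd A} else {})" for A
      using psd[of A] psd_sqrt_not_psd[of A] by (cases "psd A") auto
  qed
  also have "\<dots> \<in> sets borel"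
    using psd_sets borel_closed[OF \<open>closed C\<close>] by (auto intro: borel_comp)
  finally show "psd_sqrt -` U \<inter> space borel \<in> sets borel" .
qed

subsection \<open>Jacobians\<close>

lemma prod_Basis_vec:
  "(\<Prod>b\<in>(Basis :: ('a::euclidean_space^'n) set). f b) = (\<Prod>i\<in>UNIV. \<Prod>u\<in>Basis. f (axis i u))"
proof -
  have eq: "(Basis :: ('a^'n) set) = (\<lambda>(i, u). axis i u) ` (UNIV \<times> Basis)"
    by (auto simp: Basis_vec_def)
  have inj: "inj_on (\<lambda>(i::'n, u::'a). axis i u) (UNIV \<times> Basis)"
    by (auto simp: inj_on_def axis_eq_axis)
  show ?thesis
    unfolding eq prod.reindex[OF inj] by (simp add: prod.cartesian_product split_def)
qed

lemma diag_matrix_mult_vector: "(diag_matrix u *v x) $ i = u i * (x $ i :: 'a::semiring_1)"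
  by (simp add: diag_matrix_def matrix_vector_mult_def if_distrib[where f="\<lambda>x. x * _"] cong: if_cong)

lemma diag_matrix_mult_left: "(diag_matrix u ** A) $ i $ j = u i * (A $ i $ j :: 'a::semiring_1)"
  by (simp add: diag_matrix_def matrix_matrix_mult_def if_distrib[where f="\<lambda>x. x * _"] cong: if_cong)

lemma diag_matrix_mult_right: "(A ** diag_matrix u) $ i $ j = A $ i $ j * (u j :: 'a::semiring_1)"
  by (simp add: diag_matrix_def matrix_matrix_mult_def if_distrib[where f="\<lambda>x. _ * x"] cong: if_cong)

lemma adjoint_diag_matrix: "adjoint_matrix (diag_matrix u) = diag_matrix (\<lambda>i. cnj (u i))"
  by (auto simp: vec_eq_iff diag_matrix_def)

lemma norm_vec_cong: "(\<And>i. norm (x $ i) = norm (y $ i)) \<Longrightarrow> norm x = norm y"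
  by (simp add: norm_vec_def)

text \<open>A diagonal entry acts on the two real directions of its coordinate, whence the exponent
  2.\<close>

lemma nn_integral_matrix_vector_mult:
  fixes T :: "complex^'n^'n"
  assumes "det T \<noteq> 0" "f \<in> borel_measurable borel"
  shows "ennreal (cmod (det T) ^ 2) * (\<integral>\<^sup>+x. f (T *v x) \<partial>lborel) = (\<integral>\<^sup>+x. f x \<partial>lborel)"
\<comment> \<open>The eigenvalue at a basis vector \<open>b\<close> is written as the norm of the
  image of \<open>b\<close>, which spares extracting an index from \<open>b\<close>; it equals
  \<open>r i\<close> at \<open>axis i u\<close>.\<close>
proof (rule nn_integral_matrix_action[where
      c = "\<lambda>r b. norm (diag_matrix (\<lambda>i. complex_of_real (r i)) *v b)", OF _ _ _ _ _ _ _ assms])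
  have *: "diag_matrix (\<lambda>i. complex_of_real (r i)) *v axis i u = r i *\<^sub>R axis i u" for r :: "'n \<Rightarrow> real" and i u
    by (auto simp: vec_eq_iff diag_matrix_mult_vector axis_def scaleR_conv_of_real[where 'a = complex])
  fix r :: "'n \<Rightarrow> real" assume r: "\<And>i. 0 < r i"
  show "diag_matrix (\<lambda>i. of_real (r i)) *v b = norm (diag_matrix (\<lambda>i. complex_of_real (r i)) *v b) *\<^sub>R b"
    "0 < norm (diag_matrix (\<lambda>i. complex_of_real (r i)) *v b)" if "b \<in> Basis" for b
    using that r less_imp_neq[OF r] unfolding Basis_vec_def by (auto simp: * less_imp_le abs_of_pos)
  show "(\<Prod>b\<in>Basis. norm (diag_matrix (\<lambda>i. complex_of_real (r i)) *v b)) = (\<Prod>i\<in>UNIV. r i) ^ 2"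
    using r by (simp add: prod_Basis_vec * abs_of_pos prod_power_distrib DIM_complex)
qed (auto simp: matrix_vector_mul_assoc diag_matrix_mult_vector norm_mult intro!: linearI norm_vec_cong
    simp: matrix_vector_right_distrib scaleR_matrix_mult_vector)

text \<open>Left multiplication acts on each column separately, so the exponent for vectors is
  multiplied by the number of columns.\<close>

lemma nn_integral_matrix_mult_left:
  fixes T :: "complex^'n^'n"
  assumes "det T \<noteq> 0" "f \<in> borel_measurable borel"
  shows "ennreal (cmod (det T) ^ (2 * CARD('n))) * (\<integral>\<^sup>+X. f (T ** X) \<partial>lborel) =
    (\<integral>\<^sup>+X. f (X :: complex^'n^'n) \<partial>lborel)"
proof (rule nn_integral_matrix_action[where
      c = "\<lambda>r b. norm (diag_matrix (\<lambda>i. complex_of_real (r i)) ** b)", OF _ _ _ _ _ _ _ assms])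
  have *: "diag_matrix (\<lambda>i. complex_of_real (r i)) ** axis i (axis j u) = r i *\<^sub>R axis i (axis j u)"
    for r :: "'n \<Rightarrow> real" and i and j :: 'n and u
    by (auto simp: vec_eq_iff diag_matrix_mult_left axis_def scaleR_conv_of_real[where 'a = complex])
  fix r :: "'n \<Rightarrow> real" assume r: "\<And>i. 0 < r i"
  show "diag_matrix (\<lambda>i. of_real (r i)) ** b = norm (diag_matrix (\<lambda>i. complex_of_real (r i)) ** b) *\<^sub>R b"
    "0 < norm (diag_matrix (\<lambda>i. complex_of_real (r i)) ** b)" if "b \<in> Basis" for b :: "complex^'n^'n"
    using that r less_imp_neq[OF r] unfolding Basis_vec_def by (auto simp: * less_imp_le abs_of_pos)
  show "(\<Prod>b\<in>(Basis :: (complex^'n^'n) set). norm (diag_matrix (\<lambda>i. complex_of_real (r i)) ** b)) =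
      (\<Prod>i\<in>UNIV. r i) ^ (2 * CARD('n))"
    using r by (simp add: prod_Basis_vec * abs_of_pos prod_power_distrib DIM_complex power_mult)
qed (auto simp: matrix_mul_assoc diag_matrix_mult_left norm_mult intro!: linearI norm_vec_cong
    simp: bounded_bilinear.add_right[OF bounded_bilinear_matrix_mult]
      bounded_bilinear.scaleR_right[OF bounded_bilinear_matrix_mult])

text \<open>Over all d^2 real coordinates, scaled by r_a r_b, each r_a occurs 2d times. The action
  \<open>\<rho>\<close> has the adjoint on the right, which makes it multiplicative in the right
  order; it is then applied to the adjoint of \<open>T\<close>, whose determinant has the same
  modulus.\<close>

lemma nn_integral_herm_congruence:
  fixes T :: "complex^'d^'d"
  assumes T: "det T \<noteq> 0" and f [measurable]: "f \<in> borel_measurable borel"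
  shows "ennreal (cmod (det T) ^ (2 * CARD('d))) *
      (\<integral>\<^sup>+X. f (adjoint_matrix T ** herm_of X ** T) \<partial>lborel) = (\<integral>\<^sup>+X. f (herm_of X) \<partial>lborel)"
proof -
  define \<rho> where "\<rho> T X = herm_coords (T ** herm_of X ** adjoint_matrix T)" for T :: "complex^'d^'d" and X
  have herm: "herm_of (\<rho> T X) = T ** herm_of X ** adjoint_matrix T" for T X
    unfolding \<rho>_def by (rule herm_of_herm_coords) (simp add: adjoint_matrix_mult matrix_mul_assoc)
  have [measurable]: "herm_of \<in> borel_measurable borel"
    by (intro borel_measurable_continuous_onI continuous_on_herm_of)
  have "ennreal (cmod (det (adjoint_matrix T)) ^ (2 * CARD('d))) *
      (\<integral>\<^sup>+X. f (herm_of (\<rho> (adjoint_matrix T) X)) \<partial>lborel) = (\<integral>\<^sup>+X. f (herm_of X) \<partial>lborel)"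
  proof (rule nn_integral_matrix_action[where \<rho> = \<rho> and
      c = "\<lambda>r b. norm (\<rho> (diag_matrix (\<lambda>i. complex_of_real (r i))) b)"])
    have rho: "\<rho> (diag_matrix (\<lambda>i. of_real (r i))) X $ a $ b = r a * r b * X $ a $ b" for r X a b
      by (simp add: \<rho>_def herm_coords_def adjoint_diag_matrix diag_matrix_mult_left diag_matrix_mult_right
          herm_of_def field_simps)
    have *: "\<rho> (diag_matrix (\<lambda>i. complex_of_real (r i))) (axis i (axis j 1)) = (r i * r j) *\<^sub>R axis i (axis j 1)"
      for r :: "'d \<Rightarrow> real" and i j
      by (auto simp: vec_eq_iff rho axis_def)
    fix r :: "'d \<Rightarrow> real" assume r: "\<And>i. 0 < r i"
    show "\<rho> (diag_matrix (\<lambda>i. of_real (r i))) b = norm (\<rho> (diag_matrix (\<lambda>i. complex_of_real (r i))) b) *\<^sub>R b"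
      "0 < norm (\<rho> (diag_matrix (\<lambda>i. complex_of_real (r i))) b)" if "b \<in> Basis" for b
      using that r less_imp_neq[OF r] unfolding Basis_vec_def
      by (auto simp: * less_imp_le abs_of_pos abs_mult)
    show "(\<Prod>b\<in>Basis. norm (\<rho> (diag_matrix (\<lambda>i. complex_of_real (r i))) b)) =
        (\<Prod>i\<in>UNIV. r i) ^ (2 * CARD('d))"
      using r by (simp add: prod_Basis_vec * abs_of_pos abs_mult prod_power_distrib prod.distrib power_mult
          power2_eq_square power_mult_distrib)
  next
    show "linear (\<rho> S)" for S
    proof -
      have "linear (\<lambda>A. S ** A ** adjoint_matrix S)"
        by (auto intro!: linearI simp: bounded_bilinear.add_right[OF bounded_bilinear_matrix_mult]
            bounded_bilinear.scaleR_right[OF bounded_bilinear_matrix_mult]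
            bounded_bilinear.add_left[OF bounded_bilinear_matrix_mult]
            bounded_bilinear.scaleR_left[OF bounded_bilinear_matrix_mult])
      then have "linear (herm_coords \<circ> (\<lambda>A. S ** A ** adjoint_matrix S) \<circ> herm_of)"
        by (intro linear_compose linear_herm_of linear_herm_coords)
      then show ?thesis
        by (simp add: \<rho>_def[abs_def] o_def)
    qed
    show "norm (\<rho> (diag_matrix u) X) = norm X" if "\<And>i. cmod (u i) = 1" for u X
    proof -
      have "norm (herm_of (\<rho> (diag_matrix u) X)) = norm (herm_of X)"
        unfolding herm by (intro norm_vec_cong)
          (simp add: that adjoint_diag_matrix diag_matrix_mult_left diag_matrix_mult_right norm_mult)
      then show ?thesis
        by (simp add: norm_herm_of)
    qed
    show "\<rho> (A ** B) X = \<rho> A (\<rho> B X)" for A B X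
      by (simp add: \<rho>_def[of "A ** B"] \<rho>_def[of A] herm adjoint_matrix_mult matrix_mul_assoc)
  qed (use T in \<open>auto simp: \<rho>_def det_adjoint_matrix\<close>)
  then show ?thesis
    by (simp add: herm det_adjoint_matrix)
qed

subsection \<open>Products of measures\<close>

lemma distr_PiM_componentwise:
  assumes "finite I" "\<And>i. sigma_finite_measure (M i)"
    and f [measurable]: "\<And>i. f i \<in> measurable (M i) (M' i)"
    and sf: "\<And>i. sigma_finite_measure (distr (M i) (M' i) (f i))"
  shows "distr (PiM I M) (PiM I M') (\<lambda>x. \<lambda>i\<in>I. f i (x i)) = PiM I (\<lambda>i. distr (M i) (M' i) (f i))"
proof (rule product_sigma_finite.PiM_eqI)
  interpret product_sigma_finite M
    using assms(2) by (simp add: product_sigma_finite_def)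
  show "product_sigma_finite (\<lambda>i. distr (M i) (M' i) (f i))"
    using sf by (simp add: product_sigma_finite_def)
  fix A assume "\<And>i. i \<in> I \<Longrightarrow> A i \<in> sets (distr (M i) (M' i) (f i))"
  then have A [measurable]: "\<And>i. i \<in> I \<Longrightarrow> A i \<in> sets (M' i)"
    by simp
  have [measurable]: "(\<lambda>x. \<lambda>i\<in>I. f i (x i)) \<in> measurable (PiM I M) (PiM I M')"
    by (intro measurable_restrict) measurable
  have "(\<lambda>x. \<lambda>i\<in>I. f i (x i)) -` Pi\<^sub>E I A \<inter> space (PiM I M) = (\<Pi>\<^sub>E i\<in>I. f i -` A i \<inter> space (M i))"
    by (auto simp: space_PiM PiE_iff)
  then have "emeasure (distr (PiM I M) (PiM I M') (\<lambda>x. \<lambda>i\<in>I. f i (x i))) (Pi\<^sub>E I A) =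
      emeasure (PiM I M) (\<Pi>\<^sub>E i\<in>I. f i -` A i \<inter> space (M i))"
    using assms(1) by (subst emeasure_distr) (auto intro!: sets_PiM_I_finite)
  also have "\<dots> = (\<Prod>i\<in>I. emeasure (M i) (f i -` A i \<inter> space (M i)))"
    using assms(1) by (intro emeasure_PiM) auto
  also have "\<dots> = (\<Prod>i\<in>I. emeasure (distr (M i) (M' i) (f i)) (A i))"
    by (intro prod.cong refl) (simp add: emeasure_distr)
  finally show "emeasure (distr (PiM I M) (PiM I M') (\<lambda>x. \<lambda>i\<in>I. f i (x i))) (Pi\<^sub>E I A) =
    (\<Prod>i\<in>I. emeasure (distr (M i) (M' i) (f i)) (A i))" .
qed (use assms(1) in \<open>auto cong: sets_PiM_cong\<close>)

lemma PiM_density_eq: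
  assumes "finite I" "\<And>i. sigma_finite_measure (M i)"
    and f [measurable]: "\<And>i. f i \<in> borel_measurable (M i)"
    and sf: "\<And>i. sigma_finite_measure (density (M i) (f i))"
  shows "PiM I (\<lambda>i. density (M i) (f i)) = density (PiM I M) (\<lambda>x. \<Prod>i\<in>I. f i (x i))"
proof (rule product_sigma_finite.PiM_eqI[symmetric])
  interpret product_sigma_finite M
    using assms(2) by (simp add: product_sigma_finite_def)
  show "product_sigma_finite (\<lambda>i. density (M i) (f i))"
    using sf by (simp add: product_sigma_finite_def)
  show "finite I"
    by fact
  fix A assume "\<And>i. i \<in> I \<Longrightarrow> A i \<in> sets (density (M i) (f i))"
  then have A [measurable]: "\<And>i. i \<in> I \<Longrightarrow> A i \<in> sets (M i)"
    by simp
  have meas: "(\<lambda>x. \<Prod>i\<in>I. f i (x i)) \<in> borel_measurable (PiM I M)" "Pi\<^sub>E I A \<in> sets (PiM I M)"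
    using assms(1) A by (auto intro!: sets_PiM_I_finite borel_measurable_prod_ennreal)
  have "emeasure (density (PiM I M) (\<lambda>x. \<Prod>i\<in>I. f i (x i))) (Pi\<^sub>E I A) =
      (\<integral>\<^sup>+x. (\<Prod>i\<in>I. f i (x i)) * indicator (Pi\<^sub>E I A) x \<partial>PiM I M)"
    by (intro emeasure_density meas)
  also have "\<dots> = (\<integral>\<^sup>+x. (\<Prod>i\<in>I. f i (x i) * indicator (A i) (x i)) \<partial>PiM I M)"
  proof (rule nn_integral_cong)
    fix x assume "x \<in> space (PiM I M)"
    then have "indicator (Pi\<^sub>E I A) x = (\<Prod>i\<in>I. indicator (A i) (x i) :: ennreal)"
      using assms(1) by (auto simp: indicator_def space_PiM PiE_iff prod_zero_iff)
    then show "(\<Prod>i\<in>I. f i (x i)) * indicator (Pi\<^sub>E I A) x = (\<Prod>i\<in>I. f i (x i) * indicator (A i) (x i))"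
      by (simp add: prod.distrib)
  qed
  also have "\<dots> = (\<Prod>i\<in>I. \<integral>\<^sup>+x. f i x * indicator (A i) x \<partial>M i)"
    using assms(1) by (intro product_nn_integral_prod) auto
  also have "\<dots> = (\<Prod>i\<in>I. emeasure (density (M i) (f i)) (A i))"
    by (intro prod.cong refl) (simp add: emeasure_density)
  finally show "emeasure (density (PiM I M) (\<lambda>x. \<Prod>i\<in>I. f i (x i))) (Pi\<^sub>E I A) =
    (\<Prod>i\<in>I. emeasure (density (M i) (f i)) (A i))" .
qed (auto cong: sets_PiM_cong)

text \<open>The scaling hypothesis says that the image of Lebesgue measure under \<open>L i\<close>,
  given density \<open>c\<close>, is Lebesgue measure again. Product measures commute with
  componentwise images and densities, which collects the factors into
  \<open>c ^ card I\<close>.\<close>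

lemma nn_integral_PiM_lborel_scale:
  fixes L :: "'i \<Rightarrow> 'a::euclidean_space \<Rightarrow> 'a"
  assumes I: "finite I" and L [measurable]: "\<And>i. L i \<in> borel_measurable borel" and c: "0 < c"
    and scale: "\<And>i f. f \<in> borel_measurable borel \<Longrightarrow>
      ennreal c * (\<integral>\<^sup>+x. f (L i x) \<partial>lborel) = (\<integral>\<^sup>+x. f x \<partial>lborel)"
    and F [measurable]: "F \<in> borel_measurable (PiM I (\<lambda>_. borel))"
  shows "ennreal (c ^ card I) * (\<integral>\<^sup>+x. F (\<lambda>i\<in>I. L i (x i)) \<partial>PiM I (\<lambda>_. lborel)) =
    (\<integral>\<^sup>+x. F x \<partial>PiM I (\<lambda>_. lborel))"
proof -
  let ?D = "\<lambda>i. distr lborel borel (L i)"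
  have eq: "density (?D i) (\<lambda>_. ennreal c) = lborel" for i
  proof (rule measure_eqI)
    fix A assume "A \<in> sets (density (?D i) (\<lambda>_. ennreal c))"
    then have A [measurable]: "A \<in> sets borel"
      by simp
    have "emeasure (density (?D i) (\<lambda>_. ennreal c)) A = ennreal c * emeasure (?D i) A"
      by (simp add: emeasure_density nn_integral_cmult_indicator)
    also have "emeasure (?D i) A = (\<integral>\<^sup>+x. indicator A (L i x) \<partial>lborel)"
      using nn_integral_distr[of "L i" lborel borel "indicator A"] by simp
    finally show "emeasure (density (?D i) (\<lambda>_. ennreal c)) A = emeasure lborel A"
      using scale[of "indicator A" i] by simp
  qed simp
  have sf: "sigma_finite_measure (?D i)" for i
  proof -
    have "sigma_finite_measure (density lborel (\<lambda>_ :: 'a. ennreal (1 / c)))"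
      by (subst sigma_finite_measure.sigma_finite_iff_density_finite[OF sigma_finite_lborel]) auto
    also have "density lborel (\<lambda>_. ennreal (1 / c)) = density (density (?D i) (\<lambda>_. ennreal c)) (\<lambda>_. ennreal (1 / c))"
      by (simp add: eq)
    also have "\<dots> = ?D i"
      using c by (subst density_density_eq) (auto simp: density_1 simp flip: ennreal_mult)
    finally show ?thesis .
  qed
  have "PiM I (\<lambda>_. lborel) = PiM I (\<lambda>i. density (?D i) (\<lambda>_. ennreal c))"
    by (simp add: eq)
  also have "\<dots> = density (PiM I ?D) (\<lambda>x. \<Prod>i\<in>I. ennreal c)"
    using I sf by (intro PiM_density_eq) (auto simp: eq sigma_finite_lborel)
  also have "PiM I ?D = distr (PiM I (\<lambda>_. lborel)) (PiM I (\<lambda>_. borel)) (\<lambda>x. \<lambda>i\<in>I. L i (x i))"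
    using I sf by (intro distr_PiM_componentwise[symmetric]) (auto simp: sigma_finite_lborel)
  finally have "(\<integral>\<^sup>+x. F x \<partial>PiM I (\<lambda>_. lborel)) =
    (\<integral>\<^sup>+x. F x \<partial>density (distr (PiM I (\<lambda>_. lborel)) (PiM I (\<lambda>_. borel)) (\<lambda>x. \<lambda>i\<in>I. L i (x i))) (\<lambda>x. \<Prod>i\<in>I. ennreal c))"
    by simp
  also have "\<dots> = (\<integral>\<^sup>+x. ennreal (c ^ card I) * F x \<partial>distr (PiM I (\<lambda>_. lborel)) (PiM I (\<lambda>_. borel)) (\<lambda>x. \<lambda>i\<in>I. L i (x i)))"
    using c by (subst nn_integral_density) (auto simp: ennreal_power)
  also have "\<dots> = (\<integral>\<^sup>+x. ennreal (c ^ card I) * F (\<lambda>i\<in>I. L i (x i)) \<partial>PiM I (\<lambda>_. lborel))"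
    by (subst nn_integral_distr) (auto intro!: measurable_restrict)
  also have "\<dots> = ennreal (c ^ card I) * (\<integral>\<^sup>+x. F (\<lambda>i\<in>I. L i (x i)) \<partial>PiM I (\<lambda>_. lborel))"
    by (rule nn_integral_cmult) (auto intro!: measurable_compose[OF _ F] measurable_restrict)
  finally show ?thesis
    by simp
qed

subsection \<open>Measurability of matrix operations\<close>

lemma borel_measurable_vec_lambda [measurable (raw)]:
  fixes f :: "'a \<Rightarrow> 'n::finite \<Rightarrow> 'b::euclidean_space"
  assumes [measurable]: "\<And>i. (\<lambda>x. f x i) \<in> borel_measurable M"
  shows "(\<lambda>x. \<chi> i. f x i) \<in> borel_measurable M"
  by (subst borel_measurable_euclidean_space) (auto simp: Basis_vec_def inner_axis)

lemma borel_measurable_vec_nth [measurable (raw)]: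
  fixes f :: "'a \<Rightarrow> 'b::euclidean_space^'n"
  assumes [measurable]: "f \<in> borel_measurable M"
  shows "(\<lambda>x. f x $ i) \<in> borel_measurable M"
  by (rule measurable_compose[OF assms])
    (intro borel_measurable_continuous_onI linear_continuous_on bounded_linear_vec_nth)

lemma borel_measurable_matrix_mult [measurable (raw)]:
  fixes f :: "'a \<Rightarrow> complex^'n^'m" and g :: "'a \<Rightarrow> complex^'k^'n"
  assumes [measurable]: "f \<in> borel_measurable M" "g \<in> borel_measurable M"
  shows "(\<lambda>x. f x ** g x) \<in> borel_measurable M"
  unfolding matrix_matrix_mult_def by measurable

lemma borel_measurable_adjoint_matrix [measurable]: "adjoint_matrix \<in> borel_measurable borel"
  using linear_adjoint_matrix
  by (intro borel_measurable_continuous_onI linear_continuous_on) (simp add: linear_conv_bounded_linear)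

lemma borel_measurable_herm_of [measurable]: "herm_of \<in> borel_measurable borel"
  by (intro borel_measurable_continuous_onI continuous_on_herm_of)

lemma borel_measurable_det [measurable]: "det \<in> borel_measurable (borel :: (complex^'n^'n) measure)"
  unfolding det_def[abs_def] by measurable

lemma borel_measurable_trace [measurable]: "trace \<in> borel_measurable (borel :: (complex^'n^'n) measure)"
  unfolding trace_def[abs_def] by measurable

lemma sets_psd [measurable]: "{A. psd A} \<in> sets (borel :: (complex^'d^'d) measure)"
  by (intro borel_closed closed_psd)

lemma pred_psd [measurable]: "Measurable.pred borel (psd :: complex^'d^'d \<Rightarrow> bool)"
  using sets_psd by (simp add: pred_def)

lemma pred_pos_def [measurable]: "Measurable.pred borel (pos_def :: complex^'d^'d \<Rightarrow> bool)"
  unfolding pos_def_def[abs_def] by measurable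

section \<open>Inverse matrices\<close>

lemma matrix_inv_eqI:
  fixes A B :: "'a::field^'n^'n"
  assumes "A ** B = mat 1"
  shows "matrix_inv A = B"
proof -
  have BA: "B ** A = mat 1"
    using assms matrix_left_right_inverse by blast
  have "A ** matrix_inv A = mat 1 \<and> matrix_inv A ** A = mat 1"
    unfolding matrix_inv_def by (rule someI[of _ B]) (simp add: assms BA)
  then have "matrix_inv A = (B ** A) ** matrix_inv A"
    by (simp add: BA)
  also have "\<dots> = B"
    using \<open>A ** matrix_inv A = mat 1 \<and> _\<close> by (simp flip: matrix_mul_assoc)
  finally show ?thesis .
qed

lemma
  fixes A :: "'a::field^'n^'n"
  assumes "det A \<noteq> 0"
  shows matrix_inv_right: "A ** matrix_inv A = mat 1" and matrix_inv_left: "matrix_inv A ** A = mat 1"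
proof -
  have "invertible A"
    using assms by (simp add: invertible_det_nz)
  then obtain B where B: "A ** B = mat 1" "B ** A = mat 1"
    by (auto simp: invertible_def)
  with matrix_inv_eqI[OF B(1)] show "A ** matrix_inv A = mat 1" "matrix_inv A ** A = mat 1"
    by auto
qed

text \<open>The choice has no witness and returns the same value for all singular matrices, so
  inversion is constant there.\<close>

lemma matrix_inv_singular:
  fixes A :: "'a::field^'n^'n"
  assumes "det A = 0"
  shows "matrix_inv A = (SOME B. False)"
proof -
  have "A ** B \<noteq> mat 1" for B
    using assms det_mul[of A B] by (metis det_I mult_zero_left zero_neq_one)
  then show ?thesis
    by (simp add: matrix_inv_def)
qed

text \<open>Cramer's rule: the entries of the inverse are quotients of polynomials, hence Borel
  functions off the singular matrices.\<close>

lemma matrix_inv_nth: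
  fixes A :: "'a::field^'n^'n"
  assumes "det A \<noteq> 0"
  shows "matrix_inv A $ k $ l = det (\<chi> i j. if j = k then axis l 1 $ i else A $ i $ j) / det A"
proof -
  have "A *v (matrix_inv A *v axis l 1) = axis l 1"
    using assms by (simp add: matrix_vector_mul_assoc matrix_inv_right)
  then have "matrix_inv A *v axis l 1 = (\<chi> k. det (\<chi> i j. if j = k then axis l 1 $ i else A $ i $ j) / det A)"
    using cramer[OF assms] by blast
  moreover have "(matrix_inv A *v axis l 1) $ k = matrix_inv A $ k $ l"
    by (simp add: matrix_vector_mult_def axis_def if_distrib cong: if_cong)
  ultimately show ?thesis
    by simp
qed

lemma borel_measurable_matrix_inv [measurable]:
  "matrix_inv \<in> borel_measurable (borel :: (complex^'n^'n) measure)"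
proof -
  have "matrix_inv = (\<lambda>A :: complex^'n^'n. if det A = 0 then (SOME B. False) else
      (\<chi> k l. det (\<chi> i j. if j = k then axis l 1 $ i else A $ i $ j) / det A))"
    by (auto simp: fun_eq_iff matrix_inv_singular matrix_inv_nth vec_eq_iff)
  also have "\<dots> \<in> borel_measurable borel"
    by measurable
  finally show ?thesis .
qed

subsection \<open>Relatively invariant measures on the cone of positive definite matrices\<close>

text \<open>All three facts come from det A = |det R|^2 with \<open>R\<close> the positive root of
  \<open>A\<close>.\<close>

lemma det_pos_def:
  assumes "pos_def A"
  shows "det A = complex_of_real (Re (det A))" "0 < Re (det A)"
    and "Re (det A) = (cmod (det (psd_sqrt A)))\<^sup>2"
proof -
  define R where "R = psd_sqrt A"
  have R: "pos_def R" "adjoint_matrix R = R" "A = R ** R"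
    using assms pos_def_psd_sqrt[OF assms] psd_sqrt_square[of A] psd_psd_sqrt[of A]
    by (auto simp: R_def pos_def_def psd_adjoint)
  have "det A = cnj (det R) * det R"
    using det_adjoint_matrix[of R] by (simp add: R det_mul)
  then have eq: "det A = complex_of_real ((cmod (det R))\<^sup>2)"
    by (simp only: complex_norm_square mult.commute)
  show "Re (det A) = (cmod (det (psd_sqrt A)))\<^sup>2" "det A = complex_of_real (Re (det A))" "0 < Re (det A)"
    using R(1) unfolding eq R_def[symmetric] by (auto simp: pos_def_def)
qed

lemma Re_det_congruence: "Re (det (adjoint_matrix T ** A ** T)) = (cmod (det T))\<^sup>2 * Re (det A)"
proof -
  have "det (adjoint_matrix T ** A ** T) = (cnj (det T) * det T) * det A"
    by (simp add: det_mul det_adjoint_matrix algebra_simps)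
  also have "\<dots> = complex_of_real ((cmod (det T))\<^sup>2) * det A"
    by (simp only: complex_norm_square mult.commute)
  finally show ?thesis
    by simp
qed

lemma matrix_inv_mult:
  fixes A B :: "'a::field^'n^'n"
  assumes "det A \<noteq> 0" "det B \<noteq> 0"
  shows "matrix_inv (A ** B) = matrix_inv B ** matrix_inv A"
proof (rule matrix_inv_eqI)
  have "A ** B ** (matrix_inv B ** matrix_inv A) = A ** (B ** matrix_inv B) ** matrix_inv A"
    by (simp add: matrix_mul_assoc)
  then show "A ** B ** (matrix_inv B ** matrix_inv A) = mat 1"
    using assms by (simp add: matrix_inv_right)
qed

lemma matrix_inv_matrix_inv:
  fixes A :: "'a::field^'n^'n"
  shows "det A \<noteq> 0 \<Longrightarrow> matrix_inv (matrix_inv A) = A"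
  by (rule matrix_inv_eqI) (rule matrix_inv_left)

lemma matrix_inv_adjoint: "det A \<noteq> 0 \<Longrightarrow> matrix_inv (adjoint_matrix A) = adjoint_matrix (matrix_inv A)"
  by (rule matrix_inv_eqI) (simp add: matrix_inv_left flip: adjoint_matrix_mult)

lemma det_matrix_inv:
  fixes A :: "'a::field^'n^'n"
  assumes "det A \<noteq> 0"
  shows "det (matrix_inv A) = 1 / det A"
  using arg_cong[OF matrix_inv_right[OF assms], of det] assms by (simp add: det_mul field_simps)

text \<open>The weight at R = I that the cutoff \<open>norm T \<le> 1\<close> produces under T =
  w^(-1/2) R, since the trace of w^(-1) is the squared norm of w^(-1/2). In the use with m = n + d,
  the power n of 1 / det w comes from |det T|^(2n) and the power d from the Jacobian of the
  substitution.\<close>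

definition inv_trace_weight :: "nat \<Rightarrow> complex^'d^'d \<Rightarrow> real" where
  "inv_trace_weight m w = (if Re (trace (matrix_inv w)) \<le> 1 then 1 / Re (det w) ^ m else 0)"

text \<open>
  Integrating \<open>f (T\<^sup>* w T)\<close> over pairs of a point \<open>w\<close> of the cone and an invertible matrix \<open>T\<close> in
  two orders identifies every relatively invariant measure with the image of the corresponding
  invariant measure of the general linear group under \<open>R \<mapsto> R\<^sup>* R\<close>, up to a constant. The weight
  on \<open>T\<close> depends on \<open>T\<close> only through the trace and determinant of \<open>T\<^sup>* T\<close>, which makes the inner
  integral over \<open>w\<close> explicit after the substitution \<open>T = \<surd>w\<^sup>-\<^sup>1 R\<close>.
\<close>

lemma relatively_invariant_integral:
  fixes \<gamma> :: "'a \<Rightarrow> complex^'d^'d" and f :: "complex^'d^'d \<Rightarrow> ennreal"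
  assumes sf: "sigma_finite_measure N" and [measurable]: "\<gamma> \<in> borel_measurable N"
    and pd: "AE \<omega> in N. pos_def (\<gamma> \<omega>)"
    and inv: "\<And>T f. det T \<noteq> 0 \<Longrightarrow> f \<in> borel_measurable borel \<Longrightarrow>
      ennreal (cmod (det T) ^ (2 * n)) * (\<integral>\<^sup>+\<omega>. f (adjoint_matrix T ** \<gamma> \<omega> ** T) \<partial>N) = (\<integral>\<^sup>+\<omega>. f (\<gamma> \<omega>) \<partial>N)"
    and [measurable]: "f \<in> borel_measurable borel"
  shows "emeasure lborel {T :: complex^'d^'d. det T \<noteq> 0 \<and> norm T \<le> 1} * (\<integral>\<^sup>+\<omega>. f (\<gamma> \<omega>) \<partial>N) =
    (\<integral>\<^sup>+\<omega>. inv_trace_weight (n + CARD('d)) (\<gamma> \<omega>) \<partial>N) *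
    (\<integral>\<^sup>+R. f (adjoint_matrix R ** R) *
      ennreal (if det R \<noteq> 0 then cmod (det R) ^ (2 * n) / cmod (det R) ^ (2 * CARD('d)) else 0) \<partial>lborel)"
proof -
  interpret N: sigma_finite_measure N by fact
  interpret P: pair_sigma_finite N "lborel :: (complex^'d^'d) measure" ..
  let ?d = "CARD('d)"
  \<comment> \<open>The factor |det T|^(2n) is what relative invariance absorbs; the cutoff leaves a
    set of matrices \<open>T\<close> of finite measure.\<close>
  define g where "g T = (if det T \<noteq> 0 \<and> norm T \<le> 1 then cmod (det T) ^ (2 * n) else 0)" for T :: "complex^'d^'d"
  \<comment> \<open>For positive definite \<open>w\<close> and up to the factor |det R|^(2n), which
    is kept in \<open>p\<close>, this is \<open>g\<close> at w^(-1/2) R divided by the Jacobian (det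
    w)^d. The root has disappeared: only the inverse of \<open>w\<close> occurs.\<close>
  define q where "q R w = (if Re (trace (adjoint_matrix R ** matrix_inv w ** R)) \<le> 1
      then 1 / Re (det w) ^ (n + ?d) else 0)" for R w :: "complex^'d^'d"
  define p where "p R = f (adjoint_matrix R ** R) * ennreal (if det R \<noteq> 0 then cmod (det R) ^ (2 * n) else 0)"
    for R :: "complex^'d^'d"
  have [measurable]: "g \<in> borel_measurable borel" "p \<in> borel_measurable borel"
    "(\<lambda>x. q (fst x) (\<gamma> (snd x))) \<in> borel_measurable (lborel \<Otimes>\<^sub>M N)"
    "(\<lambda>x. q (snd x) (\<gamma> (fst x))) \<in> borel_measurable (N \<Otimes>\<^sub>M lborel)"
    "\<And>w. (\<lambda>R. q R w) \<in> borel_measurable borel" "\<And>R. (\<lambda>\<omega>. q R (\<gamma> \<omega>)) \<in> borel_measurable N"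
    "inv_trace_weight (n + ?d) \<in> borel_measurable (borel :: (complex^'d^'d) measure)"
    unfolding g_def p_def q_def inv_trace_weight_def[abs_def] by measurable
  let ?\<kappa> = "\<integral>\<^sup>+\<omega>. inv_trace_weight (n + ?d) (\<gamma> \<omega>) \<partial>N"
  let ?S = "{T :: complex^'d^'d. det T \<noteq> 0 \<and> norm T \<le> 1}"

  have left: "(\<integral>\<^sup>+\<omega>. ennreal (g T) * f (adjoint_matrix T ** \<gamma> \<omega> ** T) \<partial>N) =
      indicator ?S T * (\<integral>\<^sup>+\<omega>. f (\<gamma> \<omega>) \<partial>N)" for T
    using inv[of T f] by (simp add: nn_integral_cmult g_def indicator_def)

  have middle: "(\<integral>\<^sup>+T. ennreal (g T) * f (adjoint_matrix T ** w ** T) \<partial>lborel) = (\<integral>\<^sup>+R. p R * ennreal (q R w) \<partial>lborel)"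
    if w: "pos_def w" for w
  proof -
    define V where "V = psd_sqrt w"
    define r where "r = cmod (det V)"
    have V: "adjoint_matrix V = V" "det V \<noteq> 0" "w = V ** V"
      using pos_def_psd_sqrt[OF w] psd_sqrt_square[of w] w by (auto simp: V_def pos_def_def psd_adjoint)
    have r: "r > 0" "Re (det w) = r\<^sup>2"
      using V(2) det_pos_def(3)[OF w] by (auto simp: r_def V_def)
    have wV: "matrix_inv w = matrix_inv V ** matrix_inv V"
      using V by (simp add: matrix_inv_mult)
    have VwV: "adjoint_matrix (V ** T) ** matrix_inv w ** (V ** T) = adjoint_matrix T ** T" for T
    proof -
      have "adjoint_matrix (V ** T) ** matrix_inv w ** (V ** T) =
          adjoint_matrix T ** ((V ** matrix_inv V) ** ((matrix_inv V ** V) ** T))"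
        by (simp add: adjoint_matrix_mult V(1) wV matrix_mul_assoc)
      then show ?thesis
        using V by (simp add: matrix_inv_left matrix_inv_right)
    qed
    have eq: "ennreal (r ^ (2 * ?d)) * (p (V ** T) * ennreal (q (V ** T) w)) =
        ennreal (g T) * f (adjoint_matrix T ** w ** T)" for T
    proof (cases "det T = 0")
      case False
      have "f (adjoint_matrix (V ** T) ** (V ** T)) = f (adjoint_matrix T ** w ** T)"
        by (simp add: adjoint_matrix_mult V(1) V(3) matrix_mul_assoc)
      moreover have "(norm T \<le> 1) = (Re (trace (adjoint_matrix T ** T)) \<le> 1)"
        by (simp add: abs_square_le_1 flip: norm_power2_eq_trace)
      moreover have "r ^ (2 * ?d) * (cmod (det (V ** T)) ^ (2 * n) * (1 / (r\<^sup>2) ^ (n + ?d))) = cmod (det T) ^ (2 * n)"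
        using r(1) by (simp add: det_mul norm_mult power_mult_distrib r_def[symmetric] power_mult power_add
            power2_eq_square field_simps)
      ultimately have fe: "f (adjoint_matrix (V ** T) ** (V ** T)) = f (adjoint_matrix T ** w ** T)"
        and ne: "(norm T \<le> 1) = (Re (trace (adjoint_matrix T ** T)) \<le> 1)"
        and pe: "ennreal (r ^ (2 * ?d)) * (ennreal (cmod (det (V ** T)) ^ (2 * n)) * ennreal (1 / (r\<^sup>2) ^ (n + ?d))) =
          ennreal (cmod (det T) ^ (2 * n))"
        using r(1) by (auto simp flip: ennreal_mult)
      have "ennreal (r ^ (2 * ?d)) * (p (V ** T) * ennreal (q (V ** T) w)) =
          (if norm T \<le> 1 then f (adjoint_matrix T ** w ** T) * (ennreal (r ^ (2 * ?d)) *
            (ennreal (cmod (det (V ** T)) ^ (2 * n)) * ennreal (1 / (r\<^sup>2) ^ (n + ?d)))) else 0)"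
        using False V(2) by (simp add: p_def q_def VwV ne fe r(2) det_mul mult_ac)
      also have "\<dots> = ennreal (g T) * f (adjoint_matrix T ** w ** T)"
        unfolding pe using False by (simp add: g_def mult.commute)
      finally show ?thesis .
    qed (simp add: p_def g_def det_mul)
    have "(\<integral>\<^sup>+T. ennreal (g T) * f (adjoint_matrix T ** w ** T) \<partial>lborel) =
        (\<integral>\<^sup>+T. ennreal (r ^ (2 * ?d)) * (p (V ** T) * ennreal (q (V ** T) w)) \<partial>lborel)"
      by (simp add: eq)
    also have "\<dots> = ennreal (r ^ (2 * ?d)) * (\<integral>\<^sup>+T. p (V ** T) * ennreal (q (V ** T) w) \<partial>lborel)"
    proof (rule nn_integral_cmult)
      have [measurable]: "(\<lambda>T. V ** T) \<in> borel_measurable borel"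
        by measurable
      show "(\<lambda>T. p (V ** T) * ennreal (q (V ** T) w)) \<in> borel_measurable lborel"
        by measurable
    qed
    also have "\<dots> = (\<integral>\<^sup>+R. p R * ennreal (q R w) \<partial>lborel)"
      unfolding r_def by (rule nn_integral_matrix_mult_left[OF V(2), of "\<lambda>R. p R * ennreal (q R w)"]) measurable
    finally show ?thesis .
  qed

  \<comment> \<open>Congruence by the adjoint of R^(-1) turns \<open>q R\<close> into
    \<open>inv_trace_weight\<close>, and relative invariance reduces the integral to the constant
    \<open>?\<kappa>\<close>. What remains is |det R|^(-2d), the density of the invariant measure of
    the group, next to the |det R|^(2n) from \<open>p\<close>.\<close>
  have right: "(\<integral>\<^sup>+\<omega>. p R * ennreal (q R (\<gamma> \<omega>)) \<partial>N) = ?\<kappa> * (f (adjoint_matrix R ** R) *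
      ennreal (if det R \<noteq> 0 then cmod (det R) ^ (2 * n) / cmod (det R) ^ (2 * ?d) else 0))" for R
  proof (cases "det R = 0")
    case False
    define r where "r = cmod (det R)"
    have r: "r > 0"
      using False by (simp add: r_def)
    define T where "T = adjoint_matrix (matrix_inv R)"
    have T: "adjoint_matrix T = matrix_inv R" "det T \<noteq> 0" "cmod (det T) = 1 / r"
      "matrix_inv T = adjoint_matrix R" "matrix_inv (adjoint_matrix T) = R"
      using False by (simp_all add: T_def det_adjoint_matrix det_matrix_inv matrix_inv_matrix_inv matrix_inv_adjoint
          norm_divide r_def)
    have q: "q R w = 1 / r ^ (2 * (n + ?d)) * inv_trace_weight (n + ?d) (adjoint_matrix T ** w ** T)" if "pos_def w" for w
    proof -
      have w: "det w \<noteq> 0" "Re (det w) > 0"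
        using that det_pos_def by (auto simp: pos_def_def)
      have "matrix_inv (adjoint_matrix T ** w ** T) = adjoint_matrix R ** matrix_inv w ** R"
        using T(2,4,5) w by (simp add: matrix_inv_mult det_mul det_adjoint_matrix matrix_mul_assoc)
      moreover have "r ^ (n * 2 + ?d * 2) = (r\<^sup>2) ^ (n + ?d)"
        by (simp add: algebra_simps flip: power_mult)
      ultimately show ?thesis
        using r w by (simp add: q_def inv_trace_weight_def Re_det_congruence T(3) power_mult_distrib power_divide
            power_mult field_simps)
    qed
    have "(\<integral>\<^sup>+\<omega>. ennreal (q R (\<gamma> \<omega>)) \<partial>N) =
        (\<integral>\<^sup>+\<omega>. ennreal (1 / r ^ (2 * (n + ?d))) * ennreal (inv_trace_weight (n + ?d) (adjoint_matrix T ** \<gamma> \<omega> ** T)) \<partial>N)"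
      using pd
    proof (intro nn_integral_cong_AE, elim eventually_mono)
      fix \<omega> assume "pos_def (\<gamma> \<omega>)"
      then show "ennreal (q R (\<gamma> \<omega>)) = ennreal (1 / r ^ (2 * (n + ?d))) *
          ennreal (inv_trace_weight (n + ?d) (adjoint_matrix T ** \<gamma> \<omega> ** T))"
        using r unfolding q[OF \<open>pos_def (\<gamma> \<omega>)\<close>] by (intro ennreal_mult') simp
    qed
    also have "\<dots> = ennreal (1 / r ^ (2 * (n + ?d))) *
        (\<integral>\<^sup>+\<omega>. ennreal (inv_trace_weight (n + ?d) (adjoint_matrix T ** \<gamma> \<omega> ** T)) \<partial>N)"
      by (rule nn_integral_cmult) measurable
    also have "\<dots> = ennreal (1 / r ^ (2 * ?d)) *
        (ennreal (cmod (det T) ^ (2 * n)) * (\<integral>\<^sup>+\<omega>. ennreal (inv_trace_weight (n + ?d) (adjoint_matrix T ** \<gamma> \<omega> ** T)) \<partial>N))"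
      using r by (simp add: T(3) mult.assoc[symmetric] power_divide power_add field_simps flip: ennreal_mult)
    also have "\<dots> = ennreal (1 / r ^ (2 * ?d)) * ?\<kappa>"
      by (subst inv[OF T(2)]) auto
    finally have "(\<integral>\<^sup>+\<omega>. ennreal (q R (\<gamma> \<omega>)) \<partial>N) = ennreal (1 / r ^ (2 * ?d)) * ?\<kappa>" .
    then have "(\<integral>\<^sup>+\<omega>. p R * ennreal (q R (\<gamma> \<omega>)) \<partial>N) =
        f (adjoint_matrix R ** R) * (ennreal (r ^ (2 * n)) * ennreal (1 / r ^ (2 * ?d))) * ?\<kappa>"
      using False by (subst nn_integral_cmult) (auto simp: p_def r_def mult.assoc)
    then show ?thesis
      using False r by (simp add: mult.commute r_def flip: ennreal_mult)
  qed (simp add: p_def)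

  have "emeasure lborel ?S * (\<integral>\<^sup>+\<omega>. f (\<gamma> \<omega>) \<partial>N) = (\<integral>\<^sup>+T. indicator ?S T * (\<integral>\<^sup>+\<omega>. f (\<gamma> \<omega>) \<partial>N) \<partial>lborel)"
    by (subst nn_integral_multc) auto
  also have "\<dots> = (\<integral>\<^sup>+T. (\<integral>\<^sup>+\<omega>. ennreal (g T) * f (adjoint_matrix T ** \<gamma> \<omega> ** T) \<partial>N) \<partial>lborel)"
    by (simp add: left)
  also have "\<dots> = (\<integral>\<^sup>+\<omega>. (\<integral>\<^sup>+T. ennreal (g T) * f (adjoint_matrix T ** \<gamma> \<omega> ** T) \<partial>lborel) \<partial>N)"
    by (rule P.Fubini') measurable
  also have "\<dots> = (\<integral>\<^sup>+\<omega>. (\<integral>\<^sup>+R. p R * ennreal (q R (\<gamma> \<omega>)) \<partial>lborel) \<partial>N)"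
    using pd by (intro nn_integral_cong_AE) (auto simp: middle elim: eventually_mono)
  also have "\<dots> = (\<integral>\<^sup>+R. (\<integral>\<^sup>+\<omega>. p R * ennreal (q R (\<gamma> \<omega>)) \<partial>N) \<partial>lborel)"
    by (rule P.Fubini'[symmetric]) (simp add: split_beta', measurable)
  also have "\<dots> = ?\<kappa> * (\<integral>\<^sup>+R. f (adjoint_matrix R ** R) *
      ennreal (if det R \<noteq> 0 then cmod (det R) ^ (2 * n) / cmod (det R) ^ (2 * ?d) else 0) \<partial>lborel)"
    unfolding right by (rule nn_integral_cmult) measurable
  finally show ?thesis .
qed

section \<open>Uniqueness of relatively invariant measures\<close>

lemma emeasure_lborel_open_pos:
  assumes "open S" "x \<in> S"
  shows "0 < emeasure lborel (S :: 'a::euclidean_space set)"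
proof -
  obtain e where e: "e > 0" "ball x e \<subseteq> S"
    using assms openE by blast
  have "0 < emeasure lborel (ball x e)"
    using content_ball_pos[OF e(1), of x] by (auto simp: measure_def zero_less_iff_neq_zero)
  also have "\<dots> \<le> emeasure lborel S"
    using e(2) assms(1) by (intro emeasure_mono) auto
  finally show ?thesis .
qed

lemma continuous_on_det:
  fixes f :: "'a::topological_space \<Rightarrow> complex^'n^'n"
  shows "continuous_on S f \<Longrightarrow> continuous_on S (\<lambda>x. det (f x))"
  unfolding det_def by (intro continuous_intros)

lemma ennreal_mult_finite_cases:
  fixes a b c e :: ennreal
  assumes "a * b = c * e" "0 < a" "a < \<infinity>" "0 < b" "b < \<infinity>"
  shows "0 < c \<and> c < \<infinity>"
proof -
  have "0 < c * e" "c * e < \<infinity>"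
    using assms by (auto simp: ennreal_mult_less_top ennreal_zero_less_mult_iff simp flip: assms(1))
  then show ?thesis
    by (auto simp: ennreal_mult_less_top ennreal_zero_less_mult_iff)
qed

text \<open>Both integrals are multiples of the same integral \<open>B f\<close> over the group, so
  their ratio is that of \<open>\<kappa>1\<close> and \<open>\<kappa>2\<close>. The test functions
  \<open>f1\<close> and \<open>f2\<close> show that these two constants are positive and finite. The
  sample spaces may differ: one will carry row vectors, the other real coordinates.\<close>

lemma relatively_invariant_unique:
  fixes \<gamma>1 :: "'a \<Rightarrow> complex^'d^'d" and \<gamma>2 :: "'b \<Rightarrow> complex^'d^'d"
  assumes N1: "sigma_finite_measure N1" "\<gamma>1 \<in> borel_measurable N1" "AE \<omega> in N1. pos_def (\<gamma>1 \<omega>)"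
      "\<And>T f. det T \<noteq> 0 \<Longrightarrow> f \<in> borel_measurable borel \<Longrightarrow>
        ennreal (cmod (det T) ^ (2 * n)) * (\<integral>\<^sup>+\<omega>. f (adjoint_matrix T ** \<gamma>1 \<omega> ** T) \<partial>N1) = (\<integral>\<^sup>+\<omega>. f (\<gamma>1 \<omega>) \<partial>N1)"
    and N2: "sigma_finite_measure N2" "\<gamma>2 \<in> borel_measurable N2" "AE \<omega> in N2. pos_def (\<gamma>2 \<omega>)"
      "\<And>T f. det T \<noteq> 0 \<Longrightarrow> f \<in> borel_measurable borel \<Longrightarrow>
        ennreal (cmod (det T) ^ (2 * n)) * (\<integral>\<^sup>+\<omega>. f (adjoint_matrix T ** \<gamma>2 \<omega> ** T) \<partial>N2) = (\<integral>\<^sup>+\<omega>. f (\<gamma>2 \<omega>) \<partial>N2)"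
    and f1: "f1 \<in> borel_measurable borel" "0 < (\<integral>\<^sup>+\<omega>. f1 (\<gamma>1 \<omega>) \<partial>N1)" "(\<integral>\<^sup>+\<omega>. f1 (\<gamma>1 \<omega>) \<partial>N1) < \<infinity>"
    and f2: "f2 \<in> borel_measurable borel" "0 < (\<integral>\<^sup>+\<omega>. f2 (\<gamma>2 \<omega>) \<partial>N2)" "(\<integral>\<^sup>+\<omega>. f2 (\<gamma>2 \<omega>) \<partial>N2) < \<infinity>"
  shows "\<exists>K>0. \<forall>f\<in>borel_measurable borel. (\<integral>\<^sup>+\<omega>. f (\<gamma>1 \<omega>) \<partial>N1) = ennreal K * (\<integral>\<^sup>+\<omega>. f (\<gamma>2 \<omega>) \<partial>N2)"
proof -
  let ?S = "{T :: complex^'d^'d. det T \<noteq> 0 \<and> norm T \<le> 1}"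
  define a where "a = emeasure lborel ?S"
  define B where "B f = (\<integral>\<^sup>+R. f (adjoint_matrix R ** R) * ennreal (if det R \<noteq> 0 then
      cmod (det R) ^ (2 * n) / cmod (det R) ^ (2 * CARD('d)) else 0) \<partial>lborel)" for f :: "complex^'d^'d \<Rightarrow> ennreal"
  define \<kappa>1 where "\<kappa>1 = (\<integral>\<^sup>+\<omega>. inv_trace_weight (n + CARD('d)) (\<gamma>1 \<omega>) \<partial>N1)"
  define \<kappa>2 where "\<kappa>2 = (\<integral>\<^sup>+\<omega>. inv_trace_weight (n + CARD('d)) (\<gamma>2 \<omega>) \<partial>N2)"
  have eq1: "a * (\<integral>\<^sup>+\<omega>. f (\<gamma>1 \<omega>) \<partial>N1) = \<kappa>1 * B f" if "f \<in> borel_measurable borel" for f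
    unfolding a_def \<kappa>1_def B_def by (rule relatively_invariant_integral[OF N1 that])
  have eq2: "a * (\<integral>\<^sup>+\<omega>. f (\<gamma>2 \<omega>) \<partial>N2) = \<kappa>2 * B f" if "f \<in> borel_measurable borel" for f
    unfolding a_def \<kappa>2_def B_def by (rule relatively_invariant_integral[OF N2 that])
  have "a \<le> emeasure lborel (cball (0 :: complex^'d^'d) 1)"
    unfolding a_def by (intro emeasure_mono) auto
  also have "\<dots> < \<infinity>"
    by (intro emeasure_bounded_finite) auto
  finally have a_fin: "a < \<infinity>" .
  have op: "open (ball 0 1 \<inter> {T :: complex^'d^'d. det T \<noteq> 0})"
  proof (intro open_Int open_ball)
    have "open ((det :: complex^'d^'d \<Rightarrow> complex) -` (- {0}))"
      using continuous_on_det[of UNIV "\<lambda>x. x"] by (intro open_vimage) auto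
    then show "open {T :: complex^'d^'d. det T \<noteq> 0}"
      by (simp add: vimage_def)
  qed
  have "0 < emeasure lborel (ball 0 1 \<inter> {T :: complex^'d^'d. det T \<noteq> 0})"
  proof (rule emeasure_lborel_open_pos[OF op])
    \<comment> \<open>A multiple of the identity of norm below 1 is a nonsingular point of the open
      unit ball, which makes \<open>a\<close> positive.\<close>
    let ?c = "1 / (1 + norm (mat 1 :: complex^'d^'d))"
    have c: "0 < ?c"
      by (intro divide_pos_pos add_pos_nonneg) auto
    have "pos_def (?c *\<^sub>R mat 1 :: complex^'d^'d)"
      by (intro pos_def_scaleR pos_def_mat_1 c)
    moreover have "norm (?c *\<^sub>R mat 1 :: complex^'d^'d) < 1"
      by (simp add: abs_of_pos add_pos_nonneg)
    ultimately show "?c *\<^sub>R mat 1 \<in> ball 0 1 \<inter> {T :: complex^'d^'d. det T \<noteq> 0}"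
      by (simp add: pos_def_def)
  qed
  also have "\<dots> \<le> a"
    unfolding a_def by (intro emeasure_mono) auto
  finally have a_pos: "0 < a" .
  have "0 < \<kappa>1 \<and> \<kappa>1 < \<infinity>" "0 < \<kappa>2 \<and> \<kappa>2 < \<infinity>"
    using ennreal_mult_finite_cases[OF eq1[OF f1(1)] a_pos a_fin f1(2,3)]
      ennreal_mult_finite_cases[OF eq2[OF f2(1)] a_pos a_fin f2(2,3)] by auto
  then obtain k1 k2 where k: "\<kappa>1 = ennreal k1" "0 < k1" "\<kappa>2 = ennreal k2" "0 < k2"
    by (cases \<kappa>1; cases \<kappa>2) auto
  obtain a' where a': "a = ennreal a'" "0 < a'"
    using a_pos a_fin by (cases a) auto
  have cancel: "x = y" if "ennreal c * x = ennreal c * y" "0 < c" for c x y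
    using arg_cong[OF that(1), of "\<lambda>z. ennreal (1 / c) * z"] that(2)
    by (simp add: mult.assoc[symmetric] flip: ennreal_mult)
  have "(\<integral>\<^sup>+\<omega>. f (\<gamma>1 \<omega>) \<partial>N1) = ennreal (k1 / k2) * (\<integral>\<^sup>+\<omega>. f (\<gamma>2 \<omega>) \<partial>N2)" if f: "f \<in> borel_measurable borel" for f
  proof (rule cancel)
    have "ennreal (a' * k2) * (\<integral>\<^sup>+\<omega>. f (\<gamma>1 \<omega>) \<partial>N1) = ennreal k2 * (a * (\<integral>\<^sup>+\<omega>. f (\<gamma>1 \<omega>) \<partial>N1))"
      using a' k by (simp add: ennreal_mult algebra_simps)
    also have "\<dots> = ennreal k1 * (\<kappa>2 * B f)"
      by (simp add: eq1[OF f] k algebra_simps)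
    also have "\<dots> = ennreal k1 * (a * (\<integral>\<^sup>+\<omega>. f (\<gamma>2 \<omega>) \<partial>N2))"
      by (simp only: eq2[OF f])
    also have "\<dots> = ennreal (k1 * a') * (\<integral>\<^sup>+\<omega>. f (\<gamma>2 \<omega>) \<partial>N2)"
      using a' k by (simp add: ennreal_mult mult.assoc)
    also have "k1 * a' = (a' * k2) * (k1 / k2)"
      using k by simp
    also have "ennreal \<dots> = ennreal (a' * k2) * ennreal (k1 / k2)"
      using a' k by (intro ennreal_mult) auto
    finally show "ennreal (a' * k2) * (\<integral>\<^sup>+\<omega>. f (\<gamma>1 \<omega>) \<partial>N1) =
        ennreal (a' * k2) * (ennreal (k1 / k2) * (\<integral>\<^sup>+\<omega>. f (\<gamma>2 \<omega>) \<partial>N2))"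
      by (simp add: mult.assoc)
  qed (use a' k in auto)
  then show ?thesis
    using k by (intro exI[of _ "k1 / k2"]) auto
qed

subsection \<open>Gram matrices of Gaussian vectors\<close>

text \<open>The vector \<open>x\<close> is a row of the Gaussian matrix G; conjugating the first
  index makes the sum of \<open>outer\<close> over the rows equal to the adjoint of G times
  G.\<close>

definition outer :: "complex^'d \<Rightarrow> complex^'d^'d" where
  "outer x = (\<chi> a b. cnj (x $ a) * x $ b)"

definition gram :: "nat \<Rightarrow> (nat \<Rightarrow> complex^'d) \<Rightarrow> complex^'d^'d" where
  "gram n G = (\<Sum>l<n. outer (G l))"

text \<open>Congruence by \<open>T\<close> replaces G by G T, whose rows are the images of the rows
  of G under the transpose of \<open>T\<close>.\<close>

lemma outer_congruence: "adjoint_matrix T ** outer x ** T = outer (transpose T *v x)"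
proof -
  have "(adjoint_matrix T ** outer x ** T) $ a $ b = outer (transpose T *v x) $ a $ b" for a b
  proof -
    have "(adjoint_matrix T ** outer x ** T) $ a $ b =
        (\<Sum>e\<in>UNIV. \<Sum>c\<in>UNIV. (cnj (T $ c $ a) * cnj (x $ c)) * (T $ e $ b * x $ e))"
      by (simp add: matrix_matrix_mult_def outer_def sum_distrib_right sum_distrib_left algebra_simps)
    also have "\<dots> = (\<Sum>c\<in>UNIV. cnj (T $ c $ a) * cnj (x $ c)) * (\<Sum>e\<in>UNIV. T $ e $ b * x $ e)"
      by (subst sum.swap) (simp add: sum_product)
    also have "\<dots> = outer (transpose T *v x) $ a $ b"
      by (simp add: outer_def matrix_vector_mult_def transpose_def)
    finally show ?thesis .
  qed
  then show ?thesis
    by (simp add: vec_eq_iff)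
qed

lemma gram_congruence: "adjoint_matrix T ** gram n G ** T = gram n (\<lambda>l\<in>{..<n}. transpose T *v G l)"
  by (simp add: gram_def outer_congruence bounded_bilinear.sum_right[OF bounded_bilinear_matrix_mult]
      bounded_bilinear.sum_left[OF bounded_bilinear_matrix_mult])

lemma outer_mult_vector: "outer x *v v = (\<chi> a. cnj (x $ a) * (\<Sum>b\<in>UNIV. x $ b * v $ b))"
  by (simp add: outer_def matrix_vector_mult_def sum_distrib_left mult.assoc)

lemma outer_form: "v \<bullet> (outer x *v v) = (cmod (\<Sum>b\<in>UNIV. x $ b * v $ b))\<^sup>2"
proof -
  define s where "s = (\<Sum>b\<in>UNIV. x $ b * v $ b)"
  have "outer x *v v = (\<chi> a. cnj (x $ a) * s)"
    by (simp add: outer_mult_vector s_def)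
  then have "v \<bullet> (outer x *v v) = Re (\<Sum>a\<in>UNIV. cnj (x $ a * v $ a) * s)"
    by (simp add: inner_vec_def inner_complex_def algebra_simps sum.distrib sum_subtractf)
  also have "\<dots> = Re (cnj s * s)"
    by (simp add: s_def sum_distrib_right)
  also have "\<dots> = (cmod s)\<^sup>2"
    by (metis Re_complex_of_real complex_norm_square mult.commute)
  finally show ?thesis
    by (simp add: s_def)
qed

lemma psd_outer: "psd (outer x)"
  by (simp add: psd_iff outer_form) (simp add: outer_def vec_eq_iff mult.commute)

lemma psd_gram_vectors: "psd (gram n G)"
  unfolding gram_def by (intro psd_sum psd_outer)

lemma gram_form: "v \<bullet> (gram n G *v v) = (\<Sum>l<n. (cmod (\<Sum>b\<in>UNIV. G l $ b * v $ b))\<^sup>2)"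
proof -
  have "gram n G *v v = (\<Sum>l<n. outer (G l) *v v)"
    unfolding gram_def by (rule bounded_bilinear.sum_left[OF bounded_bilinear_matrix_vector_mult])
  then show ?thesis
    by (simp add: inner_sum_right outer_form)
qed

lemma Re_trace_gram: "Re (trace (gram n G)) = (\<Sum>l<n. \<Sum>a\<in>UNIV. (cmod (G l $ a))\<^sup>2)"
proof -
  have "Re (trace (gram n G)) = (\<Sum>a\<in>UNIV. \<Sum>l<n. (cmod (G l $ a))\<^sup>2)"
    by (simp add: trace_def gram_def outer_def cmod_power2) (simp add: power2_eq_square)
  then show ?thesis
    by (simp add: sum.swap[of _ UNIV])
qed

text \<open>A kernel vector of the Gram matrix makes a sum of squared moduli vanish, so every row
  annihilates it, in particular those of the nonsingular block picked out by
  \<open>\<iota>\<close>.\<close>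

lemma pos_def_gram:
  assumes "\<And>a. \<iota> a < n" "det (\<chi> a. G (\<iota> a)) \<noteq> 0"
  shows "pos_def (gram n G)"
proof -
  have False if sing: "det (gram n G) = 0"
  proof -
    obtain v where v: "v \<noteq> 0" "gram n G *v v = 0"
      using det_zero_kernel[OF sing] by blast
    have "(\<Sum>l<n. (cmod (\<Sum>b\<in>UNIV. G l $ b * v $ b))\<^sup>2) = 0"
      using gram_form[of v n G] v by simp
    then have "\<forall>l<n. (\<Sum>b\<in>UNIV. G l $ b * v $ b) = 0"
      by (subst (asm) sum_nonneg_eq_0_iff) auto
    then have "(\<chi> a. G (\<iota> a)) *v v = 0"
      using assms(1) by (simp add: vec_eq_iff matrix_vector_mult_def)
    then show False
      using matrix_left_mult_zero[OF assms(2)] v(1) by blast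
  qed
  then show ?thesis
    using psd_gram_vectors by (auto simp: pos_def_def)
qed

text \<open>The reversed polynomial det (I + u A) is 1 at u = 0, so it is nonzero without an
  inspection of leading coefficients. A singular shift by t, for t nonzero, corresponds to its root
  u = 1 / t.\<close>

lemma finite_singular_shifts:
  fixes A :: "complex^'n^'n"
  shows "finite {t::real. det (A + t *\<^sub>R mat 1) = 0}"
proof -
  define q where "q = det (\<chi> i j. [:if i = j then 1 else 0, A $ i $ j:] :: complex poly^'n^'n)"
  have q: "poly q u = det (\<chi> i j. (if i = j then 1 else 0) + u * A $ i $ j)" for u
    by (simp add: q_def det_def poly_sum poly_prod)
  have "poly q 0 = det (mat 1 :: complex^'n^'n)"
    unfolding q by (simp add: mat_def)
  then have "q \<noteq> 0"
    by auto
  then have "finite {u. poly q u = 0}"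
    by (rule poly_roots_finite)
  moreover have "{t::real. det (A + t *\<^sub>R mat 1) = 0} \<subseteq> insert 0 ((\<lambda>u. Re (1 / u)) ` {u. poly q u = 0})"
  proof
    fix t :: real
    assume "t \<in> {t. det (A + t *\<^sub>R mat 1) = 0}"
    then obtain x where x: "x \<noteq> 0" "(A + t *\<^sub>R mat 1) *v x = 0"
      using det_zero_kernel[of "A + t *\<^sub>R mat 1"] by auto
    show "t \<in> insert 0 ((\<lambda>u. Re (1 / u)) ` {u. poly q u = 0})"
    proof (cases "t = 0")
      case False
      let ?B = "\<chi> i j. (if i = j then 1 else 0) + complex_of_real (1 / t) * A $ i $ j"
      have "?B = (1 / t) *\<^sub>R (A + t *\<^sub>R mat 1)"
        using False by (simp add: vec_eq_iff mat_def scaleR_conv_of_real[where 'a = complex] field_simps)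
      then have "?B *v x = 0"
        by (simp only: scaleR_matrix_mult_vector x) simp
      then have "det ?B = 0"
        using matrix_left_mult_zero[of ?B x] x(1) by blast
      then have "poly q (complex_of_real (1 / t)) = 0"
        by (simp add: q)
      then show ?thesis
        using False by (intro insertI2 image_eqI[of _ _ "complex_of_real (1 / t)"]) auto
    qed simp
  qed
  ultimately show ?thesis
    by (meson finite_imageI finite_insert finite_subset)
qed

lemma sigma_finite_PiM:
  assumes "finite I" "\<And>i. sigma_finite_measure (M i)"
  shows "sigma_finite_measure (PiM I M)"
proof -
  interpret product_sigma_finite M
    using assms(2) by (simp add: product_sigma_finite_def)
  show ?thesis
    by (rule sigma_finite[OF assms(1)])
qed

lemma borel_measurable_cnj [measurable (raw)]:
  "f \<in> borel_measurable M \<Longrightarrow> (\<lambda>x. cnj (f x)) \<in> borel_measurable M"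
  by (rule measurable_compose[OF _ borel_measurable_continuous_onI]) (auto intro: continuous_intros)

lemma borel_measurable_outer [measurable]: "outer \<in> borel_measurable borel"
  unfolding outer_def[abs_def] by measurable

lemma measurable_component_borel [measurable (raw)]:
  "l \<in> I \<Longrightarrow> (\<lambda>G. G l) \<in> measurable (PiM I (\<lambda>_. lborel)) borel"
  using measurable_component_singleton[of l I "\<lambda>_. lborel"] by (simp cong: measurable_cong_sets)

lemma borel_measurable_gram [measurable]: "gram n \<in> borel_measurable (PiM {..<n} (\<lambda>_. lborel))"
  unfolding gram_def[abs_def]
  by (intro borel_measurable_sum measurable_compose[OF _ borel_measurable_outer] measurable_component_borel) auto

text \<open>
  Choose \<open>d\<close> of the \<open>n\<close> rows. Adding \<open>t\<close> times the identity to them preserves Lebesgue measure and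
  makes the block nonsingular for all but finitely many \<open>t\<close>; Fubini then shows that singular blocks are null.
\<close>

lemma AE_gram_pos_def:
  assumes n: "CARD('d) \<le> n"
  shows "AE G in PiM {..<n} (\<lambda>_. lborel). pos_def (gram n G :: complex^'d^'d)"
proof -
  let ?N = "PiM {..<n} (\<lambda>_. lborel :: (complex^'d) measure)"
  obtain \<iota> :: "'d \<Rightarrow> nat" where \<iota>: "inj \<iota>" "\<And>a. \<iota> a < n"
    using card_le_inj[of "UNIV :: 'd set" "{..<n}"] n by auto
  define top where "top G = (\<chi> a. G (\<iota> a))" for G :: "nat \<Rightarrow> complex^'d"
  have top [measurable]: "top \<in> borel_measurable ?N"
    unfolding top_def using \<iota>(2) by (intro borel_measurable_vec_lambda measurable_component_borel) auto
  \<comment> \<open>The shift of row \<open>\<iota> a\<close> is basis vector \<open>a\<close>, so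
    moving the rows by t times \<open>E\<close> adds t times the identity to the selected block and
    leaves the other rows alone.\<close>
  define E where "E l = (if l \<in> range \<iota> then axis (inv \<iota> l) 1 else 0 :: complex^'d)" for l
  have top_shift: "top (\<lambda>l\<in>{..<n}. G l + t *\<^sub>R E l) = top G + t *\<^sub>R mat 1" for G t
    using \<iota> by (auto simp: top_def vec_eq_iff E_def mat_def axis_def)
  interpret N: sigma_finite_measure ?N
    by (intro sigma_finite_PiM sigma_finite_lborel) simp
  interpret P: pair_sigma_finite ?N "lborel :: real measure" ..
  let ?z = "\<lambda>A :: complex^'d^'d. indicator {A. det A = 0} A :: ennreal"
  have z [measurable]: "?z \<in> borel_measurable borel"
    by measurable
  have shift: "(\<integral>\<^sup>+G. ?z (top G + t *\<^sub>R mat 1) \<partial>?N) = (\<integral>\<^sup>+G. ?z (top G) \<partial>?N)" for t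
  proof -
    have [measurable_cong]: "sets ?N = sets (PiM {..<n} (\<lambda>_. borel))"
      by (intro sets_PiM_cong) auto
    have "ennreal (1 ^ card {..<n}) * (\<integral>\<^sup>+G. ?z (top (\<lambda>l\<in>{..<n}. G l + t *\<^sub>R E l)) \<partial>?N) = (\<integral>\<^sup>+G. ?z (top G) \<partial>?N)"
      by (rule nn_integral_PiM_lborel_scale[where F = "\<lambda>G. ?z (top G)" and L = "\<lambda>l x. x + t *\<^sub>R E l"])
        (auto simp: nn_integral_lborel_translate)
    then show ?thesis
      by (simp add: top_shift)
  qed
  \<comment> \<open>The mass of the singular blocks is the same after every shift, so it may be
    averaged over t in [0, 1]; with the integrals exchanged, each \<open>G\<close> meets only
    finitely many bad t.\<close>
  have "(\<integral>\<^sup>+G. ?z (top G) \<partial>?N) = (\<integral>\<^sup>+t. indicator {0..1::real} t * (\<integral>\<^sup>+G. ?z (top G) \<partial>?N) \<partial>lborel)"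
    by (simp add: nn_integral_multc)
  also have "\<dots> = (\<integral>\<^sup>+t. (\<integral>\<^sup>+G. indicator {0..1} t * ?z (top G + t *\<^sub>R mat 1) \<partial>?N) \<partial>lborel)"
    by (subst nn_integral_cmult) (auto simp: shift)
  also have "\<dots> = (\<integral>\<^sup>+G. (\<integral>\<^sup>+t. indicator {0..1} t * ?z (top G + t *\<^sub>R mat 1) \<partial>lborel) \<partial>?N)"
    by (rule P.Fubini') measurable
  also have "\<dots> = (\<integral>\<^sup>+G. 0 \<partial>?N)"
  proof (rule nn_integral_cong)
    fix G
    have "AE t in lborel. t \<notin> {t. det (top G + t *\<^sub>R mat 1) = 0}"
      using finite_imp_null_set_lborel[OF finite_singular_shifts[of "top G"]] by (rule AE_not_in)
    then have "AE t in lborel. indicator {0..1} t * ?z (top G + t *\<^sub>R mat 1) = 0"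
      by (rule eventually_mono) simp
    then show "(\<integral>\<^sup>+t. indicator {0..1} t * ?z (top G + t *\<^sub>R mat 1) \<partial>lborel) = 0"
      by (subst nn_integral_0_iff_AE) auto
  qed
  finally have "(\<integral>\<^sup>+G. ?z (top G) \<partial>?N) = 0"
    by simp
  then have "AE G in ?N. ?z (top G) = 0"
    by (subst (asm) nn_integral_0_iff_AE) auto
  then show ?thesis
    by (rule eventually_mono) (use \<iota> in \<open>auto simp: top_def indicator_def intro!: pos_def_gram split: if_splits\<close>)
qed

text \<open>Each of the \<open>n\<close> rows is moved by the transpose of \<open>T\<close>, with
  Jacobian |det T|^2.\<close>

lemma gram_relatively_invariant:
  fixes T :: "complex^'d^'d"
  assumes T: "det T \<noteq> 0" and f [measurable]: "f \<in> borel_measurable borel"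
  shows "ennreal (cmod (det T) ^ (2 * n)) *
      (\<integral>\<^sup>+G. f (adjoint_matrix T ** gram n G ** T) \<partial>PiM {..<n} (\<lambda>_. lborel)) =
    (\<integral>\<^sup>+G. f (gram n G) \<partial>PiM {..<n} (\<lambda>_. lborel))"
proof -
  let ?N = "PiM {..<n} (\<lambda>_. lborel :: (complex^'d) measure)"
  have [measurable_cong]: "sets ?N = sets (PiM {..<n} (\<lambda>_. borel))"
    by (intro sets_PiM_cong) auto
  have d: "det (transpose T) \<noteq> 0" "cmod (det (transpose T)) = cmod (det T)"
    using T by (simp_all add: det_transpose)
  have m [measurable]: "(*v) (transpose T) \<in> borel_measurable borel"
    unfolding matrix_vector_mult_def[abs_def] by measurable
  have "ennreal (((cmod (det T))\<^sup>2) ^ card {..<n}) *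
      (\<integral>\<^sup>+G. f (gram n (\<lambda>l\<in>{..<n}. transpose T *v G l)) \<partial>?N) = (\<integral>\<^sup>+G. f (gram n G) \<partial>?N)"
    by (rule nn_integral_PiM_lborel_scale[where F = "\<lambda>G. f (gram n G)" and L = "\<lambda>_. (*v) (transpose T)"])
      (use T m nn_integral_matrix_vector_mult[OF d(1)] in \<open>auto simp: d(2)\<close>)
  then show ?thesis
    by (simp add: gram_congruence power_mult)
qed

section \<open>From independent entries to independent rows\<close>

lemma distr_vec_lambda_lborel:
  "distr (PiM UNIV (\<lambda>_. lborel)) borel vec_lambda = (lborel :: ('a::euclidean_space^'n) measure)"
proof (rule lborel_eqI[symmetric])
  interpret product_sigma_finite "\<lambda>_::'n. lborel :: 'a measure"
    by (simp add: product_sigma_finite_def sigma_finite_lborel)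
  have m: "vec_lambda \<in> borel_measurable (PiM UNIV (\<lambda>_. lborel))"
    by (intro borel_measurable_vec_lambda measurable_component_borel) simp
  fix l u :: "'a^'n" assume le: "\<And>b. b \<in> Basis \<Longrightarrow> l \<bullet> b \<le> u \<bullet> b"
  have le': "l $ i \<bullet> b \<le> u $ i \<bullet> b" if "b \<in> Basis" for i b
    using le[of "axis i b"] that by (auto simp: inner_axis Basis_vec_def)
  have "vec_lambda -` box l u \<inter> space (PiM UNIV (\<lambda>_. lborel)) = (\<Pi>\<^sub>E i\<in>UNIV. box (l $ i) (u $ i))"
    by (auto simp: space_PiM mem_box Basis_vec_def inner_axis PiE_iff extensional_def)
  then have "emeasure (distr (PiM UNIV (\<lambda>_. lborel)) borel vec_lambda) (box l u) =
      emeasure (PiM UNIV (\<lambda>_. lborel)) (\<Pi>\<^sub>E i\<in>UNIV. box (l $ i) (u $ i))"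
    by (subst emeasure_distr[OF m]) auto
  also have "\<dots> = (\<Prod>i\<in>UNIV. emeasure lborel (box (l $ i) (u $ i)))"
    by (intro emeasure_PiM) auto
  also have "\<dots> = (\<Prod>i\<in>UNIV. ennreal (\<Prod>b\<in>Basis. (u $ i - l $ i) \<bullet> b))"
    using le' by (intro prod.cong refl) (simp add: emeasure_lborel_box)
  also have "\<dots> = ennreal (\<Prod>i\<in>UNIV. \<Prod>b\<in>Basis. (u $ i - l $ i) \<bullet> b)"
    using le' by (intro prod_ennreal prod_nonneg) (auto simp: inner_diff_left)
  also have "(\<Prod>i\<in>UNIV. \<Prod>b\<in>Basis. (u $ i - l $ i) \<bullet> b) = (\<Prod>b\<in>Basis. (u - l) \<bullet> b)"
    by (simp add: prod_Basis_vec inner_axis)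
  finally show "emeasure (distr (PiM UNIV (\<lambda>_. lborel)) borel vec_lambda) (box l u) = (\<Prod>b\<in>Basis. (u - l) \<bullet> b)" .
qed simp

lemma emeasure_lborel_vec_box:
  fixes B :: "'n::finite \<Rightarrow> 'a::euclidean_space set"
  assumes "\<And>i. B i \<in> sets borel"
  shows "emeasure lborel {v. \<forall>i. v $ i \<in> B i} = (\<Prod>i\<in>UNIV. emeasure lborel (B i))"
proof -
  interpret product_sigma_finite "\<lambda>_::'n. lborel :: 'a measure"
    by (simp add: product_sigma_finite_def sigma_finite_lborel)
  have m: "vec_lambda \<in> borel_measurable (PiM UNIV (\<lambda>_. lborel :: 'a measure))"
    by (intro borel_measurable_vec_lambda measurable_component_borel) simp
  have [measurable]: "\<And>i. B i \<in> sets borel"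
    by fact
  have "{v. \<forall>i. v $ i \<in> B i} \<in> sets borel"
    by measurable
  then have "emeasure lborel {v. \<forall>i. v $ i \<in> B i} =
      emeasure (PiM UNIV (\<lambda>_. lborel)) (vec_lambda -` {v. \<forall>i. v $ i \<in> B i} \<inter> space (PiM UNIV (\<lambda>_. lborel)))"
    by (subst distr_vec_lambda_lborel[symmetric], subst emeasure_distr[OF m]) auto
  also have "vec_lambda -` {v. \<forall>i. v $ i \<in> B i} \<inter> space (PiM UNIV (\<lambda>_. lborel :: 'a measure)) = Pi\<^sub>E UNIV B"
    by (auto simp: space_PiM PiE_iff extensional_def)
  also have "emeasure (PiM UNIV (\<lambda>_. lborel)) \<dots> = (\<Prod>i\<in>UNIV. emeasure lborel (B i))"
    using assms by (intro emeasure_PiM) auto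
  finally show ?thesis .
qed

text \<open>\<open>wishart_gram\<close> is built on entries indexed by pairs, whereas the group acts
  on whole rows; this is the passage between the two products.\<close>

lemma distr_PiM_rows:
  "distr (PiM {..<n::nat} (\<lambda>_. lborel :: ('a::euclidean_space^'n) measure)) (PiM ({..<n} \<times> UNIV) (\<lambda>_. lborel))
      (\<lambda>G. \<lambda>p\<in>{..<n} \<times> UNIV. G (fst p) $ snd p) =
    PiM ({..<n} \<times> UNIV) (\<lambda>_. lborel :: 'a measure)"
proof (rule product_sigma_finite.PiM_eqI)
  interpret product_sigma_finite "\<lambda>_::nat. lborel :: ('a^'n) measure"
    by (simp add: product_sigma_finite_def sigma_finite_lborel)
  show "product_sigma_finite (\<lambda>_::nat \<times> 'n. lborel :: 'a measure)"
    by (simp add: product_sigma_finite_def sigma_finite_lborel)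
  let ?N = "PiM {..<n} (\<lambda>_. lborel :: ('a^'n) measure)"
  have m: "(\<lambda>G. \<lambda>p\<in>{..<n} \<times> UNIV. G (fst p) $ snd p) \<in> measurable ?N (PiM ({..<n} \<times> UNIV) (\<lambda>_. lborel))"
    by (intro measurable_restrict) (auto intro!: borel_measurable_vec_nth measurable_component_borel)
  fix A :: "nat \<times> 'n \<Rightarrow> 'a set"
  assume "\<And>p. p \<in> {..<n} \<times> UNIV \<Longrightarrow> A p \<in> sets lborel"
  then have A [measurable]: "\<And>l a. l < n \<Longrightarrow> A (l, a) \<in> sets borel"
    by auto
  have "(\<lambda>G. \<lambda>p\<in>{..<n} \<times> UNIV. G (fst p) $ snd p) -` Pi\<^sub>E ({..<n} \<times> UNIV) A \<inter> space ?N =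
      (\<Pi>\<^sub>E l\<in>{..<n}. {v. \<forall>a. v $ a \<in> A (l, a)})"
    by (auto simp: space_PiM PiE_iff)
  then have "emeasure (distr ?N (PiM ({..<n} \<times> UNIV) (\<lambda>_. lborel)) (\<lambda>G. \<lambda>p\<in>{..<n} \<times> UNIV. G (fst p) $ snd p))
        (Pi\<^sub>E ({..<n} \<times> UNIV) A) = emeasure ?N (\<Pi>\<^sub>E l\<in>{..<n}. {v. \<forall>a. v $ a \<in> A (l, a)})"
    using A by (subst emeasure_distr[OF m]) (auto intro!: sets_PiM_I_finite)
  also have "\<dots> = (\<Prod>l<n. emeasure lborel {v. \<forall>a. v $ a \<in> A (l, a)})"
  proof (intro emeasure_PiM)
    show "{v. \<forall>a. v $ a \<in> A (l, a)} \<in> sets lborel" if "l \<in> {..<n}" for l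
    proof -
      have [measurable]: "\<And>a. A (l, a) \<in> sets borel"
        using A that by auto
      show ?thesis
        unfolding sets_lborel by measurable
    qed
  qed simp
  also have "\<dots> = (\<Prod>l<n. \<Prod>a\<in>UNIV. emeasure lborel (A (l, a)))"
    using A by (intro prod.cong refl emeasure_lborel_vec_box) auto
  also have "\<dots> = (\<Prod>p\<in>{..<n} \<times> UNIV. emeasure lborel (A p))"
    by (simp add: prod.cartesian_product split_def)
  finally show "emeasure (distr ?N (PiM ({..<n} \<times> UNIV) (\<lambda>_. lborel)) (\<lambda>G. \<lambda>p\<in>{..<n} \<times> UNIV. G (fst p) $ snd p))
        (Pi\<^sub>E ({..<n} \<times> UNIV) A) = (\<Prod>p\<in>{..<n} \<times> UNIV. emeasure lborel (A p))" .
qed auto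

text \<open>The product of the scalar Gaussian densities depends on \<open>G\<close> only through
  the trace of its Gram matrix. It can therefore be moved into the integrand, leaving pure Lebesgue
  measure on the rows, to which relative invariance applies.\<close>

lemma nn_integral_wishart_gram:
  fixes f :: "complex^'d^'d \<Rightarrow> ennreal"
  assumes f [measurable]: "f \<in> borel_measurable borel"
  shows "(\<integral>\<^sup>+w. f w \<partial>wishart_gram n) = (\<integral>\<^sup>+G. f (gram n G) *
      ennreal (exp (- Re (trace (gram n G))) / pi ^ (n * CARD('d))) \<partial>PiM {..<n} (\<lambda>_. lborel))"
proof -
  let ?I = "{..<n} \<times> (UNIV :: 'd set)"
  let ?N = "PiM {..<n} (\<lambda>_. lborel :: (complex^'d) measure)"
  let ?L = "PiM ?I (\<lambda>_. lborel :: complex measure)"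
  let ?\<phi> = "\<lambda>z. ennreal (exp (- (cmod z)\<^sup>2) / pi)"
  let ?m = "\<lambda>G :: nat \<times> 'd \<Rightarrow> complex. (\<chi> a b. \<Sum>l<n. cnj (G (l, a)) * G (l, b)) :: complex^'d^'d"
  let ?r = "\<lambda>G. \<lambda>p\<in>?I. G (fst p) $ snd p"
  have c [measurable]: "(\<lambda>G. G (l, a)) \<in> borel_measurable ?L" if "l < n" for l a
    using that by (intro measurable_component_borel) auto
  have m [measurable]: "?m \<in> borel_measurable ?L"
    by (intro borel_measurable_vec_lambda borel_measurable_sum borel_measurable_times c
        measurable_compose[OF c borel_measurable_continuous_onI]) (auto intro: continuous_intros)
  have ph [measurable]: "(\<lambda>G. \<Prod>p\<in>?I. ?\<phi> (G p)) \<in> borel_measurable ?L"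
    by (intro borel_measurable_prod_ennreal) (auto intro!: measurable_compose[OF measurable_component_borel])
  have r [measurable]: "?r \<in> measurable ?N ?L"
    by (intro measurable_restrict) (auto intro!: borel_measurable_vec_nth measurable_component_borel)
  have dens: "PiM ?I (\<lambda>_. std_complex_gaussian) = density ?L (\<lambda>G. \<Prod>p\<in>?I. ?\<phi> (G p))"
    unfolding std_complex_gaussian_def
  proof (rule PiM_density_eq)
    show "sigma_finite_measure (density lborel ?\<phi>)" for i :: "nat \<times> 'd"
      by (subst sigma_finite_measure.sigma_finite_iff_density_finite[OF sigma_finite_lborel]) auto
  qed (auto simp: sigma_finite_lborel)
  have "(\<integral>\<^sup>+w. f w \<partial>wishart_gram n) = (\<integral>\<^sup>+G. f (?m G) \<partial>density ?L (\<lambda>G. \<Prod>p\<in>?I. ?\<phi> (G p)))"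
    unfolding wishart_gram_def dens by (rule nn_integral_distr) auto
  also have "\<dots> = (\<integral>\<^sup>+G. (\<Prod>p\<in>?I. ?\<phi> (G p)) * f (?m G) \<partial>?L)"
    by (rule nn_integral_density) measurable
  also have "\<dots> = (\<integral>\<^sup>+G. (\<Prod>p\<in>?I. ?\<phi> (G p)) * f (?m G) \<partial>distr ?N ?L ?r)"
    by (simp only: distr_PiM_rows)
  also have "\<dots> = (\<integral>\<^sup>+G. (\<Prod>p\<in>?I. ?\<phi> (?r G p)) * f (?m (?r G)) \<partial>?N)"
    by (rule nn_integral_distr) measurable
  also have "\<dots> = (\<integral>\<^sup>+G. f (gram n G) * ennreal (exp (- Re (trace (gram n G))) / pi ^ (n * CARD('d))) \<partial>?N)"
  proof (intro nn_integral_cong)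
    fix G :: "nat \<Rightarrow> complex^'d"
    have "?m (?r G) = gram n G"
      by (simp add: gram_def outer_def vec_eq_iff)
    moreover have "(\<Prod>p\<in>?I. ?\<phi> (?r G p)) = ennreal (exp (- Re (trace (gram n G))) / pi ^ (n * CARD('d)))"
    proof -
      have "(\<Prod>p\<in>?I. ?\<phi> (?r G p)) = ennreal (\<Prod>p\<in>?I. exp (- (cmod (G (fst p) $ snd p))\<^sup>2) / pi)"
        by (subst prod_ennreal[symmetric]) auto
      also have "(\<Prod>p\<in>?I. exp (- (cmod (G (fst p) $ snd p))\<^sup>2) / pi) =
          exp (\<Sum>p\<in>?I. - (cmod (G (fst p) $ snd p))\<^sup>2) / pi ^ (n * CARD('d))"
        by (simp add: prod_dividef exp_sum card_cartesian_product)
      also have "(\<Sum>p\<in>?I. - (cmod (G (fst p) $ snd p))\<^sup>2) = - Re (trace (gram n G))"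
        by (simp add: Re_trace_gram sum_negf sum.cartesian_product split_def)
      finally show ?thesis .
    qed
    ultimately show "(\<Prod>p\<in>?I. ?\<phi> (?r G p)) * f (?m (?r G)) =
        f (gram n G) * ennreal (exp (- Re (trace (gram n G))) / pi ^ (n * CARD('d)))"
      by (simp add: mult.commute)
  qed
  finally show ?thesis .
qed

subsection \<open>Densities of Wishart matrices\<close>

lemma nn_integral_lebesgue_herm:
  "f \<in> borel_measurable borel \<Longrightarrow> (\<integral>\<^sup>+w. f w \<partial>lebesgue_herm) = (\<integral>\<^sup>+X. f (herm_of X) \<partial>lborel)"
  unfolding lebesgue_herm_def by (rule nn_integral_distr) auto

lemma sets_lebesgue_herm [measurable_cong, simp]: "sets lebesgue_herm = sets borel"
  by (simp add: lebesgue_herm_def)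

lemma sigma_finite_lebesgue_herm: "sigma_finite_measure (lebesgue_herm :: (complex^'d^'d) measure)"
  unfolding lebesgue_herm_def
proof (rule sigma_finite_distr_lborel)
  show "bounded (herm_of -` cball 0 r :: (real^'d^'d) set)" for r
    by (rule boundedI[of _ r]) (simp add: norm_herm_of)
qed measurable

lemma pos_def_congruence_iff:
  assumes T: "det T \<noteq> 0"
  shows "pos_def (adjoint_matrix T ** A ** T) \<longleftrightarrow> pos_def A"
proof
  assume "pos_def (adjoint_matrix T ** A ** T)"
  then have "pos_def (adjoint_matrix (matrix_inv T) ** (adjoint_matrix T ** A ** T) ** matrix_inv T)"
    by (rule pos_def_congruence) (use T in \<open>simp add: det_matrix_inv\<close>)
  moreover have "adjoint_matrix (matrix_inv T) ** (adjoint_matrix T ** A ** T) ** matrix_inv T =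
      adjoint_matrix (T ** matrix_inv T) ** A ** (T ** matrix_inv T)"
    by (simp add: adjoint_matrix_mult matrix_mul_assoc)
  ultimately show "pos_def A"
    by (simp add: matrix_inv_right[OF T])
qed (rule pos_def_congruence[OF _ T])

definition cone_weight :: "nat \<Rightarrow> complex^'d^'d \<Rightarrow> real" where
  "cone_weight m w = (if pos_def w then Re (det w) ^ m else 0)"

lemma borel_measurable_cone_weight [measurable]: "cone_weight m \<in> borel_measurable borel"
  unfolding cone_weight_def[abs_def] by measurable

lemma cone_weight_nonneg: "0 \<le> cone_weight m w"
  using det_pos_def(2)[of w] by (auto simp: cone_weight_def intro!: zero_le_power less_imp_le)

text \<open>The exponent splits as 2n = 2d + 2(n - d), from the Jacobian of the congruence and from
  the determinant weight. It agrees with the one in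
  \<open>gram_relatively_invariant\<close>.\<close>

lemma cone_relatively_invariant:
  fixes T :: "complex^'d^'d"
  assumes n: "CARD('d) \<le> n" and T: "det T \<noteq> 0" and f [measurable]: "f \<in> borel_measurable borel"
  defines "N \<equiv> density lborel (\<lambda>X. ennreal (cone_weight (n - CARD('d)) (herm_of X :: complex^'d^'d)))"
  shows "ennreal (cmod (det T) ^ (2 * n)) * (\<integral>\<^sup>+X. f (adjoint_matrix T ** herm_of X ** T) \<partial>N) =
    (\<integral>\<^sup>+X. f (herm_of X) \<partial>N)"
proof -
  let ?w = "cone_weight (n - CARD('d)) :: complex^'d^'d \<Rightarrow> real"
  let ?t = "cmod (det T)"
  have w: "?t ^ (2 * n) * ?w A = ?t ^ (2 * CARD('d)) * ?w (adjoint_matrix T ** A ** T)" for A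
  proof -
    have "?t ^ (2 * n) = ?t ^ (2 * CARD('d)) * (?t\<^sup>2) ^ (n - CARD('d))"
    proof -
      have "2 * n = 2 * CARD('d) + 2 * (n - CARD('d))"
        using n by simp
      then show ?thesis
        by (simp only: power_add power_mult)
    qed
    then show ?thesis
      by (simp add: cone_weight_def pos_def_congruence_iff[OF T] Re_det_congruence power_mult_distrib)
  qed
  have "ennreal (?t ^ (2 * n)) * (\<integral>\<^sup>+X. f (adjoint_matrix T ** herm_of X ** T) \<partial>N) =
      (\<integral>\<^sup>+X. ennreal (?t ^ (2 * n)) * (ennreal (?w (herm_of X)) * f (adjoint_matrix T ** herm_of X ** T)) \<partial>lborel)"
    unfolding N_def by (subst nn_integral_density) (auto simp: nn_integral_cmult)
  also have "\<dots> = (\<integral>\<^sup>+X. ennreal (?t ^ (2 * CARD('d))) * (ennreal (?w (adjoint_matrix T ** herm_of X ** T)) *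
      f (adjoint_matrix T ** herm_of X ** T)) \<partial>lborel)"
    by (simp add: mult.assoc[symmetric] cone_weight_nonneg w flip: ennreal_mult)
  also have "\<dots> = ennreal (?t ^ (2 * CARD('d))) * (\<integral>\<^sup>+X. ennreal (?w (adjoint_matrix T ** herm_of X ** T)) *
      f (adjoint_matrix T ** herm_of X ** T) \<partial>lborel)"
    by (rule nn_integral_cmult) measurable
  also have "\<dots> = (\<integral>\<^sup>+X. ennreal (?w (herm_of X)) * f (herm_of X) \<partial>lborel)"
    by (rule nn_integral_herm_congruence[OF T, of "\<lambda>w. ennreal (?w w) * f w"]) measurable
  also have "\<dots> = (\<integral>\<^sup>+X. f (herm_of X) \<partial>N)"
    unfolding N_def by (subst nn_integral_density) auto
  finally show ?thesis .
qed

text \<open>Provides the test function on the cone side. On the unit ball the weight is bounded by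
  compactness, and it is positive on the nonempty open part of the ball inside the cone.\<close>

lemma nn_integral_cone_ball:
  defines "J \<equiv> \<lambda>m. (\<integral>\<^sup>+X. indicator {w. norm w \<le> 1} (herm_of X) \<partial>density lborel
    (\<lambda>X. ennreal (cone_weight m (herm_of X :: complex^'d^'d))))"
  shows "0 < J m" "J m < \<infinity>"
proof -
  let ?w = "\<lambda>X. cone_weight m (herm_of X :: complex^'d^'d)"
  have J: "J m = (\<integral>\<^sup>+X. ennreal (?w X) * indicator (cball 0 1) X \<partial>lborel)"
    unfolding J_def by (subst nn_integral_density) (auto simp: indicator_def norm_herm_of intro!: nn_integral_cong)
  have "continuous_on (cball 0 1) (\<lambda>X. cmod (det (herm_of X :: complex^'d^'d)) ^ m)"
    by (intro continuous_intros continuous_on_det continuous_on_herm_of)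
  then have "bounded ((\<lambda>X. cmod (det (herm_of X :: complex^'d^'d)) ^ m) ` cball 0 1)"
    by (intro compact_imp_bounded compact_continuous_image compact_cball)
  then obtain K where "\<forall>y\<in>(\<lambda>X. cmod (det (herm_of X :: complex^'d^'d)) ^ m) ` cball 0 1. norm y \<le> K"
    unfolding bounded_iff by blast
  then have K: "cmod (det (herm_of X :: complex^'d^'d)) ^ m \<le> K" if "norm X \<le> 1" for X
    using that by (force simp: norm_power)
  have "?w X \<le> K" if "norm X \<le> 1" for X
  proof (cases "pos_def (herm_of X :: complex^'d^'d)")
    case True
    then have "?w X \<le> cmod (det (herm_of X :: complex^'d^'d)) ^ m"
      using det_pos_def(2)[OF True] complex_Re_le_cmod by (auto simp: cone_weight_def intro!: power_mono)
    with K[OF that] show ?thesis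
      by linarith
  next
    case False
    then show ?thesis
      using order_trans[OF _ K[OF that], of 0] by (simp add: cone_weight_def)
  qed
  then have "J m \<le> (\<integral>\<^sup>+X. ennreal K * indicator (cball 0 1) X \<partial>(lborel :: (real^'d^'d) measure))"
    unfolding J by (intro nn_integral_mono) (auto simp: indicator_def intro: ennreal_leI)
  also have "\<dots> = ennreal K * emeasure lborel (cball (0 :: real^'d^'d) 1)"
    by (rule nn_integral_cmult_indicator) simp
  also have "\<dots> < \<infinity>"
    using emeasure_bounded_finite[of "cball (0 :: real^'d^'d) 1"] by (simp add: ennreal_mult_less_top)
  finally show "J m < \<infinity>" .
  show "0 < J m"
  proof (rule ccontr)
    assume "\<not> 0 < J m"
    then have "(\<integral>\<^sup>+X. ennreal (?w X) * indicator (cball 0 1) X \<partial>lborel) = 0"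
      by (simp add: J not_less)
    moreover have [measurable]: "cball (0 :: real^'d^'d) 1 \<in> sets borel"
      by simp
    ultimately have null: "emeasure lborel {X. ennreal (?w X) * indicator (cball 0 1) X \<noteq> 0} = 0"
      by (subst (asm) nn_integral_0_iff) (auto, measurable)
    let ?c = "1 / (1 + norm (mat 1 :: complex^'d^'d))"
    have c: "0 < ?c"
      by (intro divide_pos_pos add_pos_nonneg) auto
    have c1: "norm (?c *\<^sub>R mat 1 :: complex^'d^'d) < 1"
      by (simp add: abs_of_pos add_pos_nonneg)
    have h: "herm_of (herm_coords (?c *\<^sub>R mat 1 :: complex^'d^'d)) = ?c *\<^sub>R mat 1"
      by (rule herm_of_herm_coords) (auto simp: vec_eq_iff mat_def)
    have "0 < emeasure lborel ({X. pos_def (herm_of X :: complex^'d^'d)} \<inter> ball 0 1)"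
    proof (rule emeasure_lborel_open_pos)
      show "open ({X. pos_def (herm_of X :: complex^'d^'d)} \<inter> ball 0 1)"
        by (intro open_Int open_pos_def open_ball)
      have "norm (herm_coords (?c *\<^sub>R mat 1 :: complex^'d^'d)) < 1"
        using c1 norm_herm_of[of "herm_coords (?c *\<^sub>R mat 1 :: complex^'d^'d)"] by (simp only: h)
      moreover have "pos_def (?c *\<^sub>R mat 1 :: complex^'d^'d)"
        by (intro pos_def_scaleR pos_def_mat_1 c)
      ultimately show "herm_coords (?c *\<^sub>R mat 1 :: complex^'d^'d) \<in> {X. pos_def (herm_of X)} \<inter> ball 0 1"
        using h by simp
    qed
    also have "\<dots> \<le> emeasure lborel {X. ennreal (?w X) * indicator (cball 0 1) X \<noteq> 0}"
      by (intro emeasure_mono) (auto simp: cone_weight_def dest: det_pos_def(2))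
    finally show False
      using null by simp
  qed
qed

text \<open>On singular positive matrices the weight is zero, even for \<open>s = CARD('d)\<close>,
  because \<open>0 powr 0 = 0\<close>; so \<open>psd\<close> may be replaced by
  \<open>pos_def\<close>.\<close>

lemma wishart_weight_eq:
  fixes w :: "complex^'d^'d"
  shows "wishart_weight s w =
    (if pos_def w then exp (- Re (trace w)) * Re (det w) powr (s - real CARD('d)) else 0)"
  by (auto simp: wishart_weight_def pos_def_def indicator_def)

lemma wishart_weight_nonneg: "0 \<le> wishart_weight s w"
  by (simp add: wishart_weight_def)

lemma borel_measurable_wishart_weight [measurable]:
  "wishart_weight s \<in> borel_measurable (borel :: (complex^'d^'d) measure)"
  unfolding wishart_weight_def[abs_def] by measurable

lemma wishart_weight_nat:
  fixes w :: "complex^'d^'d"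
  assumes "CARD('d) \<le> n"
  shows "wishart_weight (real n) w = cone_weight (n - CARD('d)) w * exp (- Re (trace w))"
proof (cases "pos_def w")
  case True
  then have "Re (det w) powr (real n - real CARD('d)) = Re (det w) ^ (n - CARD('d))"
    using det_pos_def(2)[OF True] assms by (simp add: powr_realpow flip: of_nat_diff)
  with True show ?thesis
    by (simp add: wishart_weight_eq cone_weight_def)
qed (simp add: wishart_weight_eq cone_weight_def)

text \<open>The Gram image of Lebesgue measure and the cone measure are proportional, and both get
  multiplied by exp (- Tr w) / pi^(n d). Total mass one makes this weight a test function of
  integral 1 on the Gram side, so no Gaussian integral is evaluated.\<close>

lemma wishart_gram_density:
  assumes n: "CARD('d) \<le> n" and prob: "emeasure (wishart_gram n :: (complex^'d^'d) measure) UNIV = 1"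
  shows "\<exists>K>0. (wishart_gram n :: (complex^'d^'d) measure) =
    density lebesgue_herm (\<lambda>w. ennreal (K * wishart_weight (real n) w))"
proof -
  let ?N1 = "PiM {..<n} (\<lambda>_. lborel :: (complex^'d) measure)"
  let ?cw = "cone_weight (n - CARD('d)) :: complex^'d^'d \<Rightarrow> real"
  let ?N2 = "density lborel (\<lambda>X. ennreal (?cw (herm_of X)))"
  let ?p = "pi ^ (n * CARD('d))"
  let ?e = "\<lambda>w :: complex^'d^'d. ennreal (exp (- Re (trace w)) / ?p)"
  have sf2: "sigma_finite_measure ?N2"
    by (subst sigma_finite_measure.sigma_finite_iff_density_finite[OF sigma_finite_lborel]) auto
  have pd2: "AE X in ?N2. pos_def (herm_of X)"
    by (subst AE_density) (auto simp: cone_weight_def)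
  have "(\<integral>\<^sup>+G. ?e (gram n G) \<partial>?N1) = emeasure (wishart_gram n :: (complex^'d^'d) measure) UNIV"
    using nn_integral_wishart_gram[of "\<lambda>_ :: complex^'d^'d. 1" n] by (simp add: wishart_gram_def)
  then have f1: "(\<integral>\<^sup>+G. ?e (gram n G) \<partial>?N1) = 1"
    using prob by simp
  have "\<exists>K>0. \<forall>f\<in>borel_measurable borel.
      (\<integral>\<^sup>+G. f (gram n G) \<partial>?N1) = ennreal K * (\<integral>\<^sup>+X. f (herm_of X) \<partial>?N2)"
  proof (rule relatively_invariant_unique[where ?f1.0 = ?e and ?f2.0 = "indicator {w. norm w \<le> 1}" and n = n])
    show "sigma_finite_measure ?N1"
      by (intro sigma_finite_PiM sigma_finite_lborel) simp
  qed (use n sf2 pd2 f1 nn_integral_cone_ball[where 'd = 'd, of "n - CARD('d)"] in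
      \<open>auto intro: AE_gram_pos_def gram_relatively_invariant cone_relatively_invariant\<close>)
  then obtain K where K: "K > 0" "\<And>f. f \<in> borel_measurable borel \<Longrightarrow>
      (\<integral>\<^sup>+G. f (gram n G) \<partial>?N1) = ennreal K * (\<integral>\<^sup>+X. f (herm_of X) \<partial>?N2)"
    by blast
  have "wishart_gram n = density lebesgue_herm (\<lambda>w :: complex^'d^'d. ennreal (K / ?p * wishart_weight (real n) w))"
  proof (rule measure_eqI)
    fix A assume "A \<in> sets (wishart_gram n :: (complex^'d^'d) measure)"
    then have A [measurable]: "A \<in> sets borel"
      by (simp add: wishart_gram_def)
    have "emeasure (wishart_gram n) A = (\<integral>\<^sup>+w. indicator A w \<partial>wishart_gram n)"
      using A by (subst nn_integral_indicator) (auto simp: wishart_gram_def)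
    also have "\<dots> = (\<integral>\<^sup>+G. indicator A (gram n G) * ?e (gram n G) \<partial>?N1)"
      by (rule nn_integral_wishart_gram) measurable
    also have "\<dots> = ennreal K * (\<integral>\<^sup>+X. indicator A (herm_of X) * ?e (herm_of X) \<partial>?N2)"
      by (rule K(2)) measurable
    also have "\<dots> = ennreal K * (\<integral>\<^sup>+X. ennreal (?cw (herm_of X)) * (indicator A (herm_of X) * ?e (herm_of X)) \<partial>lborel)"
      by (subst nn_integral_density) auto
    also have "\<dots> = (\<integral>\<^sup>+X. ennreal K * (ennreal (?cw (herm_of X)) * (indicator A (herm_of X) * ?e (herm_of X))) \<partial>lborel)"
      by (rule nn_integral_cmult[symmetric]) measurable
    also have "\<dots> = (\<integral>\<^sup>+X. ennreal (K / ?p * wishart_weight (real n) (herm_of X)) * indicator A (herm_of X) \<partial>lborel)"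
    proof (rule nn_integral_cong)
      fix X
      have "ennreal (K / ?p * wishart_weight (real n) (herm_of X :: complex^'d^'d)) =
          ennreal (K * (?cw (herm_of X) * (exp (- Re (trace (herm_of X))) / ?p)))"
        by (simp add: wishart_weight_nat[OF n])
      also have "\<dots> = ennreal K * (ennreal (?cw (herm_of X)) * ?e (herm_of X))"
      proof -
        have e: "0 \<le> exp (- Re (trace (herm_of X :: complex^'d^'d))) / ?p"
          by simp
        show ?thesis
          by (simp only: ennreal_mult[OF less_imp_le[OF K(1)] mult_nonneg_nonneg[OF cone_weight_nonneg e]]
              ennreal_mult[OF cone_weight_nonneg e])
      qed
      finally show "ennreal K * (ennreal (?cw (herm_of X)) * (indicator A (herm_of X) * ?e (herm_of X))) =
          ennreal (K / ?p * wishart_weight (real n) (herm_of X)) * indicator A (herm_of X)"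
        by (simp add: mult_ac)
    qed
    also have "\<dots> = (\<integral>\<^sup>+w. ennreal (K / ?p * wishart_weight (real n) w) * indicator A w \<partial>lebesgue_herm)"
      by (rule nn_integral_lebesgue_herm[symmetric]) measurable
    also have "\<dots> = emeasure (density lebesgue_herm (\<lambda>w. ennreal (K / ?p * wishart_weight (real n) w))) A"
      by (rule emeasure_density[symmetric]) measurable
    finally show "emeasure (wishart_gram n) A =
      emeasure (density lebesgue_herm (\<lambda>w. ennreal (K / ?p * wishart_weight (real n) w))) A" .
  qed (simp add: wishart_gram_def)
  then show ?thesis
    using K(1) by (intro exI[of _ "K / ?p"]) auto
qed

text \<open>Either clause of the definition gives a multiple \<open>K\<close> of the same weight,
  where a Gram matrix has n >= d by the bound on \<open>s\<close>. Total mass one then forces Z = 1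
  / K, so the law depends on \<open>s\<close> alone and the integral of the weight is
  finite.\<close>

lemma wishart_matrix_law:
  fixes W :: "'w \<Rightarrow> complex^'d^'d"
  assumes M: "prob_space M" and W: "wishart_matrix M s W" and s: "real CARD('d) \<le> s"
  defines "Z \<equiv> enn2real (\<integral>\<^sup>+w. ennreal (wishart_weight s (w :: complex^'d^'d)) \<partial>lebesgue_herm)"
  shows "0 < Z" "distr M borel W = density lebesgue_herm (\<lambda>w. ennreal (wishart_weight s w / Z))"
proof -
  have Wm: "W \<in> borel_measurable M"
    using W by (simp add: wishart_matrix_def)
  have one: "emeasure (distr M borel W) UNIV = 1"
    using prob_space.emeasure_space_1[OF prob_space.prob_space_distr[OF M Wm]] by simp
  have "\<exists>K>0. distr M borel W = density lebesgue_herm (\<lambda>w. ennreal (K * wishart_weight s w))"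
  proof (cases "distr M borel W = wishart_density s")
    case True
    define D where "D = (\<integral>u. wishart_weight s (u :: complex^'d^'d) \<partial>lebesgue_herm)"
    have dens: "distr M borel W = density lebesgue_herm (\<lambda>w. ennreal (1 / D * wishart_weight s w))"
      by (simp add: True wishart_density_def D_def)
    \<comment> \<open>The Bochner integral \<open>D\<close> would also be 0 for a non-integrable
      weight. Division by 0 would then make the law vanish, which mass one excludes.\<close>
    have "D \<noteq> 0"
    proof
      assume "D = 0"
      then have "emeasure (distr M borel W) UNIV = 0"
        by (simp add: dens emeasure_density)
      with one show False
        by simp
    qed
    moreover have "D \<ge> 0"
      unfolding D_def by (intro Bochner_Integration.integral_nonneg) (simp add: wishart_weight_nonneg)
    ultimately show ?thesis
      using dens by (intro exI[of _ "1 / D"]) auto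
  next
    case False
    then obtain n where n: "s = real n" "distr M borel W = wishart_gram n"
      using W by (auto simp: wishart_matrix_def)
    then show ?thesis
      using wishart_gram_density[where 'd = 'd, of n] one s by auto
  qed
  then obtain K where K: "K > 0" "distr M borel W = density lebesgue_herm (\<lambda>w. ennreal (K * wishart_weight s w))"
    by blast
  have "1 = (\<integral>\<^sup>+w. ennreal (K * wishart_weight s w) \<partial>(lebesgue_herm :: (complex^'d^'d) measure))"
    using one unfolding K(2) by (simp add: emeasure_density)
  also have "\<dots> = ennreal K * (\<integral>\<^sup>+w. ennreal (wishart_weight s w) \<partial>(lebesgue_herm :: (complex^'d^'d) measure))"
    using K(1) by (simp add: ennreal_mult wishart_weight_nonneg nn_integral_cmult)
  finally have "(\<integral>\<^sup>+w. ennreal (wishart_weight s w) \<partial>(lebesgue_herm :: (complex^'d^'d) measure)) = ennreal (1 / K)"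
    using K(1) by (cases "\<integral>\<^sup>+w. ennreal (wishart_weight s w) \<partial>(lebesgue_herm :: (complex^'d^'d) measure)")
      (auto simp: ennreal_mult_top field_simps simp flip: ennreal_mult ennreal_1)
  then have Z: "Z = 1 / K"
    using K(1) by (simp add: Z_def)
  then show "0 < Z" "distr M borel W = density lebesgue_herm (\<lambda>w. ennreal (wishart_weight s w / Z))"
    using K by (auto simp: mult.commute)
qed

subsection \<open>Normalisation of independent Wishart matrices\<close>

lemma borel_measurable_normalize_povm [measurable]:
  "(normalize_povm :: (complex^'d^'d)^'k \<Rightarrow> _) \<in> borel_measurable borel"
  unfolding normalize_povm_def[abs_def] Let_def by measurable

lemma Re_det_psd_nonneg: "psd A \<Longrightarrow> 0 \<le> Re (det A)"
  using det_pos_def(2)[of A] by (cases "det A = 0") (auto simp: pos_def_def less_imp_le)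

lemma psd_congruence_iff:
  assumes T: "det T \<noteq> 0"
  shows "psd (adjoint_matrix T ** A ** T) \<longleftrightarrow> psd A"
proof
  assume "psd (adjoint_matrix T ** A ** T)"
  then have "psd (adjoint_matrix (matrix_inv T) ** (adjoint_matrix T ** A ** T) ** matrix_inv T)"
    by (rule psd_congruence)
  moreover have "adjoint_matrix (matrix_inv T) ** (adjoint_matrix T ** A ** T) ** matrix_inv T =
      adjoint_matrix (T ** matrix_inv T) ** A ** (T ** matrix_inv T)"
    by (simp add: adjoint_matrix_mult matrix_mul_assoc)
  ultimately show "psd A"
    by (simp add: matrix_inv_right[OF T])
qed (rule psd_congruence)

definition psd_det_powr :: "real \<Rightarrow> complex^'d^'d \<Rightarrow> real" where
  "psd_det_powr a w = indicator {w. psd w} w * Re (det w) powr a"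

lemma borel_measurable_psd_det_powr [measurable]:
  "psd_det_powr a \<in> borel_measurable (borel :: (complex^'d^'d) measure)"
  unfolding psd_det_powr_def[abs_def] by measurable

lemma psd_det_powr_nonneg: "0 \<le> psd_det_powr a w"
  by (simp add: psd_det_powr_def)

lemma psd_det_powr_congruence:
  assumes "det T \<noteq> 0"
  shows "psd_det_powr a (adjoint_matrix T ** w ** T) = ((cmod (det T))\<^sup>2) powr a * psd_det_powr a w"
  using Re_det_psd_nonneg[of w]
  by (auto simp: psd_det_powr_def psd_congruence_iff[OF assms] Re_det_congruence powr_mult indicator_def)

lemma wishart_weight_psd_det_powr:
  fixes w :: "complex^'d^'d"
  shows "wishart_weight s w = exp (- Re (trace w)) * psd_det_powr (s - real CARD('d)) w"
  by (simp add: wishart_weight_def psd_det_powr_def)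

definition povm_weight :: "('k::finite \<Rightarrow> real) \<Rightarrow> (complex^'d^'d)^'k \<Rightarrow> real" where
  "povm_weight s m = (\<Prod>i\<in>UNIV. psd_det_powr (s i - real CARD('d)) (m $ i))"

lemma borel_measurable_povm_weight [measurable]:
  "povm_weight s \<in> borel_measurable (borel :: ((complex^'d^'d)^'k::finite) measure)"
  unfolding povm_weight_def[abs_def] by measurable

lemma povm_weight_nonneg: "0 \<le> povm_weight s m"
  unfolding povm_weight_def by (intro prod_nonneg) (simp add: psd_det_powr_nonneg)

text \<open>The unnormalised density of S. The powers s_i - d and the Jacobian (det S)^d in k - 1
  variables add up to the exponent (sum of the s_i) - d, so this is the Wishart weight whose
  parameter is the sum of the s_i.\<close>

definition sum_weight :: "('k::finite \<Rightarrow> real) \<Rightarrow> complex^'d^'d \<Rightarrow> real" where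
  "sum_weight s S = (if pos_def S then exp (- Re (trace S)) *
     (\<Prod>i\<in>UNIV. Re (det S) powr (s i - real CARD('d))) * Re (det S) ^ (CARD('d) * (CARD('k) - 1)) else 0)"

lemma borel_measurable_sum_weight [measurable]:
  "sum_weight s \<in> borel_measurable (borel :: (complex^'d^'d) measure)"
  unfolding sum_weight_def[abs_def] by measurable

lemma borel_measurable_herm_coords [measurable]: "herm_coords \<in> borel_measurable borel"
  by (intro borel_measurable_continuous_onI continuous_on_herm_coords)

lemma herm_of_sum: "herm_of (\<Sum>i\<in>I. X i) = (\<Sum>i\<in>I. herm_of (X i))"
  by (rule linear_sum[OF linear_herm_of])

text \<open>The part of the integrand over a fixed sum \<open>y\<close>: substitute \<open>x\<^sub>i = \<surd>y m\<^sub>i \<surd>y\<close>.\<close>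

lemma nn_integral_fixed_sum:
  fixes s :: "'k::finite \<Rightarrow> real" and F :: "(complex^'d^'d)^'k \<Rightarrow> ennreal" and j :: 'k and y :: "real^'d^'d"
  defines "\<Phi> \<equiv> \<lambda>X :: 'k \<Rightarrow> real^'d^'d. ennreal (\<Prod>i\<in>UNIV. wishart_weight (s i) (herm_of (X i) :: complex^'d^'d)) *
      F (normalize_povm (\<chi> i. herm_of (X i)))"
    and "\<Psi> \<equiv> \<lambda>X. ennreal (povm_weight s (\<chi> i. herm_of (X i))) * F (\<chi> i. herm_of (X i))"
    and "I \<equiv> UNIV - {j}" and "e \<equiv> herm_coords (mat 1 :: complex^'d^'d)"
  assumes [measurable]: "F \<in> borel_measurable borel"
  shows "(\<integral>\<^sup>+x. \<Phi> (x(j := y - (\<Sum>i\<in>I. x i))) \<partial>PiM I (\<lambda>_. lborel)) =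
    ennreal (sum_weight s (herm_of y :: complex^'d^'d)) *
    (\<integral>\<^sup>+x. \<Psi> (x(j := e - (\<Sum>i\<in>I. x i))) \<partial>PiM I (\<lambda>_. lborel))"
proof -
  have I: "finite I" "j \<notin> I" "UNIV = insert j I" "card I = CARD('k) - 1"
    by (auto simp: I_def)
  have sets [measurable_cong]: "sets (PiM I (\<lambda>_. lborel :: (real^'d^'d) measure)) = sets (PiM I (\<lambda>_. borel))"
    by (intro sets_PiM_cong) auto
  have comp: "(\<lambda>x. (x(j := z - (\<Sum>i\<in>I. x i))) i) \<in> borel_measurable (PiM I (\<lambda>_. borel :: (real^'d^'d) measure))" for i z
    by (cases "i = j") (auto simp: I_def intro!: borel_measurable_diff borel_measurable_sum)
  have vec [measurable]: "(\<lambda>x. (\<chi> i. herm_of ((x(j := z - (\<Sum>i\<in>I. x i))) i)) :: (complex^'d^'d)^'k) \<in>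
      borel_measurable (PiM I (\<lambda>_. borel))" for z
    by (intro borel_measurable_vec_lambda measurable_compose[OF comp borel_measurable_herm_of])
  have \<Phi>_vec: "\<Phi> X = (\<lambda>m. ennreal (\<Prod>i\<in>UNIV. wishart_weight (s i) (m $ i)) * F (normalize_povm m)) (\<chi> i. herm_of (X i))" for X
    by (simp add: \<Phi>_def)
  have \<Phi>_meas [measurable]: "(\<lambda>x. \<Phi> (x(j := y - (\<Sum>i\<in>I. x i)))) \<in> borel_measurable (PiM I (\<lambda>_. borel))"
    unfolding \<Phi>_vec by measurable
  have \<Psi>_meas [measurable]: "(\<lambda>x. \<Psi> (x(j := e - (\<Sum>i\<in>I. x i)))) \<in> borel_measurable (PiM I (\<lambda>_. borel))"
    unfolding \<Psi>_def by measurable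
  have total: "(\<Sum>i\<in>UNIV. herm_of ((x(j := z - (\<Sum>i\<in>I. x i))) i)) = (herm_of z :: complex^'d^'d)" for x z
  proof -
    have "(\<Sum>i\<in>UNIV. (x(j := z - (\<Sum>i\<in>I. x i))) i) = z"
      using I(2) by (simp add: I(1,3) sum.insert cong: sum.cong) (intro sum.cong, auto)
    then show ?thesis
      by (simp flip: herm_of_sum)
  qed
  show ?thesis
  proof (cases "pos_def (herm_of y :: complex^'d^'d)")
    case False
    \<comment> \<open>Nonzero weights make every summand positive definite, and then also the total
      \<open>herm_of y\<close>; so off the cone both sides are zero.\<close>
    have "\<Phi> (x(j := y - (\<Sum>i\<in>I. x i))) = 0" for x
    proof (rule ccontr)
      let ?X = "x(j := y - (\<Sum>i\<in>I. x i))"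
      assume "\<Phi> ?X \<noteq> 0"
      moreover have "\<Phi> ?X = 0" if "(\<Prod>i\<in>UNIV. wishart_weight (s i) (herm_of (?X i) :: complex^'d^'d)) = 0"
        unfolding \<Phi>_def that by simp
      ultimately have "(\<Prod>i\<in>UNIV. wishart_weight (s i) (herm_of (?X i) :: complex^'d^'d)) \<noteq> 0"
        by blast
      then have pd: "pos_def (herm_of (?X i) :: complex^'d^'d)" for i
        by (auto simp: prod_zero_iff wishart_weight_eq split: if_splits)
      then have psd: "psd (herm_of (?X i) :: complex^'d^'d)" for i
        unfolding pos_def_def by blast
      have "pos_def (herm_of (?X j) + (\<Sum>i\<in>I. herm_of (?X i)) :: complex^'d^'d)"
        by (rule pos_def_add_psd[OF pd psd_sum[OF psd]])
      also have "herm_of (?X j) + (\<Sum>i\<in>I. herm_of (?X i)) = (\<Sum>i\<in>UNIV. herm_of (?X i) :: complex^'d^'d)"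
        by (simp only: I(3) sum.insert[OF I(1,2)])
      finally show False
        using False by (simp only: total)
    qed
    with False show ?thesis
      by (simp add: sum_weight_def)
  next
    case True
    define R where "R = psd_sqrt (herm_of y :: complex^'d^'d)"
    have R: "adjoint_matrix R = R" "det R \<noteq> 0" "R ** R = herm_of y"
      using pos_def_psd_sqrt[OF True] psd_sqrt_square[of "herm_of y"] True
      by (auto simp: R_def pos_def_def psd_adjoint)
    have r: "(cmod (det R))\<^sup>2 = Re (det (herm_of y :: complex^'d^'d))"
      using det_pos_def(3)[OF True] by (simp add: R_def)
    have r_pos: "0 < Re (det (herm_of y :: complex^'d^'d))"
      by (rule det_pos_def(2)[OF True])
    define \<rho> where "\<rho> X = herm_coords (R ** herm_of X ** R)" for X
    have \<rho>: "herm_of (\<rho> X) = R ** herm_of X ** R" for X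
      unfolding \<rho>_def by (rule herm_of_herm_coords) (simp add: adjoint_matrix_mult R matrix_mul_assoc)
    have \<rho>_add: "\<rho> (A + B) = \<rho> A + \<rho> B" and \<rho>_scale: "\<rho> (c *\<^sub>R A) = c *\<^sub>R \<rho> A" for A B c
      by (simp_all add: \<rho>_def linear_add[OF linear_herm_of] linear_add[OF linear_herm_coords]
          linear_scale[OF linear_herm_of] linear_scale[OF linear_herm_coords]
          bounded_bilinear.add_left[OF bounded_bilinear_matrix_mult] bounded_bilinear.add_right[OF bounded_bilinear_matrix_mult]
          bounded_bilinear.scaleR_left[OF bounded_bilinear_matrix_mult] bounded_bilinear.scaleR_right[OF bounded_bilinear_matrix_mult])
    then have lin: "linear \<rho>"
      by (intro linearI)
    have [measurable]: "\<rho> \<in> borel_measurable borel"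
      unfolding \<rho>_def[abs_def] by measurable
    have \<rho>_e: "\<rho> e = y"
      by (simp add: \<rho>_def e_def herm_of_herm_coords R)
    let ?c = "cmod (det R) ^ (2 * CARD('d))"
    have "(\<integral>\<^sup>+x. \<Phi> (x(j := y - (\<Sum>i\<in>I. x i))) \<partial>PiM I (\<lambda>_. lborel)) = ennreal (?c ^ card I) *
        (\<integral>\<^sup>+x. \<Phi> ((\<lambda>i\<in>I. \<rho> (x i))(j := y - (\<Sum>i\<in>I. (\<lambda>i\<in>I. \<rho> (x i)) i))) \<partial>PiM I (\<lambda>_. lborel))"
    proof (rule nn_integral_PiM_lborel_scale[symmetric, where L = "\<lambda>_. \<rho>" and F = "\<lambda>x. \<Phi> (x(j := y - (\<Sum>i\<in>I. x i)))"])
      show "ennreal ?c * (\<integral>\<^sup>+X. f (\<rho> X) \<partial>lborel) = (\<integral>\<^sup>+X. f X \<partial>lborel)"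
        if [measurable]: "f \<in> borel_measurable borel" for f
        using nn_integral_herm_congruence[OF R(2), of "\<lambda>w. f (herm_coords w)"] by (simp add: R(1) \<rho>_def)
    qed (use I R in auto)
    also have "(\<lambda>x. \<Phi> ((\<lambda>i\<in>I. \<rho> (x i))(j := y - (\<Sum>i\<in>I. (\<lambda>i\<in>I. \<rho> (x i)) i)))) =
        (\<lambda>x. ennreal (exp (- Re (trace (herm_of y :: complex^'d^'d))) *
          (\<Prod>i\<in>UNIV. Re (det (herm_of y :: complex^'d^'d)) powr (s i - real CARD('d)))) * \<Psi> (x(j := e - (\<Sum>i\<in>I. x i))))"
    proof
      fix x
      define m where "m = x(j := e - (\<Sum>i\<in>I. x i))"
      \<comment> \<open>The eliminated component is transformed like the others: since
        \<open>\<rho>\<close> is linear with \<open>\<rho> e = y\<close>, subtracting the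
        \<open>\<rho> (x i)\<close> from \<open>y\<close> gives \<open>\<rho>\<close> of the
        difference taken from \<open>e\<close>.\<close>
      have "(\<lambda>i\<in>I. \<rho> (x i))(j := y - (\<Sum>i\<in>I. (\<lambda>i\<in>I. \<rho> (x i)) i)) = (\<lambda>i. \<rho> (m i))"
        by (auto simp: m_def fun_eq_iff I_def linear_diff[OF lin] linear_sum[OF lin] \<rho>_e)
      moreover have "\<Phi> (\<lambda>i. \<rho> (m i)) = ennreal (exp (- Re (trace (herm_of y :: complex^'d^'d))) *
          (\<Prod>i\<in>UNIV. Re (det (herm_of y :: complex^'d^'d)) powr (s i - real CARD('d)))) * \<Psi> m"
      proof -
        have msum: "(\<Sum>i\<in>UNIV. herm_of (m i)) = (mat 1 :: complex^'d^'d)"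
          unfolding m_def total by (simp add: e_def herm_of_herm_coords)
        have sum: "(\<Sum>i\<in>UNIV. R ** herm_of (m i) ** R) = herm_of y"
        proof -
          have "(\<Sum>i\<in>UNIV. R ** herm_of (m i) ** R) = R ** (\<Sum>i\<in>UNIV. herm_of (m i)) ** R"
            by (simp add: bounded_bilinear.sum_right[OF bounded_bilinear_matrix_mult]
                bounded_bilinear.sum_left[OF bounded_bilinear_matrix_mult])
          then show ?thesis
            by (simp add: msum R)
        qed
        have "matrix_inv R ** (R ** A ** R) ** matrix_inv R = A" for A
        proof -
          have "matrix_inv R ** (R ** A ** R) ** matrix_inv R = (matrix_inv R ** R) ** A ** (R ** matrix_inv R)"
            by (simp add: matrix_mul_assoc)
          then show ?thesis
            by (simp add: matrix_inv_left[OF R(2)] matrix_inv_right[OF R(2)])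
        qed
        \<comment> \<open>The matrices sum to \<open>herm_of y\<close>, so
          \<open>normalize_povm\<close> uses the inverse of the same root \<open>R\<close> and
          undoes the substitution exactly.\<close>
        then have norm: "normalize_povm (\<chi> i. herm_of (\<rho> (m i))) = (\<chi> i. herm_of (m i))"
          by (simp add: normalize_povm_def \<rho> sum flip: R_def)
        have "(\<Prod>i\<in>UNIV. wishart_weight (s i) (herm_of (\<rho> (m i)))) =
            (\<Prod>i\<in>UNIV. exp (- Re (trace (R ** herm_of (m i) ** R)))) *
            (\<Prod>i\<in>UNIV. Re (det (herm_of y :: complex^'d^'d)) powr (s i - real CARD('d))) *
            povm_weight s (\<chi> i. herm_of (m i))"
          using psd_det_powr_congruence[OF R(2)]
          by (simp add: wishart_weight_psd_det_powr \<rho> povm_weight_def R(1) r prod.distrib mult.assoc)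
        also have "(\<Prod>i\<in>UNIV. exp (- Re (trace (R ** herm_of (m i) ** R)))) =
            exp (- Re (trace (\<Sum>i\<in>UNIV. R ** herm_of (m i) ** R)))"
        proof -
          have "trace (\<Sum>i\<in>UNIV. A i) = (\<Sum>i\<in>UNIV. trace (A i))" for A :: "'k \<Rightarrow> complex^'d^'d"
            by (simp add: trace_def) (rule sum.swap)
          then show ?thesis
            by (simp add: exp_sum flip: sum_negf)
        qed
        finally show ?thesis
          unfolding \<Phi>_def \<Psi>_def norm sum
          by (simp add: ennreal_mult povm_weight_nonneg prod_nonneg mult.assoc)
      qed
      ultimately show "\<Phi> ((\<lambda>i\<in>I. \<rho> (x i))(j := y - (\<Sum>i\<in>I. (\<lambda>i\<in>I. \<rho> (x i)) i))) =
        ennreal (exp (- Re (trace (herm_of y :: complex^'d^'d))) *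
          (\<Prod>i\<in>UNIV. Re (det (herm_of y :: complex^'d^'d)) powr (s i - real CARD('d)))) * \<Psi> (x(j := e - (\<Sum>i\<in>I. x i)))"
        by (simp add: m_def)
    qed
    also have "(\<integral>\<^sup>+x. ennreal (exp (- Re (trace (herm_of y :: complex^'d^'d))) *
          (\<Prod>i\<in>UNIV. Re (det (herm_of y :: complex^'d^'d)) powr (s i - real CARD('d)))) *
          \<Psi> (x(j := e - (\<Sum>i\<in>I. x i))) \<partial>PiM I (\<lambda>_. lborel)) =
        ennreal (exp (- Re (trace (herm_of y :: complex^'d^'d))) *
          (\<Prod>i\<in>UNIV. Re (det (herm_of y :: complex^'d^'d)) powr (s i - real CARD('d)))) *
        (\<integral>\<^sup>+x. \<Psi> (x(j := e - (\<Sum>i\<in>I. x i))) \<partial>PiM I (\<lambda>_. lborel))"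
      by (rule nn_integral_cmult) measurable
    \<comment> \<open>As |det R|^2 = det y, the k - 1 free variables together contribute (det y)^(d
      (k - 1)).\<close>
    also have "?c ^ card I = Re (det (herm_of y :: complex^'d^'d)) ^ (CARD('d) * (CARD('k) - 1))"
      by (simp add: power_mult r I(4))
    also have "ennreal \<dots> * (ennreal (exp (- Re (trace (herm_of y :: complex^'d^'d))) *
          (\<Prod>i\<in>UNIV. Re (det (herm_of y :: complex^'d^'d)) powr (s i - real CARD('d)))) *
        (\<integral>\<^sup>+x. \<Psi> (x(j := e - (\<Sum>i\<in>I. x i))) \<partial>PiM I (\<lambda>_. lborel))) =
      ennreal (sum_weight s (herm_of y :: complex^'d^'d)) *
        (\<integral>\<^sup>+x. \<Psi> (x(j := e - (\<Sum>i\<in>I. x i))) \<partial>PiM I (\<lambda>_. lborel))"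
    proof -
      let ?r = "Re (det (herm_of y :: complex^'d^'d))"
      let ?a = "exp (- Re (trace (herm_of y :: complex^'d^'d))) * (\<Prod>i\<in>UNIV. ?r powr (s i - real CARD('d)))"
      let ?q = "?r ^ (CARD('d) * (CARD('k) - 1))"
      have "sum_weight s (herm_of y :: complex^'d^'d) = ?q * ?a"
        using True by (simp add: sum_weight_def)
      also have "ennreal \<dots> = ennreal ?q * ennreal ?a"
        using r_pos by (intro ennreal_mult) (auto intro!: mult_nonneg_nonneg prod_nonneg)
      finally show ?thesis
        by (simp only: mult.assoc)
    qed
    finally show ?thesis .
  qed
qed

section \<open>The delta measure in real coordinates\<close>

lemma PiM_lebesgue_herm:
  assumes "finite I"
  shows "PiM I (\<lambda>_. lebesgue_herm :: (complex^'d^'d) measure) =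
    distr (PiM I (\<lambda>_. lborel)) (PiM I (\<lambda>_. borel)) (\<lambda>x. \<lambda>i\<in>I. herm_of (x i))"
  unfolding lebesgue_herm_def
  by (rule distr_PiM_componentwise[symmetric])
    (use assms sigma_finite_lebesgue_herm[where 'd = 'd] in \<open>auto simp: sigma_finite_lborel lebesgue_herm_def\<close>)

lemma measurable_delta_map:
  "(\<lambda>m. \<chi> i. if i = j then mat 1 - (\<Sum>l\<in>UNIV - {j}. m l) else m i) \<in>
    borel_measurable (PiM (UNIV - {j}) (\<lambda>_. borel :: (complex^'d^'d) measure))"
proof (intro borel_measurable_vec_lambda)
  show "(\<lambda>m. if i = j then mat 1 - (\<Sum>l\<in>UNIV - {j}. m l) else m i) \<in>
    borel_measurable (PiM (UNIV - {j}) (\<lambda>_. borel :: (complex^'d^'d) measure))" for i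
    by (cases "i = j") auto
qed

text \<open>By linearity of \<open>herm_of\<close>, the identity minus the other matrices is again
  \<open>herm_of\<close> of a coordinate matrix. This gives the delta measure the shape of an
  integral over a fixed sum, with the sum equal to the identity.\<close>

lemma nn_integral_delta_sum_one:
  fixes F :: "(complex^'d^'d)^'k::finite \<Rightarrow> ennreal"
  assumes [measurable]: "F \<in> borel_measurable borel"
  shows "(\<integral>\<^sup>+m. F m \<partial>delta_sum_one j) =
    (\<integral>\<^sup>+x. F (\<chi> i. herm_of ((x(j := herm_coords (mat 1) - (\<Sum>l\<in>UNIV - {j}. x l))) i)) \<partial>PiM (UNIV - {j}) (\<lambda>_. lborel))"
proof -
  let ?I = "UNIV - {j}"
  let ?g = "\<lambda>m. (\<chi> i. if i = j then mat 1 - (\<Sum>l\<in>?I. m l) else m i) :: (complex^'d^'d)^'k"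
  have g [measurable]: "?g \<in> borel_measurable (PiM ?I (\<lambda>_. borel))"
    by (rule measurable_delta_map)
  have [measurable_cong]: "sets (PiM ?I (\<lambda>_. lebesgue_herm :: (complex^'d^'d) measure)) = sets (PiM ?I (\<lambda>_. borel))"
    "sets (PiM ?I (\<lambda>_. lborel :: (real^'d^'d) measure)) = sets (PiM ?I (\<lambda>_. borel))"
    by (auto intro!: sets_PiM_cong)
  have "(\<integral>\<^sup>+m. F m \<partial>delta_sum_one j) = (\<integral>\<^sup>+m. F (?g m) \<partial>PiM ?I (\<lambda>_. lebesgue_herm))"
    unfolding delta_sum_one_def by (rule nn_integral_distr) measurable
  also have "\<dots> = (\<integral>\<^sup>+x. F (?g (\<lambda>i\<in>?I. herm_of (x i))) \<partial>PiM ?I (\<lambda>_. lborel))"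
  proof (subst PiM_lebesgue_herm)
    show "(\<integral>\<^sup>+m. F (?g m) \<partial>distr (PiM ?I (\<lambda>_. lborel)) (PiM ?I (\<lambda>_. borel)) (\<lambda>x. \<lambda>i\<in>?I. herm_of (x i))) =
        (\<integral>\<^sup>+x. F (?g (\<lambda>i\<in>?I. herm_of (x i))) \<partial>PiM ?I (\<lambda>_. lborel))"
    proof (rule nn_integral_distr)
      show "(\<lambda>x. \<lambda>i\<in>?I. herm_of (x i)) \<in> measurable (PiM ?I (\<lambda>_. lborel)) (PiM ?I (\<lambda>_. borel))"
        by (intro measurable_restrict) simp
    qed measurable
  qed simp
  also have "(\<lambda>x. ?g (\<lambda>i\<in>?I. herm_of (x i))) =
      (\<lambda>x. \<chi> i. herm_of ((x(j := herm_coords (mat 1) - (\<Sum>l\<in>?I. x l))) i))"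
  proof (intro ext, subst vec_eq_iff, intro allI)
    show "?g (\<lambda>i\<in>?I. herm_of (x i)) $ i =
        (\<chi> i. herm_of ((x(j := herm_coords (mat 1) - (\<Sum>l\<in>?I. x l))) i)) $ i" for x i
      by (simp add: linear_diff[OF linear_herm_of] herm_of_sum herm_of_herm_coords)
  qed
  finally show ?thesis
    by simp
qed

text \<open>The variable \<open>j\<close> is the one traded for S. It enters only through the delta
  measure, not through the two constant factors in front, so all choices of \<open>j\<close> share
  one constant.\<close>

lemma nn_integral_wishart_povm:
  fixes W :: "'k::finite \<Rightarrow> 'w \<Rightarrow> complex^'d^'d" and F :: "(complex^'d^'d)^'k \<Rightarrow> ennreal" and j :: 'k
  assumes M: "prob_space M" and indep: "prob_space.indep_vars M (\<lambda>_. borel) W UNIV"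
    and W: "\<And>i. wishart_matrix M (s i) (W i)" and s: "\<And>i. real CARD('d) \<le> s i"
    and F [measurable]: "F \<in> borel_measurable borel"
  defines "Z \<equiv> \<lambda>i. enn2real (\<integral>\<^sup>+w. ennreal (wishart_weight (s i) (w :: complex^'d^'d)) \<partial>lebesgue_herm)"
  shows "(\<integral>\<^sup>+\<omega>. F (normalize_povm (\<chi> i. W i \<omega>)) \<partial>M) =
    ennreal (\<Prod>i\<in>UNIV. 1 / Z i) * (\<integral>\<^sup>+y. ennreal (sum_weight s (herm_of y :: complex^'d^'d)) \<partial>lborel) *
    (\<integral>\<^sup>+m. ennreal (povm_weight s m) * F m \<partial>delta_sum_one j)"
proof -
  let ?L = "lebesgue_herm :: (complex^'d^'d) measure"
  let ?N = "PiM UNIV (\<lambda>_. borel) :: ('k \<Rightarrow> complex^'d^'d) measure"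
  let ?U = "PiM UNIV (\<lambda>_. lborel) :: ('k \<Rightarrow> real^'d^'d) measure"
  define \<phi> where "\<phi> i w = ennreal (wishart_weight (s i) w / Z i)" for i and w :: "complex^'d^'d"
  have Z: "0 < Z i" and law: "distr M borel (W i) = density ?L (\<phi> i)" for i
    using wishart_matrix_law[OF M W s] by (simp_all add: Z_def \<phi>_def[abs_def])
  have [measurable]: "W i \<in> borel_measurable M" for i
    using W by (simp add: wishart_matrix_def)
  have [measurable]: "\<phi> i \<in> borel_measurable borel" for i
    unfolding \<phi>_def by measurable
  have [measurable_cong]: "sets (PiM UNIV (\<lambda>_. ?L)) = sets ?N" "sets ?U = sets (PiM UNIV (\<lambda>_. borel))"
    by (auto intro!: sets_PiM_cong)
  have vl [measurable]: "vec_lambda \<in> borel_measurable ?N"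
    by (intro borel_measurable_vec_lambda) auto
  have pr [measurable]: "(\<lambda>x. \<Prod>i\<in>UNIV. \<phi> i (x i)) \<in> borel_measurable ?N"
    by measurable
  have joint: "distr M ?N (\<lambda>\<omega>. \<lambda>i\<in>UNIV. W i \<omega>) = PiM UNIV (\<lambda>i. distr M borel (W i))"
    by (rule prob_space.indep_vars_iff_distr_eq_PiM[OF M, THEN iffD1]) (use indep in auto)
  have "(\<integral>\<^sup>+\<omega>. F (normalize_povm (\<chi> i. W i \<omega>)) \<partial>M) =
      (\<integral>\<^sup>+x. F (normalize_povm (vec_lambda x)) \<partial>distr M ?N (\<lambda>\<omega>. \<lambda>i\<in>UNIV. W i \<omega>))"
  proof -
    have "(\<lambda>\<omega>. \<lambda>i\<in>UNIV. W i \<omega>) \<in> measurable M ?N"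
      by (intro measurable_restrict) simp
    moreover have "(\<lambda>x. F (normalize_povm (vec_lambda x))) \<in> borel_measurable ?N"
      by (rule measurable_compose[OF vl]) measurable
    ultimately show ?thesis
      by (subst nn_integral_distr) (simp_all add: restrict_UNIV)
  qed
  also have "\<dots> = (\<integral>\<^sup>+x. F (normalize_povm (vec_lambda x)) \<partial>density (PiM UNIV (\<lambda>_. ?L)) (\<lambda>x. \<Prod>i\<in>UNIV. \<phi> i (x i)))"
  proof -
    have "PiM UNIV (\<lambda>i. density ?L (\<phi> i)) = density (PiM UNIV (\<lambda>_. ?L)) (\<lambda>x. \<Prod>i\<in>UNIV. \<phi> i (x i))"
    proof (rule PiM_density_eq)
      show "sigma_finite_measure (density ?L (\<phi> i))" for i
        by (subst sigma_finite_measure.sigma_finite_iff_density_finite[OF sigma_finite_lebesgue_herm])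
          (auto simp: \<phi>_def)
    qed (auto simp: sigma_finite_lebesgue_herm)
    then show ?thesis
      by (simp only: joint law)
  qed
  also have "\<dots> = (\<integral>\<^sup>+x. (\<Prod>i\<in>UNIV. \<phi> i (x i)) * F (normalize_povm (vec_lambda x)) \<partial>PiM UNIV (\<lambda>_. ?L))"
    by (rule nn_integral_density) measurable
  also have "\<dots> = (\<integral>\<^sup>+X. (\<Prod>i\<in>UNIV. \<phi> i (herm_of (X i))) * F (normalize_povm (\<chi> i. herm_of (X i))) \<partial>?U)"
  proof (subst PiM_lebesgue_herm)
    have "(\<integral>\<^sup>+x. (\<Prod>i\<in>UNIV. \<phi> i (x i)) * F (normalize_povm (vec_lambda x)) \<partial>distr ?U ?N (\<lambda>x. \<lambda>i\<in>UNIV. herm_of (x i))) =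
      (\<integral>\<^sup>+X. (\<Prod>i\<in>UNIV. \<phi> i ((\<lambda>i\<in>UNIV. herm_of (X i)) i)) *
        F (normalize_povm (vec_lambda (\<lambda>i\<in>UNIV. herm_of (X i)))) \<partial>?U)"
    proof (rule nn_integral_distr)
      show "(\<lambda>x. \<lambda>i\<in>UNIV. herm_of (x i)) \<in> measurable ?U ?N"
        by (intro measurable_restrict) simp
    qed measurable
    then show "(\<integral>\<^sup>+x. (\<Prod>i\<in>UNIV. \<phi> i (x i)) * F (normalize_povm (vec_lambda x)) \<partial>distr ?U ?N (\<lambda>x. \<lambda>i\<in>UNIV. herm_of (x i))) =
        (\<integral>\<^sup>+X. (\<Prod>i\<in>UNIV. \<phi> i (herm_of (X i))) * F (normalize_povm (\<chi> i. herm_of (X i))) \<partial>?U)"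
      by (simp add: restrict_UNIV)
  qed simp
  finally have lebesgue: "(\<integral>\<^sup>+\<omega>. F (normalize_povm (\<chi> i. W i \<omega>)) \<partial>M) =
    (\<integral>\<^sup>+X. (\<Prod>i\<in>UNIV. \<phi> i (herm_of (X i))) * F (normalize_povm (\<chi> i. herm_of (X i))) \<partial>?U)" .

  define \<Phi> where "\<Phi> X = ennreal (\<Prod>i\<in>UNIV. wishart_weight (s i) (herm_of (X i) :: complex^'d^'d)) *
    F (normalize_povm (\<chi> i. herm_of (X i)))" for X
  have \<Phi>_vec: "\<Phi> X = (\<lambda>m. ennreal (\<Prod>i\<in>UNIV. wishart_weight (s i) (m $ i)) * F (normalize_povm m)) (\<chi> i. herm_of (X i))" for X
    by (simp add: \<Phi>_def)
  have "(\<lambda>X. (\<chi> i. herm_of (X i)) :: (complex^'d^'d)^'k) \<in> borel_measurable ?U"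
    by (intro borel_measurable_vec_lambda) measurable
  then have [measurable]: "\<Phi> \<in> borel_measurable ?U"
    unfolding \<Phi>_vec[abs_def] by measurable
  have "(\<Prod>i\<in>UNIV. \<phi> i (herm_of (X i))) * F (normalize_povm (\<chi> i. herm_of (X i))) =
      ennreal (\<Prod>i\<in>UNIV. 1 / Z i) * \<Phi> X" for X
  proof -
    have "(\<Prod>i\<in>UNIV. \<phi> i (herm_of (X i))) = ennreal ((\<Prod>i\<in>UNIV. 1 / Z i) * (\<Prod>i\<in>UNIV. wishart_weight (s i) (herm_of (X i))))"
      using Z unfolding \<phi>_def
      by (subst prod_ennreal) (auto simp: wishart_weight_nonneg less_imp_le prod_dividef)
    also have "\<dots> = ennreal (\<Prod>i\<in>UNIV. 1 / Z i) * ennreal (\<Prod>i\<in>UNIV. wishart_weight (s i) (herm_of (X i)))"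
      using Z by (intro ennreal_mult prod_nonneg) (auto simp: wishart_weight_nonneg less_imp_le)
    finally show ?thesis
      by (simp add: \<Phi>_def mult.assoc)
  qed
  then have "(\<integral>\<^sup>+X. (\<Prod>i\<in>UNIV. \<phi> i (herm_of (X i))) * F (normalize_povm (\<chi> i. herm_of (X i))) \<partial>?U) =
      ennreal (\<Prod>i\<in>UNIV. 1 / Z i) * (\<integral>\<^sup>+X. \<Phi> X \<partial>?U)"
    by (simp add: nn_integral_cmult)
  also have "(\<integral>\<^sup>+X. \<Phi> X \<partial>?U) = (\<integral>\<^sup>+y. ennreal (sum_weight s (herm_of y :: complex^'d^'d)) \<partial>lborel) *
      (\<integral>\<^sup>+m. ennreal (povm_weight s m) * F m \<partial>delta_sum_one j)"
  proof -
    let ?I = "UNIV - {j}"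
    let ?P = "PiM ?I (\<lambda>_. lborel) :: ('k \<Rightarrow> real^'d^'d) measure"
    let ?e = "herm_coords (mat 1 :: complex^'d^'d)"
    interpret product_sigma_finite "\<lambda>_::'k. lborel :: (real^'d^'d) measure"
      by (simp add: product_sigma_finite_def sigma_finite_lborel)
    interpret S: sigma_finite_measure ?P
      by (intro sigma_finite_PiM sigma_finite_lborel) simp
    interpret S: pair_sigma_finite ?P "lborel :: (real^'d^'d) measure" ..
    have ins: "UNIV = insert j ?I"
      by auto
    have [measurable_cong]: "sets ?P = sets (PiM ?I (\<lambda>_. borel))"
      by (intro sets_PiM_cong) auto
    have upd: "(\<lambda>p. (\<chi> i. herm_of (((fst p)(j := snd p + g (fst p))) i)) :: (complex^'d^'d)^'k) \<in>
        borel_measurable (?P \<Otimes>\<^sub>M lborel)" if [measurable]: "g \<in> borel_measurable ?P" for g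
    proof (intro borel_measurable_vec_lambda measurable_compose[OF _ borel_measurable_herm_of])
      show "(\<lambda>p. ((fst p)(j := snd p + g (fst p))) i) \<in> borel_measurable (?P \<Otimes>\<^sub>M lborel)" for i
      proof (cases "i = j")
        case False
        then have "(\<lambda>x. x i) \<in> borel_measurable ?P"
          by (intro measurable_component_borel) auto
        then show ?thesis
          using False by simp
      qed simp
    qed
    have \<Phi>_upd: "(\<lambda>p. \<Phi> ((fst p)(j := snd p + g (fst p)))) \<in> borel_measurable (?P \<Otimes>\<^sub>M lborel)"
      if "g \<in> borel_measurable ?P" for g
      unfolding \<Phi>_vec by (rule measurable_compose[OF upd[OF that]]) measurable
    have sum_meas: "(\<lambda>x. - (\<Sum>i\<in>?I. x i)) \<in> borel_measurable ?P"
      by (intro borel_measurable_uminus borel_measurable_sum measurable_component_borel)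
    have slice: "(\<lambda>y. \<Phi> (x(j := y))) \<in> borel_measurable borel" for x
    proof -
      have "(\<lambda>y. (\<chi> i. herm_of ((x(j := y)) i)) :: (complex^'d^'d)^'k) \<in> borel_measurable borel"
      proof (intro borel_measurable_vec_lambda measurable_compose[OF _ borel_measurable_herm_of])
        show "(\<lambda>y. (x(j := y)) i) \<in> borel_measurable borel" for i
          by (cases "i = j") auto
      qed
      then show ?thesis
        unfolding \<Phi>_vec by (rule measurable_compose) measurable
    qed
    have "(\<integral>\<^sup>+X. \<Phi> X \<partial>?U) = (\<integral>\<^sup>+X. \<Phi> X \<partial>PiM (insert j ?I) (\<lambda>_. lborel))"
      by (simp flip: ins)
    also have "\<dots> = (\<integral>\<^sup>+x. (\<integral>\<^sup>+y. \<Phi> (x(j := y)) \<partial>lborel) \<partial>?P)"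
    proof (rule product_nn_integral_insert)
      show "\<Phi> \<in> borel_measurable (PiM (insert j ?I) (\<lambda>_. lborel))"
        by (simp flip: ins)
    qed auto
    \<comment> \<open>With the other variables fixed, translating variable \<open>j\<close> makes
      \<open>y\<close> the coordinate of the sum S of all matrices.\<close>
    also have "\<dots> = (\<integral>\<^sup>+x. (\<integral>\<^sup>+y. \<Phi> (x(j := y + - (\<Sum>i\<in>?I. x i))) \<partial>lborel) \<partial>?P)"
      by (subst nn_integral_lborel_translate[OF slice]) simp
    \<comment> \<open>The integral over S becomes the outer one, so that the substitution can be
      made with S fixed.\<close>
    also have "\<dots> = (\<integral>\<^sup>+y. (\<integral>\<^sup>+x. \<Phi> (x(j := y + - (\<Sum>i\<in>?I. x i))) \<partial>?P) \<partial>lborel)"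
      using \<Phi>_upd[OF sum_meas] by (intro S.Fubini'[symmetric]) (simp add: split_beta')
    also have "\<dots> = (\<integral>\<^sup>+y. ennreal (sum_weight s (herm_of y :: complex^'d^'d)) *
        (\<integral>\<^sup>+m. ennreal (povm_weight s m) * F m \<partial>delta_sum_one j) \<partial>lborel)"
    proof (rule nn_integral_cong)
      fix y
      have "(\<integral>\<^sup>+x. \<Phi> (x(j := y - (\<Sum>i\<in>?I. x i))) \<partial>?P) = ennreal (sum_weight s (herm_of y :: complex^'d^'d)) *
          (\<integral>\<^sup>+x. ennreal (povm_weight s (\<chi> i. herm_of ((x(j := ?e - (\<Sum>i\<in>?I. x i))) i))) *
            F (\<chi> i. herm_of ((x(j := ?e - (\<Sum>i\<in>?I. x i))) i)) \<partial>?P)"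
        unfolding \<Phi>_def by (rule nn_integral_fixed_sum[OF F])
      also have "\<dots> = ennreal (sum_weight s (herm_of y :: complex^'d^'d)) *
          (\<integral>\<^sup>+m. ennreal (povm_weight s m) * F m \<partial>delta_sum_one j)"
        by (subst nn_integral_delta_sum_one) auto
      finally show "(\<integral>\<^sup>+x. \<Phi> (x(j := y + - (\<Sum>i\<in>?I. x i))) \<partial>?P) =
          ennreal (sum_weight s (herm_of y :: complex^'d^'d)) *
          (\<integral>\<^sup>+m. ennreal (povm_weight s m) * F m \<partial>delta_sum_one j)"
        by simp
    qed
    also have "\<dots> = (\<integral>\<^sup>+y. ennreal (sum_weight s (herm_of y :: complex^'d^'d)) \<partial>lborel) *
        (\<integral>\<^sup>+m. ennreal (povm_weight s m) * F m \<partial>delta_sum_one j)"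
      by (rule nn_integral_multc) measurable
    finally show ?thesis .
  qed
  finally show ?thesis
    by (simp only: lebesgue mult.assoc)
qed

theorem theorem5p13:
  fixes s :: "'k::finite \<Rightarrow> real"
  assumes "\<And>i. real CARD('d::finite) \<le> s i"
  shows "\<exists>C::real. C > 0 \<and>
    (\<forall>(M :: 'w measure) (P :: 'w \<Rightarrow> (complex^'d^'d)^'k) (j :: 'k).
       wishart_povm M s P \<longrightarrow>
       P \<in> borel_measurable M \<and>
       distr M borel P =
         density (delta_sum_one j)
           (\<lambda>m. ennreal (C * (\<Prod>i\<in>UNIV.
              indicator {a. psd a} (m $ i) * Re (det (m $ i)) powr (s i - real CARD('d))))))"
proof -
  define Z where "Z i = enn2real (\<integral>\<^sup>+w. ennreal (wishart_weight (s i) (w :: complex^'d^'d)) \<partial>lebesgue_herm)" for i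
  define \<A> where "\<A> = ennreal (\<Prod>i\<in>UNIV. 1 / Z i) *
    (\<integral>\<^sup>+y. ennreal (sum_weight s (herm_of y :: complex^'d^'d)) \<partial>lborel)"
  \<comment> \<open>\<open>\<A>\<close> is known to be positive and finite only once some
    Wishart-random POVM exists; the value 1 keeps \<open>C\<close> positive if there is none over
    the type \<open>'w\<close>.\<close>
  define C where "C = (if 0 < enn2real \<A> then enn2real \<A> else 1)"
  have weight: "(\<Prod>i\<in>UNIV. indicator {a. psd a} (m $ i) * Re (det (m $ i)) powr (s i - real CARD('d))) = povm_weight s m"
    for m :: "(complex^'d^'d)^'k"
    by (simp add: povm_weight_def psd_det_powr_def)
  have "P \<in> borel_measurable M \<and> distr M borel P = density (delta_sum_one j) (\<lambda>m. ennreal (C * povm_weight s m))"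
    if povm: "wishart_povm M s P" for M :: "'w measure" and P :: "'w \<Rightarrow> (complex^'d^'d)^'k" and j
  proof -
    obtain W where M: "prob_space M" and indep: "prob_space.indep_vars M (\<lambda>_. borel) W UNIV"
      and W: "\<And>i. wishart_matrix M (s i) (W i)" and P: "P = (\<lambda>\<omega>. normalize_povm (\<chi> i. W i \<omega>))"
      using povm by (auto simp: wishart_povm_def)
    have [measurable]: "W i \<in> borel_measurable M" for i
      using W by (simp add: wishart_matrix_def)
    have P_meas [measurable]: "P \<in> borel_measurable M"
      unfolding P by measurable
    have law: "(\<integral>\<^sup>+\<omega>. F (P \<omega>) \<partial>M) = \<A> * (\<integral>\<^sup>+m. ennreal (povm_weight s m) * F m \<partial>delta_sum_one j)"
      if "F \<in> borel_measurable borel" for F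
      unfolding P \<A>_def Z_def by (rule nn_integral_wishart_povm[OF M indep W assms that])
    \<comment> \<open>Taking F = 1, the total mass 1 is \<open>\<A>\<close> times an integral, so
      \<open>\<A>\<close> can be neither 0 nor infinite.\<close>
    have "\<A> * (\<integral>\<^sup>+m. ennreal (povm_weight s (m :: (complex^'d^'d)^'k)) \<partial>delta_sum_one j) = 1"
      using law[of "\<lambda>_. 1"] prob_space.emeasure_space_1[OF M] by simp
    then have "\<A> \<noteq> 0" "\<A> \<noteq> \<infinity>"
      by (auto simp: ennreal_top_mult split: if_splits)
    then have C: "0 < C" "\<A> = ennreal C"
      by (cases \<A>; simp add: C_def)+
    have [measurable_cong]: "sets (delta_sum_one j) = sets (borel :: ((complex^'d^'d)^'k) measure)"
      by (simp add: delta_sum_one_def)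
    have "distr M borel P = density (delta_sum_one j) (\<lambda>m. ennreal (C * povm_weight s m))"
    proof (rule measure_eqI)
      fix A assume "A \<in> sets (distr M borel P)"
      then have [measurable]: "A \<in> sets borel"
        by simp
      have "emeasure (distr M borel P) A = (\<integral>\<^sup>+\<omega>. indicator A (P \<omega>) \<partial>M)"
        using nn_integral_distr[of P M borel "indicator A"] by simp
      also have "\<dots> = \<A> * (\<integral>\<^sup>+m. ennreal (povm_weight s m) * indicator A m \<partial>delta_sum_one j)"
        by (rule law) measurable
      also have "\<dots> = (\<integral>\<^sup>+m. ennreal (C * povm_weight s m) * indicator A m \<partial>delta_sum_one j)"
        using C(1) by (simp add: C(2) ennreal_mult povm_weight_nonneg mult.assoc nn_integral_cmult)
      also have "\<dots> = emeasure (density (delta_sum_one j) (\<lambda>m. ennreal (C * povm_weight s m))) A"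
        by (rule emeasure_density[symmetric]) measurable
      finally show "emeasure (distr M borel P) A =
        emeasure (density (delta_sum_one j) (\<lambda>m. ennreal (C * povm_weight s m))) A" .
    qed (simp add: delta_sum_one_def)
    with P_meas show ?thesis
      by blast
  qed
  then show ?thesis
    unfolding weight by (intro exI[of _ C]) (auto simp: C_def)
qed

end
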